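(* Let $n\ge 2$, $l\ge 1$, let $\mathcal{A}_1,\dots,\mathcal{A}_l\subset\{0,1,\dots,n-1\}$ be non-empty, let $K_1,\dots,K_l\subset[0,1]$ be the self-similar sets $K_i=\bigcup_{a\in\mathcal{A}_i}\frac{K_i+a}{n}$, and let $\mathbf{m}=(m_1,\dots,m_l)\in\mathbb{Z}^l$ with $\prod_i m_i\ne 0$. Let $U_r$, the covering condition, the set $\Xi$, the graph $G_\Xi$ with transition matrix $M$, the graph $G^*$ with its strongly connected components $\{\Omega_j\}_j$, the numbers $\rho(\Omega_j)$, the order $\prec$, and the notions of "reaching" and "dominated" be as defined in the context. Suppose the covering condition holds for $\prod_{i=1}^lK_i$ with respect to $\mathbf{m}$. Let $r\ge 2$ be an integer with $U_r\ne\emptyset$ and let $d_r=\dim_HU_r$. (1) Then $d_r\le\frac{\log\rho(M)}{\log n}$. (2) Assume moreover that every $K_i$ satisfies the strong separation condition (i.e. $1\notin\mathcal{A}_i-\mathcal{A}_i$ for all $i$). Then either $U_r$ is countable, or $$d_r\in\Big\{\max\Big\{\tfrac{\log\rho(\Omega_j)}{\log n}:\Omega_i\prec\Omega_j\Big\}\ :\ \Omega_i\text{ a strongly connected component of }G^*\Big\}\setminus\{0\}\quad\text{and}\quad\mathcal{H}^{d_r}(U_r)>0.$$ (3) Suppose every $K_i$ satisfies the strong separation condition, $d_r>0$, and $[m_*,m^*]$ is dominated by $\Xi$ for $d_r$. Then $\mathcal{H}^{d_r}(U_r)=\infty$. In particular, if every $K_i$ satisfies the strong separation condition, $d_r>0$,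 $M$ is irreducible and the elements of $\Xi$ can reach every working interval, then $\mathcal{H}^{d_r}(U_r)=\infty$.
   Context: $K_i$ is the unique non-empty compact set with $K_i=\bigcup_{a\in\mathcal{A}_i}n^{-1}(K_i+a)$. $(\cdot,\cdot)$ is the standard inner product on $\mathbb{R}^l$; for $B\subset\mathbb{R}^l$, $(\mathbf{m},B)=\{(\mathbf{m},b):b\in B\}$. $\dim_H$ and $\mathcal{H}^d$ denote Hausdorff dimension and $d$-dimensional Hausdorff measure. "Countable" means at most countable. $\log 0=-\infty$. For $x\in\mathbb{R}$, $S_x=\{\mathbf{y}\in\prod_{i=1}^lK_i:(\mathbf{m},\mathbf{y})=x\}$, and for $r\in\mathbb{N}^+$, $U_r=\{x:\mathrm{Card}(S_x)=r\}$. Let $m_*=\sum_{m_i<0}m_i$ and $m^*=\sum_{m_i>0}m_i$ (empty sums are $0$), so $(\mathbf{m},[0,1]^l)=[m_*,m^*]$. For $\mathbf{i}\in\prod_{i=1}^l\mathcal{A}_i$ let $\mathbf{c}_{\mathbf{i}}=\frac{\mathbf{i}+[0,1]^l}{n}$, so $(\mathbf{m},\mathbf{c}_{\mathbf{i}})=n^{-1}((\mathbf{m},\mathbf{i})+[m_*,m^*])$. The covering condition holds for $\prod_{i=1}^l K_i$ with respect to $\mathbf{m}$ if $\bigcup_{\mathbf{i}\in\prod_{i=1}^l\mathcal{A}_i}(\mathbf{m},\mathbf{c}_{\mathbf{i}})=[m_*,m^*]$. An integer interval is an interval $I=n^{-1}[u,u+1]\subset[m_*,m^*]$ with $u\in\mathbb{Z}$.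 The working intervals are $J_t=[t,t+1]$, $t\in[m_*,m^*-1]\cap\mathbb{Z}$. An integer interval $I=n^{-1}[u,u+1]$ is of type $t\in[m_*,m^*-1]\cap\mathbb{Z}$ if $u-(\mathbf{m},\mathbf{i})=t$ for some $\mathbf{i}\in\prod_{i=1}^l\mathcal{A}_i$. For integer intervals $I_1,I_2$ write $I_1\to I_2$ if there is an integer $t\in[m_*,m^*-1]$ such that $I_1$ is of type $t$ and $I_2\subset J_t$. Two integer intervals $n^{-1}[u_1,u_1+1]$ and $n^{-1}[u_2,u_2+1]$ are congruent if $u_1\equiv u_2\pmod n$. For a strongly connected component $H$ of a directed graph, $\rho(H)$ is the spectral radius of the adjacency matrix of the subgraph restricted to $H$ (a single vertex without a loop is a component of spectral radius $0$). For components $H,H'$, $H\prec H'$ means $H=H'$ or there is a directed path from a vertex of $H$ to a vertex of $H'$. Graph $G_\Xi$: $\Xi$ is the collection of integer intervals $I$ for which there is a unique $\mathbf{i}\in\prod_{i=1}^l\mathcal{A}_i$ with $I\subset(\mathbf{m},\mathbf{c}_{\mathbf{i}})$. $G_\Xi$ has vertex set $\Xi$ and an edge from $I_1$ to $I_2$ iff $I_1\to I_2$. $M$ is its $0$-$1$ transition (adjacency) matrix, $\rho(M)$ its spectral radius, and $\{\Xi_i\}_i$ its strongly connected components. A component $\Xi_i$ can reach $J_t$ if there is a directed path in $G_\Xi$ from a vertex of $\Xi_i$ to a vertex of type $t$; likewise the elements of $\Xi$ can reach $J_t$ if there is a directed path in $G_\Xi$ from a vertex of $\Xi$ to a vertex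 of type $t$. For $d>0$, $[m_*,m^*]$ is dominated by $\Xi$ for $d$ if each working interval $J_t$ can be reached by some $\Xi_i$ with $\frac{\log\rho(\Xi_i)}{\log n}\ge d$. Graph $G^*$: a (non-empty) subset $\omega\subset\Xi$ is congruent if any two of its elements are congruent. The vertices of $G^*$ are all congruent subsets of $\Xi$, and there is a directed edge from $\omega$ to $\omega'$ iff for every $I\in\omega$ there is $I'\in\omega'$ with $I\to I'$, and for every $I'\in\omega'$ there is $I\in\omega$ with $I\to I'$. $\{\Omega_j\}_j$ are the strongly connected components of $G^*$. *)

theory Defs
  imports
    "HOL-Analysis.Analysis"
    "HOL-Number_Theory.Cong"
    "Jordan_Normal_Form.Spectral_Radius"
    "Graph_Theory.Digraph_Component"
begin

no_notation Matrix.vec_index (infixl "$" 100)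
no_notation Matrix.scalar_prod (infix "\<bullet>" 70)

section \<open>Hausdorff measure and dimension\<close>

text \<open>
  The case split keeps the convention that a non-empty set contributes \<open>1\<close> in dimension \<open>0\<close>,
  even if its diameter is \<open>0\<close> (recall \<open>0 powr 0 = 0\<close>).
\<close>
definition diam_power :: "real \<Rightarrow> 'a::metric_space set \<Rightarrow> ennreal" where
  "diam_power s C =
     (if C = {} then 0 else if s = 0 then 1 else ennreal (diameter C powr s))"

text \<open>
  Covers are restricted to bounded sets because \<^const>\<open>diameter\<close> is a real number and is only
  meaningful for these. Finite covers are included by padding with the empty set.
\<close>
definition hausdorff_premeasure :: "real \<Rightarrow> real \<Rightarrow> 'a::metric_space set \<Rightarrow> ennreal" where
  "hausdorff_premeasure s \<delta> E =
     (INF C \<in> {C :: nat \<Rightarrow> 'a set. E \<subseteq> (\<Union>k. C k) \<and> (\<forall>k. bounded (C k) \<and> diameter (C k) \<le> \<delta>)}.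
        \<Sum>k. diam_power s (C k))"

definition hausdorff_measure :: "real \<Rightarrow> 'a::metric_space set \<Rightarrow> ennreal" where
  "hausdorff_measure s E = (SUP \<delta> \<in> {0<..}. hausdorff_premeasure s \<delta> E)"

definition hausdorff_dim :: "'a::metric_space set \<Rightarrow> ereal" where
  "hausdorff_dim E = Inf {ereal s | s. 0 \<le> s \<and> hausdorff_measure s E = 0}"


section \<open>Adjacency matrices of finite directed graphs\<close>

definition digraph_of :: "'a set \<Rightarrow> ('a \<Rightarrow> 'a \<Rightarrow> bool) \<Rightarrow> ('a, 'a \<times> 'a) pre_digraph" where
  "digraph_of V R =
     \<lparr>verts = V, arcs = {(u, v). u \<in> V \<and> v \<in> V \<and> R u v}, tail = fst, head = snd\<rparr>"

text \<open>
  The enumeration of the vertices is arbitrary; a different one conjugates the adjacency matrix by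
  a permutation matrix, which affects neither its spectral radius nor its irreducibility.
\<close>
definition vertex_list :: "('a, 'b) pre_digraph \<Rightarrow> 'a list" where
  "vertex_list G = (SOME vs. distinct vs \<and> set vs = verts G)"

definition adjacency_mat :: "('a, 'b) pre_digraph \<Rightarrow> real mat" where
  "adjacency_mat G = (let vs = vertex_list G in
     Matrix.mat (length vs) (length vs) (\<lambda>(i, j). if vs ! i \<rightarrow>\<^bsub>G\<^esub> vs ! j then 1 else 0))"

text \<open>The spectral radius of the empty matrix is set to \<open>0\<close>.\<close>
definition real_spectral_radius :: "real mat \<Rightarrow> real" where
  "real_spectral_radius M =
     (if dim_row M = 0 then 0 else spectral_radius (map_mat complex_of_real M))"

definition irreducible_nonneg_mat :: "real mat \<Rightarrow> bool" where
  "irreducible_nonneg_mat M \<longleftrightarrow>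
     (\<forall>i < dim_row M. \<forall>j < dim_row M. \<exists>k > 0. (M ^\<^sub>m k) $$ (i, j) > 0)"

abbreviation strong_components :: "('a, 'b) pre_digraph \<Rightarrow> 'a set set" where
  "strong_components G \<equiv> pre_digraph.sccs_verts G"

definition component_radius :: "('a, 'b) pre_digraph \<Rightarrow> 'a set \<Rightarrow> real" where
  "component_radius G H = real_spectral_radius (adjacency_mat (G \<restriction> H))"

definition component_le :: "('a, 'b) pre_digraph \<Rightarrow> 'a set \<Rightarrow> 'a set \<Rightarrow> bool" where
  "component_le G H H' \<longleftrightarrow> H = H' \<or> (\<exists>u \<in> H. \<exists>v \<in> H'. u \<rightarrow>\<^sup>*\<^bsub>G\<^esub> v)"

text \<open>The quotient \<open>log \<rho> / log n\<close> with \<open>log 0 = -\<infinity>\<close>.\<close>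
definition log_ratio :: "nat \<Rightarrow> real \<Rightarrow> ereal" where
  "log_ratio n \<rho> = (if \<rho> = 0 then -\<infinity> else ereal (ln \<rho> / ln (real n)))"


section \<open>Projections of products of self-similar sets\<close>

definition is_self_similar_set :: "nat \<Rightarrow> int set \<Rightarrow> real set \<Rightarrow> bool" where
  "is_self_similar_set n A K \<longleftrightarrow>
     K \<noteq> {} \<and> compact K \<and> K = (\<Union>a \<in> A. (\<lambda>x. (x + real_of_int a) / real n) ` K)"

definition real_vec :: "int ^ 'l \<Rightarrow> real ^ 'l" where
  "real_vec z = (\<chi> k. real_of_int (z $ k))"

definition fibre :: "('l::finite \<Rightarrow> real set) \<Rightarrow> int ^ 'l \<Rightarrow> real \<Rightarrow> (real ^ 'l) set" where
  "fibre K m x = {y. (\<forall>k. y $ k \<in> K k) \<and> real_vec m \<bullet> y = x}"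

text \<open>For \<open>r = 0\<close> this would also contain the points with infinite fibre; only \<open>r > 0\<close> is used.\<close>
definition multiplicity_set :: "('l::finite \<Rightarrow> real set) \<Rightarrow> int ^ 'l \<Rightarrow> nat \<Rightarrow> real set" where
  "multiplicity_set K m r = {x. card (fibre K m x) = r}"

definition m_lower :: "int ^ 'l::finite \<Rightarrow> int" where
  "m_lower m = (\<Sum>k | m $ k < 0. m $ k)"

definition m_upper :: "int ^ 'l::finite \<Rightarrow> int" where
  "m_upper m = (\<Sum>k | m $ k > 0. m $ k)"

definition hull_interval :: "int ^ 'l::finite \<Rightarrow> real set" where
  "hull_interval m = {real_of_int (m_lower m) .. real_of_int (m_upper m)}"

definition digit_vectors :: "('l \<Rightarrow> int set) \<Rightarrow> (int ^ 'l) set" where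
  "digit_vectors A = {i. \<forall>k. i $ k \<in> A k}"

text \<open>Here \<open>1\<close> is the all-ones vector, so \<open>cbox 0 1\<close> is the unit cube.\<close>
definition cell :: "nat \<Rightarrow> int ^ 'l \<Rightarrow> (real ^ 'l::finite) set" where
  "cell n i = (\<lambda>y. (real_vec i + y) /\<^sub>R real n) ` cbox 0 1"

definition cell_projection :: "nat \<Rightarrow> int ^ 'l \<Rightarrow> int ^ 'l::finite \<Rightarrow> real set" where
  "cell_projection n m i = (\<lambda>b. real_vec m \<bullet> b) ` cell n i"

definition covering_condition :: "nat \<Rightarrow> ('l \<Rightarrow> int set) \<Rightarrow> int ^ 'l::finite \<Rightarrow> bool" where
  "covering_condition n A m \<longleftrightarrow> (\<Union>i \<in> digit_vectors A. cell_projection n m i) = hull_interval m"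

text \<open>
  The integer interval \<open>n\<^sup>-\<^sup>1[u, u + 1]\<close> is represented by the integer \<open>u\<close>, and the working interval
  \<open>[t, t + 1]\<close> by the integer \<open>t\<close>.
\<close>
definition interval_of :: "nat \<Rightarrow> int \<Rightarrow> real set" where
  "interval_of n u = {real_of_int u / real n .. (real_of_int u + 1) / real n}"

definition working_interval :: "int \<Rightarrow> real set" where
  "working_interval t = {real_of_int t .. real_of_int t + 1}"

definition integer_intervals :: "nat \<Rightarrow> int ^ 'l::finite \<Rightarrow> int set" where
  "integer_intervals n m = {u. interval_of n u \<subseteq> hull_interval m}"

definition working_types :: "int ^ 'l::finite \<Rightarrow> int set" where
  "working_types m = {m_lower m .. m_upper m - 1}"

definition of_type :: "('l \<Rightarrow> int set) \<Rightarrow> int ^ 'l::finite \<Rightarrow> int \<Rightarrow> int \<Rightarrow> bool" where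
  "of_type A m u t \<longleftrightarrow>
     t \<in> working_types m \<and>
     (\<exists>i \<in> digit_vectors A. real_of_int u - real_vec m \<bullet> real_vec i = real_of_int t)"

definition interval_step :: "nat \<Rightarrow> ('l \<Rightarrow> int set) \<Rightarrow> int ^ 'l::finite \<Rightarrow> int \<Rightarrow> int \<Rightarrow> bool" where
  "interval_step n A m u v \<longleftrightarrow>
     (\<exists>t \<in> working_types m. of_type A m u t \<and> interval_of n v \<subseteq> working_interval t)"

definition Xi :: "nat \<Rightarrow> ('l \<Rightarrow> int set) \<Rightarrow> int ^ 'l::finite \<Rightarrow> int set" where
  "Xi n A m = {u \<in> integer_intervals n m.
     \<exists>!i. i \<in> digit_vectors A \<and> interval_of n u \<subseteq> cell_projection n m i}"

definition graph_Xi :: "nat \<Rightarrow> ('l \<Rightarrow> int set) \<Rightarrow> int ^ 'l::finite \<Rightarrow> (int, int \<times> int) pre_digraph" where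
  "graph_Xi n A m = digraph_of (Xi n A m) (interval_step n A m)"

definition component_reaches ::
    "nat \<Rightarrow> ('l \<Rightarrow> int set) \<Rightarrow> int ^ 'l::finite \<Rightarrow> int set \<Rightarrow> int \<Rightarrow> bool" where
  "component_reaches n A m H t \<longleftrightarrow>
     (\<exists>u \<in> H. \<exists>v. u \<rightarrow>\<^sup>*\<^bsub>graph_Xi n A m\<^esub> v \<and> of_type A m v t)"

definition Xi_reaches :: "nat \<Rightarrow> ('l \<Rightarrow> int set) \<Rightarrow> int ^ 'l::finite \<Rightarrow> int \<Rightarrow> bool" where
  "Xi_reaches n A m t \<longleftrightarrow>
     (\<exists>u \<in> Xi n A m. \<exists>v. u \<rightarrow>\<^sup>*\<^bsub>graph_Xi n A m\<^esub> v \<and> of_type A m v t)"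

definition dominated :: "nat \<Rightarrow> ('l \<Rightarrow> int set) \<Rightarrow> int ^ 'l::finite \<Rightarrow> ereal \<Rightarrow> bool" where
  "dominated n A m d \<longleftrightarrow>
     (\<forall>t \<in> working_types m. \<exists>H \<in> strong_components (graph_Xi n A m).
        component_reaches n A m H t \<and> log_ratio n (component_radius (graph_Xi n A m) H) \<ge> d)"

definition congruent_subset :: "nat \<Rightarrow> int set \<Rightarrow> bool" where
  "congruent_subset n \<omega> \<longleftrightarrow> \<omega> \<noteq> {} \<and> (\<forall>u \<in> \<omega>. \<forall>v \<in> \<omega>. [u = v] (mod int n))"

definition graph_star ::
    "nat \<Rightarrow> ('l \<Rightarrow> int set) \<Rightarrow> int ^ 'l::finite \<Rightarrow> (int set, int set \<times> int set) pre_digraph" where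
  "graph_star n A m = digraph_of
     {\<omega>. \<omega> \<subseteq> Xi n A m \<and> congruent_subset n \<omega>}
     (\<lambda>\<omega> \<omega>'. (\<forall>u \<in> \<omega>. \<exists>v \<in> \<omega>'. interval_step n A m u v) \<and>
             (\<forall>v \<in> \<omega>'. \<exists>u \<in> \<omega>. interval_step n A m u v))"

definition max_exponent ::
    "nat \<Rightarrow> ('l \<Rightarrow> int set) \<Rightarrow> int ^ 'l::finite \<Rightarrow> int set set \<Rightarrow> ereal" where
  "max_exponent n A m H = (let G = graph_star n A m in
     Max {log_ratio n (component_radius G H') | H'. H' \<in> strong_components G \<and> component_le G H H'})"

text \<open>
  This is the condition \<open>1 \<notin> A - A\<close>. It excludes any two consecutive digits, hence is in general
  stronger than mere disjointness of the pieces \<open>(K + a) / n\<close>.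
\<close>
definition strong_separation :: "int set \<Rightarrow> bool" where
  "strong_separation A \<longleftrightarrow> 1 \<notin> {a - b | a b. a \<in> A \<and> b \<in> A}"

end

theory Submission
  imports Defs
begin

text \<open>
  Outside the countable set of \<open>n\<close>-adic points, the expansion of a point of \<open>U\<^sub>1\<close> is eventually an
  infinite path in \<open>G\<^sub>\<Xi>\<close>, and conversely such a path determines a point with a single preimage. A point with
  \<open>r\<close> preimages splits, after finitely many digits, into \<open>r\<close> points of \<open>U\<^sub>1\<close> with the same fractional
  digits. Counting paths bounds the dimension by the spectral radius. Under strong separation the positions of
  these \<open>r\<close> points form an infinite path in \<open>G\<^sup>*\<close>, and every path from the same vertex yields a point of
  \<open>U\<^sub>r\<close>; as every path ends in a strong component, \<open>U\<^sub>r\<close> is up to countable sets a countable union of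
  similar copies of the graph-directed sets of the reachable components. A component of radius
  \<open>\<rho> > 1\<close> has positive measure in dimension \<open>log \<rho> / log n\<close>, and one of radius at most \<open>1\<close> contributes
  countably many points. For the infinite measure, the points of \<open>U\<^sub>r\<close> (\<open>r \<ge> 2\<close>) are sorted by the time
  at which they leave \<open>\<Xi>\<close>: pulling back along the paths of a dominating component gives, for infinitely many exit
  times, pieces whose measures are bounded below.
\<close>

section \<open>Hausdorff measure\<close>

text \<open>Two classical tools are replaced. Instead of a Perron eigenvector, the moduli of an
  eigenvector for an eigenvalue of largest modulus give some h \<ge> 0 with \<rho> h \<le> A h; this
  bounds walk counts from below and drives the lower bound for the measure. Instead of additivity on
  Borel sets, pieces are told apart by finitely many base n digits, that is, by a floor. Off the
  n-adic points, n x is interior to exactly one unit interval, so its floor names the integer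
  interval containing x, and a closed condition on n x becomes a condition on integers. The shifted
  points that different digit words produce from one x differ by integers; one digit later their
  integer parts are congruent mod n. This is the origin of congruent subsets as vertices of G*.
  Without strong separation a preimage may have two digit expansions, so a single preimage need not
  put the interval into \<Xi>, and words do not count preimages. The bound (1) gets by with
  membership in \<Xi> from some digit on; the exact counting behind G* relies on separation.\<close>

lemma ennreal_eq_0I:
  assumes "\<And>e. 0 < e \<Longrightarrow> x \<le> ennreal e" shows "x = 0"
  using ennreal_le_epsilon[of 0 x] assms by simp

lemma ennreal_le_mult_INF:
  fixes f :: "'a \<Rightarrow> ennreal"
  assumes c: "c > 0" and le: "\<And>x. x \<in> S \<Longrightarrow> a \<le> ennreal c * f x"
  shows "a \<le> ennreal c * (INF x\<in>S. f x)"
proof -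
  have inv: "ennreal (1 / c) * (ennreal c * y) = y" "ennreal c * (ennreal (1 / c) * y) = y" for y
    using c by (simp_all flip: mult.assoc ennreal_mult)
  have "ennreal (1 / c) * a \<le> (INF x\<in>S. f x)"
    by (rule INF_greatest) (metis inv(1) le mult_left_mono zero_le)
  then show ?thesis by (metis inv(2) mult_left_mono zero_le)
qed

lemma hausdorff_premeasure_mono:
  assumes "E \<subseteq> F"
  shows "hausdorff_premeasure s \<delta> E \<le> hausdorff_premeasure s \<delta> F"
  unfolding hausdorff_premeasure_def by (rule INF_superset_mono) (use assms in auto)

lemma hausdorff_measure_mono:
  "E \<subseteq> F \<Longrightarrow> hausdorff_measure s E \<le> hausdorff_measure s F"
  unfolding hausdorff_measure_def by (intro SUP_mono) (auto intro: hausdorff_premeasure_mono)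

lemma hausdorff_premeasure_antimono:
  assumes "\<delta> \<le> \<delta>'"
  shows "hausdorff_premeasure s \<delta>' E \<le> hausdorff_premeasure s \<delta> E"
  unfolding hausdorff_premeasure_def by (rule INF_superset_mono) (use assms in \<open>auto intro: order_trans\<close>)

lemma hausdorff_premeasure_le:
  assumes "E \<subseteq> (\<Union>k. C k)" "\<And>k. bounded (C k)" "\<And>k. diameter (C k) \<le> \<delta>"
  shows "hausdorff_premeasure s \<delta> E \<le> (\<Sum>k. diam_power s (C k))"
  unfolding hausdorff_premeasure_def by (rule INF_lower) (use assms in auto)

lemma hausdorff_premeasure_cover:
  assumes "hausdorff_premeasure s \<delta> E < c"
  obtains C where "E \<subseteq> (\<Union>k. C k)" "\<And>k. bounded (C k)" "\<And>k. diameter (C k) \<le> \<delta>"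
    "(\<Sum>k. diam_power s (C k)) < c"
  using assms unfolding hausdorff_premeasure_def INF_less_iff by auto

lemma hausdorff_premeasure_le_measure:
  "0 < \<delta> \<Longrightarrow> hausdorff_premeasure s \<delta> E \<le> hausdorff_measure s E"
  unfolding hausdorff_measure_def by (rule SUP_upper) auto

lemma hausdorff_measure_leI:
  assumes "\<delta>0 > 0" and "\<And>\<delta>. 0 < \<delta> \<Longrightarrow> \<delta> \<le> \<delta>0 \<Longrightarrow> hausdorff_premeasure s \<delta> E \<le> c"
  shows "hausdorff_measure s E \<le> c"
  unfolding hausdorff_measure_def
proof (rule SUP_least)
  fix \<delta> :: real assume "\<delta> \<in> {0<..}"
  then have "hausdorff_premeasure s \<delta> E \<le> hausdorff_premeasure s (min \<delta> \<delta>0) E"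
    by (intro hausdorff_premeasure_antimono) auto
  also have "\<dots> \<le> c" using \<open>\<delta> \<in> {0<..}\<close> assms by auto
  finally show "hausdorff_premeasure s \<delta> E \<le> c" .
qed

lemma hausdorff_measure_null_iff:
  "hausdorff_measure s E = 0 \<longleftrightarrow> (\<forall>\<delta>>0. hausdorff_premeasure s \<delta> E = 0)"
  unfolding hausdorff_measure_def by (auto simp: bot_ennreal[symmetric])

lemma hausdorff_null_Union:
  fixes E :: "nat \<Rightarrow> 'a::metric_space set"
  assumes "\<And>i. hausdorff_measure s (E i) = 0"
  shows "hausdorff_measure s (\<Union>i. E i) = 0"
  unfolding hausdorff_measure_null_iff
proof (intro allI impI)
  fix \<delta> :: real assume d: "\<delta> > 0"
  have "hausdorff_premeasure s \<delta> (\<Union>i. E i) \<le> ennreal e" if e: "e > 0" for e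
  proof -
    have "\<exists>C. E i \<subseteq> (\<Union>k. C k) \<and> (\<forall>k. bounded (C k)) \<and> (\<forall>k. diameter (C k) \<le> \<delta>) \<and>
        (\<Sum>k. diam_power s (C k)) < ennreal (e * (1/2) ^ Suc i)" for i
    proof -
      have "hausdorff_premeasure s \<delta> (E i) < ennreal (e * (1/2) ^ Suc i)"
        using assms[of i] d e unfolding hausdorff_measure_null_iff by (auto simp: ennreal_less_zero_iff)
      from hausdorff_premeasure_cover[OF this] show ?thesis by metis
    qed
    then obtain C where C: "\<And>i. E i \<subseteq> (\<Union>k. C i k)" "\<And>i k. bounded (C i k)"
        "\<And>i k. diameter (C i k) \<le> \<delta>" 
        "\<And>i. (\<Sum>k. diam_power s (C i k)) < ennreal (e * (1/2) ^ Suc i)"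
      by metis
    define D where "D k = (case prod_decode k of (i, j) \<Rightarrow> C i j)" for k
    have "hausdorff_premeasure s \<delta> (\<Union>i. E i) \<le> (\<Sum>k. diam_power s (D k))"
    proof (rule hausdorff_premeasure_le)
      show "(\<Union>i. E i) \<subseteq> (\<Union>k. D k)"
      proof safe
        fix x i assume "x \<in> E i"
        then obtain k where "x \<in> C i k" using C(1) by blast
        then have "x \<in> D (prod_encode (i, k))" by (simp add: D_def)
        then show "x \<in> (\<Union>k. D k)" by blast
      qed
    qed (auto simp: D_def C split: prod.split)
    also have "\<dots> = (\<Sum>k. case prod_decode k of (i, j) \<Rightarrow> diam_power s (C i j))"
      by (intro suminf_cong) (auto simp: D_def split: prod.split)
    also have "\<dots> = (\<Sum>i. \<Sum>j. diam_power s (C i j))"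
      using suminf_ennreal_2dimen[where f = "\<lambda>(i, j). diam_power s (C i j)"
          and g = "\<lambda>i. \<Sum>j. diam_power s (C i j)"] by (simp add: comp_def)
    also have "\<dots> \<le> (\<Sum>i. ennreal (e * (1/2) ^ Suc i))"
      using C(4) by (intro suminf_le) (auto intro: less_imp_le)
    also have "\<dots> = ennreal e"
    proof -
      have "(\<lambda>i. e * (1/2) ^ Suc i) sums (e * 1)"
        by (intro sums_mult power_half_series)
      then have "(\<Sum>i. ennreal (e * (1/2) ^ Suc i)) = ennreal (e * 1)"
        using e by (intro suminf_ennreal_eq) auto
      then show ?thesis by simp
    qed
    finally show ?thesis .
  qed
  then show "hausdorff_premeasure s \<delta> (\<Union>i. E i) = 0" by (rule ennreal_eq_0I)
qed

lemma hausdorff_null_subset: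
  "E \<subseteq> F \<Longrightarrow> hausdorff_measure s F = 0 \<Longrightarrow> hausdorff_measure s E = 0"
  using hausdorff_measure_mono[of E F s] by simp

lemma hausdorff_null_empty: "hausdorff_measure s ({} :: 'a::metric_space set) = 0"
proof -
  have "hausdorff_premeasure s \<delta> ({} :: 'a set) \<le> (\<Sum>k::nat. diam_power s ({} :: 'a set))" if "\<delta> > 0" for \<delta>
    by (rule hausdorff_premeasure_le) (use that in auto)
  then show ?thesis unfolding hausdorff_measure_null_iff by (auto simp: diam_power_def)
qed

lemma hausdorff_null_UN_countable:
  assumes "countable I" "\<And>i. i \<in> I \<Longrightarrow> hausdorff_measure s (E i) = 0"
  shows "hausdorff_measure s (\<Union>i\<in>I. E i) = 0"
proof (cases "I = {}")
  case False
  have "(\<Union>i\<in>I. E i) = (\<Union>k. E (from_nat_into I k))"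
    using range_from_nat_into[OF False assms(1)] by (metis image_image)
  then show ?thesis
    using hausdorff_null_Union[of s "\<lambda>k. E (from_nat_into I k)"] assms(2) from_nat_into[OF False] by simp
qed (simp add: hausdorff_null_empty)

lemma hausdorff_null_Un:
  assumes "hausdorff_measure s E = 0" "hausdorff_measure s F = 0"
  shows "hausdorff_measure s (E \<union> F) = 0"
  using hausdorff_null_UN_countable[of "{E, F}" s "\<lambda>x. x"] assms by auto

lemma hausdorff_null_sing:
  assumes "s > 0" shows "hausdorff_measure s {x} = 0"
proof -
  have "hausdorff_premeasure s \<delta> {x} \<le> (\<Sum>k::nat. diam_power s {x})" if "\<delta> > 0" for \<delta>
    by (rule hausdorff_premeasure_le) (use that in auto)
  moreover have "diam_power s {x} = 0" using assms by (simp add: diam_power_def)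
  ultimately show ?thesis unfolding hausdorff_measure_null_iff by auto
qed

lemma hausdorff_null_countable:
  assumes "s > 0" "countable E" shows "hausdorff_measure s E = 0"
proof -
  have "hausdorff_measure s (\<Union>x\<in>E. {x}) = 0"
    by (rule hausdorff_null_UN_countable[OF assms(2)]) (rule hausdorff_null_sing[OF assms(1)])
  then show ?thesis by simp
qed

lemma diam_power_antimono:
  assumes "0 \<le> s" "s \<le> t" "diameter C \<le> 1" "bounded C"
  shows "diam_power t C \<le> diam_power s C"
proof (cases "C = {} \<or> t = 0")
  case False
  have "0 \<le> diameter C" using assms diameter_ge_0 by blast
  with False assms show ?thesis
    by (auto simp: diam_power_def intro!: powr_mono' ennreal_leI powr_le1 simp flip: ennreal_1)
qed (use assms in \<open>auto simp: diam_power_def\<close>)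

lemma hausdorff_null_exponent_mono:
  assumes "hausdorff_measure s E = 0" "0 \<le> s" "s \<le> t"
  shows "hausdorff_measure t E = 0"
proof -
  have "hausdorff_measure t E \<le> hausdorff_measure s E"
  \<comment> \<open>Scales up to 1 suffice, and there the larger exponent makes every term
    smaller.\<close>
  proof (rule hausdorff_measure_leI[of 1])
    fix \<delta> :: real assume d: "0 < \<delta>" "\<delta> \<le> 1"
    have "hausdorff_premeasure t \<delta> E \<le> hausdorff_premeasure s \<delta> E"
      unfolding hausdorff_premeasure_def
    proof (rule INF_mono)
      fix C :: "nat \<Rightarrow> 'a set" assume "C \<in> {C. E \<subseteq> (\<Union>k. C k) \<and> (\<forall>k. bounded (C k) \<and> diameter (C k) \<le> \<delta>)}"
      then show "\<exists>B\<in>{C. E \<subseteq> (\<Union>k. C k) \<and> (\<forall>k. bounded (C k) \<and> diameter (C k) \<le> \<delta>)}.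
          (\<Sum>k. diam_power t (B k)) \<le> (\<Sum>k. diam_power s (C k))"
        using d assms by (intro bexI[of _ C] suminf_le diam_power_antimono) (auto intro: order_trans)
    qed
    also have "\<dots> \<le> hausdorff_measure s E" using d by (intro hausdorff_premeasure_le_measure)
    finally show "hausdorff_premeasure t \<delta> E \<le> hausdorff_measure s E" .
  qed simp
  with assms show ?thesis by simp
qed

lemma diameter_lipschitz_image:
  assumes "bounded C" "c > 0" "\<And>x y. x \<in> C \<Longrightarrow> y \<in> C \<Longrightarrow> dist (f x) (f y) \<le> c * dist x y"
  shows "bounded (f ` C)" "diameter (f ` C) \<le> c * diameter C"
proof -
  have *: "dist a b \<le> c * diameter C" if "a \<in> f ` C" "b \<in> f ` C" for a b
  proof -
    obtain x y where xy: "x \<in> C" "y \<in> C" "a = f x" "b = f y" using \<open>a \<in> f ` C\<close> \<open>b \<in> f ` C\<close> by blast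
    then have "dist a b \<le> c * dist x y" using assms(3) by simp
    also have "\<dots> \<le> c * diameter C"
      using assms xy by (intro mult_left_mono diameter_bounded_bound) auto
    finally show ?thesis .
  qed
  show "bounded (f ` C)" using * unfolding bounded_two_points by blast
  have "0 \<le> c * diameter C" using assms diameter_ge_0[of C] by simp
  then show "diameter (f ` C) \<le> c * diameter C"
    using * by (cases "C = {}") (auto simp: diameter_def intro!: cSUP_least)
qed

lemma hausdorff_measure_lipschitz_image:
  fixes E :: "'a::metric_space set" and f :: "'a \<Rightarrow> 'b::metric_space"
  assumes s: "s > 0" and c: "c > 0"
    and f: "\<And>x y. x \<in> E \<Longrightarrow> y \<in> E \<Longrightarrow> dist (f x) (f y) \<le> c * dist x y"
  shows "hausdorff_measure s (f ` E) \<le> ennreal (c powr s) * hausdorff_measure s E"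
proof (rule hausdorff_measure_leI[of 1])
  fix \<delta> :: real assume d: "0 < \<delta>"
  have "hausdorff_premeasure s \<delta> (f ` E) \<le> ennreal (c powr s) * hausdorff_premeasure s (\<delta> / c) E"
    unfolding hausdorff_premeasure_def[of s "\<delta> / c" E]
  proof (rule ennreal_le_mult_INF)
    show "c powr s > 0" using c by simp
    fix C :: "nat \<Rightarrow> 'a set"
    assume C: "C \<in> {C. E \<subseteq> \<Union> (range C) \<and> (\<forall>k. bounded (C k) \<and> diameter (C k) \<le> \<delta> / c)}"
    \<comment> \<open>The Lipschitz bound holds on \<open>E\<close> only, so cover sets are cut down
      to \<open>E\<close> before being mapped.\<close>
    define D where "D k = f ` (C k \<inter> E)" for k
    have bC: "bounded (C k \<inter> E)" for k using C by (auto intro: bounded_Int)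
    have dC: "diameter (C k \<inter> E) \<le> diameter (C k)" for k using C by (intro diameter_subset) auto
    have D: "bounded (D k)" "diameter (D k) \<le> c * diameter (C k \<inter> E)" for k
      unfolding D_def using diameter_lipschitz_image[OF bC c, where f = f] f by auto
    then have D2: "diameter (D k) \<le> c * diameter (C k)" for k
      using dC[of k] c by (meson mult_left_mono order_trans less_imp_le)
    have "hausdorff_premeasure s \<delta> (f ` E) \<le> (\<Sum>k. diam_power s (D k))"
    proof (rule hausdorff_premeasure_le)
      show "f ` E \<subseteq> (\<Union>k. D k)" using C unfolding D_def by blast
      fix k
      have "c * diameter (C k) \<le> \<delta>" using C c by (auto simp: field_simps)
      then show "diameter (D k) \<le> \<delta>" using D2[of k] by simp
    qed (use D in auto)
    also have "\<dots> \<le> (\<Sum>k. ennreal (c powr s) * diam_power s (C k))"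
    proof (intro suminf_le)
      fix k
      have "0 \<le> diameter (D k)" using D diameter_ge_0 by blast
      moreover have "0 \<le> diameter (C k)" using C diameter_ge_0 by blast
      ultimately have "diameter (D k) powr s \<le> c powr s * diameter (C k) powr s"
        using D2[of k] s c by (simp flip: powr_mult add: powr_mono2)
      then show "diam_power s (D k) \<le> ennreal (c powr s) * diam_power s (C k)"
        using s by (auto simp: diam_power_def D_def ennreal_leI simp flip: ennreal_mult)
    qed auto
    also have "\<dots> = ennreal (c powr s) * (\<Sum>k. diam_power s (C k))" by simp
    finally show "hausdorff_premeasure s \<delta> (f ` E) \<le> ennreal (c powr s) * (\<Sum>k. diam_power s (C k))" .
  qed
  also have "\<dots> \<le> ennreal (c powr s) * hausdorff_measure s E"
    using d c by (intro mult_left_mono hausdorff_premeasure_le_measure) auto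
  finally show "hausdorff_premeasure s \<delta> (f ` E) \<le> ennreal (c powr s) * hausdorff_measure s E" .
qed simp

section \<open>Hausdorff dimension\<close>

lemma hausdorff_dim_le:
  assumes "s \<ge> 0" "hausdorff_measure s E = 0"
  shows "hausdorff_dim E \<le> ereal s"
  unfolding hausdorff_dim_def by (rule Inf_lower) (use assms in auto)

lemma hausdorff_dim_leI:
  assumes "0 \<le> s0" "\<And>s. s0 < s \<Longrightarrow> hausdorff_measure s E = 0"
  shows "hausdorff_dim E \<le> ereal s0"
proof (rule ereal_le_epsilon2)
  fix e :: real assume "0 < e"
  then show "hausdorff_dim E \<le> ereal s0 + ereal e"
    using hausdorff_dim_le[of "s0 + e" E] assms by simp
qed

lemma hausdorff_dim_nonneg: "0 \<le> hausdorff_dim E"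
  unfolding hausdorff_dim_def by (rule Inf_greatest) auto

text \<open>Null exponents are upward closed, so a single exponent of non-zero (possibly infinite)
  measure bounds the infimum from below.\<close>

lemma hausdorff_dim_eqI:
  assumes "0 \<le> s0" "\<And>s. s0 < s \<Longrightarrow> hausdorff_measure s E = 0" "hausdorff_measure s0 E \<noteq> 0"
  shows "hausdorff_dim E = ereal s0"
proof (rule antisym)
  show "ereal s0 \<le> hausdorff_dim E"
    unfolding hausdorff_dim_def
  proof (rule Inf_greatest)
    fix x assume "x \<in> {ereal s |s. 0 \<le> s \<and> hausdorff_measure s E = 0}"
    then obtain s where s: "x = ereal s" "0 \<le> s" "hausdorff_measure s E = 0" by auto
    then show "ereal s0 \<le> x"
      using hausdorff_null_exponent_mono[of s E s0] assms(3) by (cases "s \<le> s0") auto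
  qed
qed (rule hausdorff_dim_leI[OF assms(1,2)])

lemma hausdorff_dim_countable:
  assumes "countable E" shows "hausdorff_dim E = 0"
proof (rule antisym)
  show "hausdorff_dim E \<le> 0"
    using hausdorff_dim_leI[of 0 E] hausdorff_null_countable[OF _ assms] by (simp add: zero_ereal_def)
qed (rule hausdorff_dim_nonneg)

lemma hausdorff_null_diff_countable:
  assumes "s > 0" "countable N" "hausdorff_measure s (E - N) = 0"
  shows "hausdorff_measure s E = 0"
  using hausdorff_null_Un[OF assms(3) hausdorff_null_countable[OF assms(1,2)]]
  by (rule hausdorff_null_subset[rotated]) auto

text \<open>The cover of generation k costs at most C (\<sigma> / b^s)^k, which tends to 0, while
  its diameters b^(-k) drop below every \<delta>.\<close>

lemma hausdorff_null_finite_covers: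
  fixes E :: "'a::metric_space set"
  assumes s: "s > 0" and b: "b > 1" and \<sigma>: "0 < \<sigma>" "\<sigma> < b powr s" and C: "C \<ge> 0"
    and cov: "\<And>k::nat. \<exists>\<C>. finite \<C> \<and> E \<subseteq> \<Union>\<C> \<and> real (card \<C>) \<le> C * \<sigma> ^ k \<and>
        (\<forall>D\<in>\<C>. bounded D \<and> diameter D \<le> b powr (- real k))"
  shows "hausdorff_measure s E = 0"
  unfolding hausdorff_measure_null_iff
proof (intro allI impI)
  fix \<delta> :: real assume d: "\<delta> > 0"
  have l1: "(\<lambda>k::nat. b powr (- real k)) \<longlonglongrightarrow> 0"
  proof -
    have "(\<lambda>k::nat. (1/b) ^ k) \<longlonglongrightarrow> 0" using b by (intro LIMSEQ_power_zero) auto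
    moreover have "(1/b) ^ k = b powr (- real k)" for k using b 
      by (simp add: powr_minus powr_realpow power_one_over inverse_eq_divide)
    ultimately show ?thesis by simp
  qed
  have l2: "(\<lambda>k::nat. C * (\<sigma> / b powr s) ^ k) \<longlonglongrightarrow> C * 0"
    using \<sigma> b by (intro tendsto_mult tendsto_const LIMSEQ_power_zero) auto
  have "hausdorff_premeasure s \<delta> E \<le> ennreal e" if e: "e > 0" for e
  proof -
    have "eventually (\<lambda>k. b powr (- real k) < \<delta> \<and> C * (\<sigma> / b powr s) ^ k < e) sequentially"
      using order_tendstoD(2)[OF l1 d] order_tendstoD(2)[OF l2, of e] e by (auto elim: eventually_conj)
    then obtain k where k: "b powr (- real k) < \<delta>" "C * (\<sigma> / b powr s) ^ k < e"
      by (auto simp: eventually_sequentially)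
    obtain \<C> where \<C>: "finite \<C>" "E \<subseteq> \<Union>\<C>" "real (card \<C>) \<le> C * \<sigma> ^ k"
        "\<And>D. D \<in> \<C> \<Longrightarrow> bounded D \<and> diameter D \<le> b powr (- real k)" using cov[of k] by auto
    obtain h where h: "bij_betw h {0..<card \<C>} \<C>" using ex_bij_betw_nat_finite[OF \<C>(1)] by auto
    define D where "D i = (if i < card \<C> then h i else {})" for i
    have hD: "h i \<in> \<C>" if "i < card \<C>" for i using h that by (auto simp: bij_betw_def)
    have "hausdorff_premeasure s \<delta> E \<le> (\<Sum>i. diam_power s (D i))"
    proof (rule hausdorff_premeasure_le)
      show "E \<subseteq> (\<Union>i. D i)"
      proof
        fix x assume "x \<in> E"
        then obtain B where "B \<in> \<C>" "x \<in> B" using \<C> by auto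
        then obtain i where "i < card \<C>" "h i = B"
          using h unfolding bij_betw_def by (metis atLeastLessThan_iff imageE)
        then show "x \<in> (\<Union>i. D i)" using \<open>x \<in> B\<close> by (auto simp: D_def intro!: exI[of _ i])
      qed
      show "bounded (D i)" "diameter (D i) \<le> \<delta>" for i
        using \<C>(4)[OF hD] k d by (auto simp: D_def intro: less_imp_le order_trans)
    qed
    also have "\<dots> = (\<Sum>i<card \<C>. diam_power s (D i))"
      by (rule suminf_finite) (auto simp: D_def diam_power_def)
    also have "\<dots> \<le> (\<Sum>i<card \<C>. ennreal ((b powr (- real k)) powr s))"
    proof (rule sum_mono)
      fix i assume "i \<in> {..<card \<C>}"
      then have "bounded (D i)" "diameter (D i) \<le> b powr (- real k)" using \<C>(4)[OF hD] by (auto simp: D_def)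
      moreover then have "0 \<le> diameter (D i)" using diameter_ge_0 by blast
      ultimately show "diam_power s (D i) \<le> ennreal ((b powr (- real k)) powr s)"
        using s by (auto simp: diam_power_def intro!: ennreal_leI powr_mono2)
    qed
    also have "\<dots> = ennreal (real (card \<C>) * (b powr (- real k)) powr s)"
      by (simp add: ennreal_mult ennreal_of_nat_eq_real_of_nat)
    also have "\<dots> \<le> ennreal e"
    proof (rule ennreal_leI)
      have "(b powr (- real k)) powr s = 1 / (b powr s) ^ k"
        using b by (simp add: powr_powr powr_realpow[symmetric] powr_minus_divide[symmetric] mult.commute)
      then have "real (card \<C>) * (b powr (- real k)) powr s \<le> C * \<sigma> ^ k * (1 / (b powr s) ^ k)"
        using \<C>(3) by (simp add: divide_right_mono)
      also have "\<dots> = C * (\<sigma> / b powr s) ^ k" by (simp add: power_divide)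
      finally show "real (card \<C>) * (b powr (- real k)) powr s \<le> e" using k by simp
    qed
    finally show ?thesis .
  qed
  then show "hausdorff_premeasure s \<delta> E = 0" by (rule ennreal_eq_0I)
qed

text \<open>A set of small diameter meets at most two of the intervals of generation \<open>M\<close>; this replaces
  the additivity of the Hausdorff measure on Borel sets, at the cost of a factor \<open>2\<close>.\<close>
lemma hausdorff_measure_sum_le:
  fixes E :: "real set" and h :: "int \<Rightarrow> 'b"
  assumes b: "b > 0" and f: "\<And>x. x \<in> E \<Longrightarrow> f x = h \<lfloor>b * x\<rfloor>" and S: "finite S"
  shows "(\<Sum>a\<in>S. hausdorff_measure s {x\<in>E. f x = a}) \<le> 2 * hausdorff_measure s E"
proof -
  let ?E = "\<lambda>a. {x\<in>E. f x = a}"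
  have pre: "(\<Sum>a\<in>S. hausdorff_premeasure s \<delta> (?E a)) \<le> 2 * hausdorff_premeasure s \<delta> E"
    if d: "0 < \<delta>" "\<delta> < 1 / b" for \<delta>
  proof -
    let ?T = "{C :: nat \<Rightarrow> real set. E \<subseteq> (\<Union>k. C k) \<and> (\<forall>k. bounded (C k) \<and> diameter (C k) \<le> \<delta>)}"
    have "(\<Sum>a\<in>S. hausdorff_premeasure s \<delta> (?E a)) \<le> 2 * (\<Sum>k. diam_power s (C k))" if C: "C \<in> ?T" for C
    proof -
      \<comment> \<open>Cover sets that miss the piece of \<open>a\<close> are dropped, so each
        \<open>C k\<close> is charged only to the values of \<open>a\<close> whose piece it
        meets.\<close>
      define D where "D a k = (if C k \<inter> ?E a = {} then {} else C k)" for a k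
      have "(\<Sum>a\<in>S. hausdorff_premeasure s \<delta> (?E a)) \<le> (\<Sum>a\<in>S. \<Sum>k. diam_power s (D a k))"
      proof (rule sum_mono, rule hausdorff_premeasure_le)
        fix a assume "a \<in> S"
        show "?E a \<subseteq> (\<Union>k. D a k)" using C unfolding D_def by fastforce
        fix k show "bounded (D a k)" "diameter (D a k) \<le> \<delta>" using C d by (auto simp: D_def)
      qed
      also have "\<dots> = (\<Sum>k. \<Sum>a\<in>S. diam_power s (D a k))"
        by (rule suminf_sum[symmetric]) auto
      also have "\<dots> \<le> (\<Sum>k. 2 * diam_power s (C k))"
      proof (rule suminf_le)
        fix k
        let ?A = "{a\<in>S. C k \<inter> ?E a \<noteq> {}}"
        have fA: "finite ?A" using S by simp
        have "card ?A \<le> 2"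
        proof (cases "C k = {}")
          case False
          then obtain x0 where x0: "x0 \<in> C k" by auto
          have bd: "bounded (C k)" and dm: "diameter (C k) \<le> \<delta>" using C by auto
          define q where "q = \<lfloor>b * Inf (C k)\<rfloor>"
          have bb: "bdd_below (C k)" using bd by (rule bounded_imp_bdd_below)
          \<comment> \<open>Because b \<delta> < 1, the values b x on \<open>C k\<close> stay within
            less than one unit above b times its infimum.\<close>
          have "\<lfloor>b * x\<rfloor> \<in> {q, q + 1}" if x: "x \<in> C k" for x
          proof -
            have "Inf (C k) \<le> x" using x bb by (rule cInf_lower)
            moreover have "x \<le> Inf (C k) + \<delta>"
            proof -
              have "x - \<delta> \<le> Inf (C k)"
              proof (rule cInf_greatest[OF False])
                fix y assume "y \<in> C k"
                then have "dist x y \<le> \<delta>" using diameter_bounded_bound[OF bd x] dm by fastforce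
                then show "x - \<delta> \<le> y" by (auto simp: dist_real_def)
              qed
              then show ?thesis by simp
            qed
            ultimately have "b * Inf (C k) \<le> b * x" "b * x \<le> b * Inf (C k) + b * \<delta>"
              using b by (auto simp flip: distrib_left)
            moreover have "b * \<delta> < 1" using d b by (simp add: field_simps)
            ultimately show ?thesis unfolding q_def insert_iff by linarith
          qed
          then have "?A \<subseteq> h ` {q, q + 1}" using f by (fastforce simp: image_iff)
          then have "card ?A \<le> card (h ` {q, q+1})" by (intro card_mono) auto
          also have "\<dots> \<le> card {q, q+1}" by (rule card_image_le) auto
          also have "\<dots> \<le> 2" by simp
          finally show ?thesis .
        qed auto
        have "(\<Sum>a\<in>S. diam_power s (D a k)) = (\<Sum>a\<in>?A. diam_power s (C k))"
          by (rule sum.mono_neutral_cong_right) (use S in \<open>auto simp: D_def diam_power_def\<close>)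
        also have "\<dots> = of_nat (card ?A) * diam_power s (C k)" by simp
        also have "\<dots> \<le> 2 * diam_power s (C k)"
          using of_nat_mono[OF \<open>card ?A \<le> 2\<close>, where ?'a = ennreal] by (intro mult_right_mono) auto
        finally show "(\<Sum>a\<in>S. diam_power s (D a k)) \<le> 2 * diam_power s (C k)" .
      qed auto
      also have "\<dots> = 2 * (\<Sum>k. diam_power s (C k))" by simp
      finally show ?thesis .
    qed
    then show ?thesis
      using ennreal_le_mult_INF[of 2 ?T _ "\<lambda>C. \<Sum>k. diam_power s (C k)"]
      unfolding hausdorff_premeasure_def[of s \<delta> E] by simp
  qed
  \<comment> \<open>The supremum is taken along an increasing sequence so that it commutes with the
    finite sum; \<open>j + 2\<close> keeps \<delta> strictly below \<open>1 / b\<close>, as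
    \<open>pre\<close> demands.\<close>
  have H: "hausdorff_measure s F = (SUP j. hausdorff_premeasure s (1 / (b * real (j + 2))) F)" for F :: "real set"
  proof (rule antisym)
    show "hausdorff_measure s F \<le> (SUP j. hausdorff_premeasure s (1 / (b * real (j + 2))) F)"
      unfolding hausdorff_measure_def
    proof (rule SUP_least)
      fix \<delta> :: real assume "\<delta> \<in> {0<..}"
      then have dp: "\<delta> > 0" by simp
      obtain j :: nat where j: "1 / (b * \<delta>) < real j" using reals_Archimedean2 by blast
      have "1 / (b * real (j + 2)) \<le> \<delta>"
      proof -
        have "1 < real j * (b * \<delta>)" using j dp b by (simp add: field_simps)
        also have "\<dots> \<le> real (j + 2) * (b * \<delta>)" using dp b by (intro mult_right_mono) auto
        finally have "1 \<le> \<delta> * (b * real (j + 2))" by (simp add: mult_ac)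
        then show ?thesis using b by (simp add: pos_divide_le_eq)
      qed
      then have "hausdorff_premeasure s \<delta> F \<le> hausdorff_premeasure s (1 / (b * real (j + 2))) F"
        by (rule hausdorff_premeasure_antimono)
      then show "hausdorff_premeasure s \<delta> F \<le> (SUP j. hausdorff_premeasure s (1 / (b * real (j + 2))) F)"
        by (meson SUP_upper2 UNIV_I)
    qed
    show "(SUP j. hausdorff_premeasure s (1 / (b * real (j + 2))) F) \<le> hausdorff_measure s F"
      by (rule SUP_least, rule hausdorff_premeasure_le_measure) (use b in auto)
  qed
  have inc: "incseq (\<lambda>j. hausdorff_premeasure s (1 / (b * real (j + 2))) F)" for F :: "real set"
    by (rule incseq_SucI, rule hausdorff_premeasure_antimono) (use b in \<open>simp add: frac_le\<close>)
  have "(\<Sum>a\<in>S. hausdorff_measure s (?E a)) = (SUP j. \<Sum>a\<in>S. hausdorff_premeasure s (1 / (b * real (j + 2))) (?E a))"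
    unfolding H by (rule ennreal_SUP_sum[symmetric]) (rule inc)
  also have "\<dots> \<le> 2 * hausdorff_measure s E"
  proof (rule SUP_least)
    fix j
    have "(\<Sum>a\<in>S. hausdorff_premeasure s (1 / (b * real (j + 2))) (?E a)) \<le> 2 * hausdorff_premeasure s (1 / (b * real (j + 2))) E"
      by (rule pre) (use b in \<open>auto intro!: divide_strict_left_mono\<close>)
    also have "\<dots> \<le> 2 * hausdorff_measure s E"
      using b by (intro mult_left_mono hausdorff_premeasure_le_measure) auto
    finally show "(\<Sum>a\<in>S. hausdorff_premeasure s (1 / (b * real (j + 2))) (?E a)) \<le> 2 * hausdorff_measure s E" .
  qed
  finally show ?thesis .
qed

section \<open>Walks and the spectral radius\<close>

text \<open>For \<open>v\<close> in \<open>V\<close> this is the row sum at \<open>v\<close> of the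
  k-th power of the adjacency matrix, expressed without enumerating \<open>V\<close>.\<close>

primrec nwalks :: "'a set \<Rightarrow> ('a \<Rightarrow> 'a \<Rightarrow> bool) \<Rightarrow> nat \<Rightarrow> 'a \<Rightarrow> nat" where
  "nwalks V R 0 v = 1"
| "nwalks V R (Suc k) v = (\<Sum>w\<in>{w\<in>V. R v w}. nwalks V R k w)"

abbreviation graph_radius :: "'a set \<Rightarrow> ('a \<Rightarrow> 'a \<Rightarrow> bool) \<Rightarrow> real" where
  "graph_radius V R \<equiv> real_spectral_radius (adjacency_mat (digraph_of V R))"

abbreviation edges :: "'a set \<Rightarrow> ('a \<Rightarrow> 'a \<Rightarrow> bool) \<Rightarrow> ('a \<times> 'a) set" where
  "edges V R \<equiv> {(a, b). a \<in> V \<and> b \<in> V \<and> R a b}"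

lemma arcs_ends_digraph_of: "arcs_ends (digraph_of V R) = edges V R"
  by (auto simp: digraph_of_def arcs_ends_def arc_to_ends_def)

lemma vertex_list_digraph_of:
  assumes "finite V"
  shows "distinct (vertex_list (digraph_of V R))" "set (vertex_list (digraph_of V R)) = V"
proof -
  have "\<exists>vs. distinct vs \<and> set vs = verts (digraph_of V R)"
    using finite_distinct_list[OF assms] by (auto simp: digraph_of_def)
  from someI_ex[OF this]
  show "distinct (vertex_list (digraph_of V R))" "set (vertex_list (digraph_of V R)) = V"
    unfolding vertex_list_def[symmetric] by (auto simp: digraph_of_def)
qed

lemma induce_subgraph_digraph_of:
  "H \<subseteq> V \<Longrightarrow> digraph_of V R \<restriction> H = digraph_of H R"
  by (auto simp: induce_subgraph_def digraph_of_def)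

lemma complex_adjacency_mat:
  fixes V :: "'a set" and R
  assumes "finite V"
  obtains vs where "distinct vs" "set vs = V"
    "adjacency_mat (digraph_of V R) \<in> carrier_mat (length vs) (length vs)"
    "map_mat complex_of_real (adjacency_mat (digraph_of V R)) =
      Matrix.mat (length vs) (length vs) (\<lambda>(i, j). if R (vs ! i) (vs ! j) then 1 else 0)"
    "graph_radius V R = (if vs = [] then 0 else
       spectral_radius (Matrix.mat (length vs) (length vs) (\<lambda>(i, j). if R (vs ! i) (vs ! j) then 1 else 0)))"
proof -
  define vs where "vs = vertex_list (digraph_of V R)"
  have vs: "distinct vs" "set vs = V" unfolding vs_def using vertex_list_digraph_of[OF assms] by auto
  have c: "adjacency_mat (digraph_of V R) \<in> carrier_mat (length vs) (length vs)"
    by (simp add: adjacency_mat_def Let_def vs_def)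
  have e: "map_mat complex_of_real (adjacency_mat (digraph_of V R)) =
      Matrix.mat (length vs) (length vs) (\<lambda>(i, j). if R (vs ! i) (vs ! j) then 1 else 0)"
    unfolding adjacency_mat_def Let_def vs_def[symmetric] arcs_ends_digraph_of
    by (rule eq_matI) (use vs nth_mem in \<open>auto simp: of_real_def\<close>)
  show ?thesis
    by (rule that[OF vs c e]) (use c in \<open>auto simp: real_spectral_radius_def e\<close>)
qed

text \<open>The spectral radius is the modulus of an eigenvalue; reading an eigenvector along the
  vertex list as a function on \<open>V\<close> removes the enumeration from the statement.\<close>

lemma graph_radius_eigenvalue:
  fixes V :: "'a set" and R
  assumes "finite V" "V \<noteq> {}"
  obtains f :: "'a \<Rightarrow> complex" and e :: complex where "norm e = graph_radius V R"
    "\<exists>v\<in>V. f v \<noteq> 0" "\<And>v. v \<in> V \<Longrightarrow> e * f v = (\<Sum>w\<in>{w\<in>V. R v w}. f w)"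
proof -
  obtain vs where vs: "distinct vs" "set vs = V" 
    and rad: "graph_radius V R = (if vs = [] then 0 else
       spectral_radius (Matrix.mat (length vs) (length vs) (\<lambda>(i, j). if R (vs ! i) (vs ! j) then 1 else 0)))"
    using complex_adjacency_mat[OF assms(1), of R] by metis
  let ?A = "Matrix.mat (length vs) (length vs) (\<lambda>(i, j). if R (vs ! i) (vs ! j) then 1 else 0) :: complex mat"
  have ne: "vs \<noteq> []" "length vs > 0" using vs assms by auto
  have A: "?A \<in> carrier_mat (length vs) (length vs)" by simp
  obtain e where e: "e \<in> spectrum ?A" "norm e = graph_radius V R"
    using spectral_radius_mem_max(1)[OF A ne(2)] rad ne(1) by auto
  obtain x where x: "x \<in> carrier_vec (length vs)" "x \<noteq> 0\<^sub>v (length vs)" "?A *\<^sub>v x = e \<cdot>\<^sub>v x"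
    using e(1) unfolding spectrum_def eigenvalue_def eigenvector_def by auto
  define f where "f v = vec_index x (inv_into {..<length vs} ((!) vs) v)" for v
  have bij: "bij_betw ((!) vs) {..<length vs} V" by (rule bij_betw_nth) (use vs in auto)
  have f: "f (vs ! i) = vec_index x i" if "i < length vs" for i
    unfolding f_def using bij_betw_inv_into_left[OF bij] that by simp
  show ?thesis
  proof (rule that[OF e(2)])
    obtain i where i: "i < length vs" "vec_index x i \<noteq> 0"
      using x(1,2) by (metis carrier_vecD eq_vecI index_zero_vec)
    then show "\<exists>v\<in>V. f v \<noteq> 0" using f vs by (metis nth_mem)
  next
    fix v assume "v \<in> V"
    then obtain i where i: "i < length vs" "v = vs ! i" using vs by (metis in_set_conv_nth)
    have "e * f v = vec_index (?A *\<^sub>v x) i" using i x f by simp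
    also have "\<dots> = (\<Sum>j<length vs. (if R v (vs ! j) then 1 else 0) * f (vs ! j))"
      using i x(1) f by (auto simp: scalar_prod_def intro!: sum.cong)
    also have "\<dots> = (\<Sum>w\<in>V. (if R v w then 1 else 0) * f w)"
      by (rule sum.reindex_bij_betw[OF bij, of "\<lambda>w. (if R v w then 1 else 0) * f w"])
    also have "\<dots> = (\<Sum>w\<in>{w\<in>V. R v w}. f w)"
      by (rule sum.mono_neutral_cong_right) (use assms in auto)
    finally show "e * f v = (\<Sum>w\<in>{w\<in>V. R v w}. f w)" .
  qed
qed

text \<open>Triangle inequality in the eigenvalue equation. The modulus of the eigenvector takes the
  place of a Perron eigenvector for an arbitrary finite graph, at the price of an inequality and of
  possible zeros.\<close>

lemma graph_radius_subeigenvector: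
  fixes V :: "'a set" and R
  assumes "finite V" "V \<noteq> {}"
  obtains h :: "'a \<Rightarrow> real" where "\<And>v. h v \<ge> 0" "\<exists>v\<in>V. h v > 0"
    "\<And>v. v \<in> V \<Longrightarrow> graph_radius V R * h v \<le> (\<Sum>w\<in>{w\<in>V. R v w}. h w)"
proof -
  obtain f :: "'a \<Rightarrow> complex" and e where *: "norm e = graph_radius V R"
    "\<exists>v\<in>V. f v \<noteq> 0" "\<And>v. v \<in> V \<Longrightarrow> e * f v = (\<Sum>w\<in>{w\<in>V. R v w}. f w)"
    by (rule graph_radius_eigenvalue[OF assms, of R]) (rule that, assumption+)
  show ?thesis
  proof (rule that[of "\<lambda>v. norm (f v)"])
    fix v assume "v \<in> V"
    then have "graph_radius V R * norm (f v) = norm (\<Sum>w\<in>{w\<in>V. R v w}. f w)"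
      using * by (metis norm_mult)
    also have "\<dots> \<le> (\<Sum>w\<in>{w\<in>V. R v w}. norm (f w))" by (rule norm_sum)
    finally show "graph_radius V R * norm (f v) \<le> (\<Sum>w\<in>{w\<in>V. R v w}. norm (f w))" .
  qed (use * in auto)
qed

lemma graph_radius_nonneg: "finite V \<Longrightarrow> 0 \<le> graph_radius V R"
proof (cases "V = {}")
  case True
  then show ?thesis using vertex_list_digraph_of[of V R]
    by (simp add: real_spectral_radius_def adjacency_mat_def Let_def)
qed (metis graph_radius_eigenvalue norm_ge_zero)

text \<open>Iterating the subeigenvector inequality gives \<rho>^k h(v) \<le> nwalks(k, v) max h; at
  a vertex maximising h the factor cancels.\<close>

lemma nwalks_ge_radius_power:
  assumes fin: "finite V" "V \<noteq> {}"
  obtains v where "v \<in> V" "\<And>k. graph_radius V R ^ k \<le> real (nwalks V R k v)"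
proof -
  obtain h :: "'a \<Rightarrow> real" where h: "\<And>v. h v \<ge> 0" "\<exists>v\<in>V. h v > 0"
    "\<And>v. v \<in> V \<Longrightarrow> graph_radius V R * h v \<le> (\<Sum>w\<in>{w\<in>V. R v w}. h w)"
    using graph_radius_subeigenvector[OF fin] by blast
  define c where "c = Max (h ` V)"
  have c: "h v \<le> c" if "v \<in> V" for v unfolding c_def using fin that by simp
  obtain u where u: "u \<in> V" "h u = c" unfolding c_def using fin Max_in[of "h ` V"] by fastforce
  have "c > 0" using h(2) c by force
  have "graph_radius V R ^ k * h v \<le> real (nwalks V R k v) * c" if "v \<in> V" for k v
    using that
  proof (induction k arbitrary: v)
    case (Suc k)
    have "graph_radius V R ^ Suc k * h v = graph_radius V R ^ k * (graph_radius V R * h v)" by simp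
    also have "\<dots> \<le> graph_radius V R ^ k * (\<Sum>w\<in>{w\<in>V. R v w}. h w)"
      using h(3)[OF Suc.prems] graph_radius_nonneg[OF fin(1)] by (intro mult_left_mono) auto
    also have "\<dots> = (\<Sum>w\<in>{w\<in>V. R v w}. graph_radius V R ^ k * h w)" by (rule sum_distrib_left)
    also have "\<dots> \<le> (\<Sum>w\<in>{w\<in>V. R v w}. real (nwalks V R k w) * c)"
      by (rule sum_mono) (use Suc.IH in auto)
    also have "\<dots> = real (nwalks V R (Suc k) v) * c" by (simp add: sum_distrib_right)
    finally show ?case .
  qed (use c in auto)
  from this[OF u(1)] u \<open>c > 0\<close> show ?thesis by (intro that[of u]) auto
qed

text \<open>The matrix A / \<sigma> has spectral radius below 1, hence bounded powers, and walk
  counts are A^k applied to the all-ones vector. The strict inequality absorbs polynomial factors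
  coming from Jordan blocks.\<close>

lemma nwalks_growth:
  assumes fin: "finite V" and \<sigma>: "graph_radius V R < \<sigma>"
  obtains C where "C \<ge> 0" "\<And>k v. v \<in> V \<Longrightarrow> real (nwalks V R k v) \<le> C * \<sigma> ^ k"
proof (cases "V = {}")
  case False
  obtain vs where vs: "distinct vs" "set vs = V" 
    and rad: "graph_radius V R = (if vs = [] then 0 else
       spectral_radius (Matrix.mat (length vs) (length vs) (\<lambda>(i, j). if R (vs ! i) (vs ! j) then 1 else 0)))"
    using complex_adjacency_mat[OF fin, of R] by metis
  define N where "N = length vs"
  define A :: "complex mat" where "A = Matrix.mat N N (\<lambda>(i, j). if R (vs ! i) (vs ! j) then 1 else 0)"
  have ne: "vs \<noteq> []" "N > 0" using vs False by (auto simp: N_def)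
  have A: "A \<in> carrier_mat N N" by (simp add: A_def)
  have rad: "graph_radius V R = spectral_radius A" using rad ne by (simp add: A_def N_def)
  have \<sigma>0: "\<sigma> > 0" using \<sigma> graph_radius_nonneg[OF fin, of R] by linarith
  define B where "B = complex_of_real (1 / \<sigma>) \<cdot>\<^sub>m A"
  have B: "B \<in> carrier_mat N N" using A by (simp add: B_def)
  have "spectral_radius B < 1"
  proof -
    obtain e where e: "e \<in> spectrum B" "norm e = spectral_radius B"
      using spectral_radius_mem_max(1)[OF B ne(2)] by auto
    obtain x where x: "x \<in> carrier_vec N" "x \<noteq> 0\<^sub>v N" "B *\<^sub>v x = e \<cdot>\<^sub>v x"
      using e(1) B unfolding spectrum_def eigenvalue_def eigenvector_def by auto
    have AB: "A = complex_of_real \<sigma> \<cdot>\<^sub>m B" unfolding B_def using \<sigma>0 by (intro eq_matI) auto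
    have "A *\<^sub>v x = complex_of_real \<sigma> \<cdot>\<^sub>v (B *\<^sub>v x)"
      unfolding AB using x(1) B by (intro eq_vecI) (auto simp: scalar_prod_def sum_distrib_left mult.assoc)
    then have "A *\<^sub>v x = (complex_of_real \<sigma> * e) \<cdot>\<^sub>v x"
      using x by (simp add: smult_smult_assoc)
    then have "complex_of_real \<sigma> * e \<in> spectrum A"
      using x A unfolding spectrum_def eigenvalue_def eigenvector_def by auto
    then have "norm (complex_of_real \<sigma> * e) \<le> spectral_radius A"
      by (intro spectral_radius_mem_max(2)[OF A ne(2)]) auto
    then have "\<sigma> * spectral_radius B \<le> graph_radius V R" using e \<sigma>0 rad by (simp add: norm_mult)
    then have "\<sigma> * spectral_radius B < \<sigma> * 1" using \<sigma> by simp
    then show ?thesis using \<sigma>0 by (subst (asm) mult_less_cancel_left_pos) auto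
  qed
  from spectral_radius_jnf_norm_bound_less_1_upper_triangular[OF B this]
  obtain c where c: "\<And>k. norm_bound (B ^\<^sub>m k) c" by auto
  \<comment> \<open>The normalised walk counts: \<open>g 0\<close> is the all-ones vector, and the
    recursion of \<open>nwalks\<close> becomes multiplication by \<open>B\<close>.\<close>
  define g where "g k = Matrix.vec N (\<lambda>i. complex_of_real (real (nwalks V R k (vs ! i)) / \<sigma> ^ k))" for k
  have gc: "g k \<in> carrier_vec N" for k by (simp add: g_def)
  have bij: "bij_betw ((!) vs) {..<N} V" by (rule bij_betw_nth) (use vs N_def in auto)
  have Bg: "B *\<^sub>v g k = g (Suc k)" for k
  proof (rule eq_vecI)
    fix i assume "i < dim_vec (g (Suc k))"
    then have i: "i < N" by (simp add: g_def)
    have "vec_index (B *\<^sub>v g k) i = (\<Sum>j<N. (if R (vs ! i) (vs ! j) then 1 else 0) * complex_of_real (real (nwalks V R k (vs ! j)) / \<sigma> ^ Suc k))"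
      using i by (auto simp: B_def A_def g_def scalar_prod_def intro!: sum.cong)
    also have "\<dots> = (\<Sum>w\<in>V. (if R (vs ! i) w then 1 else 0) * complex_of_real (real (nwalks V R k w) / \<sigma> ^ Suc k))"
      by (rule sum.reindex_bij_betw[OF bij, of "\<lambda>w. (if R (vs ! i) w then 1 else 0) * complex_of_real (real (nwalks V R k w) / \<sigma> ^ Suc k)"])
    also have "\<dots> = (\<Sum>w\<in>{w\<in>V. R (vs ! i) w}. complex_of_real (real (nwalks V R k w) / \<sigma> ^ Suc k))"
      by (rule sum.mono_neutral_cong_right) (use fin in auto)
    also have "\<dots> = vec_index (g (Suc k)) i" using i by (simp add: g_def sum_divide_distrib)
    finally show "vec_index (B *\<^sub>v g k) i = vec_index (g (Suc k)) i" .
  qed (simp add: g_def B_def A_def)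
  have pow: "(B ^\<^sub>m k) *\<^sub>v g j = g (j + k)" for k j
  proof (induction k arbitrary: j)
    case (Suc k)
    have "(B ^\<^sub>m Suc k) *\<^sub>v g j = (B ^\<^sub>m k) *\<^sub>v (B *\<^sub>v g j)"
      using B gc by (simp add: assoc_mult_mat_vec[of _ N N _ N])
    then show ?case using Suc[of "Suc j"] Bg by simp
  qed (use B gc in auto)
  show ?thesis
  proof (rule that[of "real N * max c 0"])
    fix k v assume "v \<in> V"
    then obtain i where i: "i < N" "v = vs ! i" using vs unfolding N_def by (metis in_set_conv_nth)
    have Bk: "dim_row (B ^\<^sub>m k) = N" "dim_col (B ^\<^sub>m k) = N" using B by auto
    have "real (nwalks V R k v) / \<sigma> ^ k = norm (vec_index (g k) i)"
      using i \<sigma>0 by (simp add: g_def norm_divide norm_power)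
    also have "g k = (B ^\<^sub>m k) *\<^sub>v g 0" using pow[of k 0] by simp
    also have "vec_index ((B ^\<^sub>m k) *\<^sub>v g 0) i = (\<Sum>j<N. (B ^\<^sub>m k) $$ (i, j))"
      using i Bk by (auto simp: g_def scalar_prod_def intro!: sum.cong)
    also have "norm \<dots> \<le> (\<Sum>j<N. norm ((B ^\<^sub>m k) $$ (i, j)))" by (rule norm_sum)
    also have "\<dots> \<le> (\<Sum>j<N. max c 0)"
      using c[of k] i Bk by (intro sum_mono) (auto simp: norm_bound_def intro: max.coboundedI1)
    finally show "real (nwalks V R k v) \<le> real N * max c 0 * \<sigma> ^ k"
      using \<sigma>0 by (simp add: pos_divide_le_eq)
  qed simp
qed (rule that[of 0], auto)

lemma nwalks_reach:
  assumes "(u, v) \<in> edges V R ^^ a" "finite V"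
  shows "nwalks V R k v \<le> nwalks V R (a + k) u"
  using assms(1)
proof (induction a arbitrary: u)
  case (Suc a)
  then obtain w where w: "(u, w) \<in> edges V R" "(w, v) \<in> edges V R ^^ a" by (meson relpow_Suc_D2)
  have "nwalks V R k v \<le> nwalks V R (a + k) w" using Suc.IH w by blast
  also have "\<dots> \<le> (\<Sum>w\<in>{w\<in>V. R u w}. nwalks V R (a + k) w)"
    by (rule member_le_sum) (use w assms in auto)
  finally show ?case by simp
qed auto

text \<open>A vertex with two successors lies on two different closed walks, so the number of walks
  starting from it grows exponentially.\<close>
lemma radius_le_1_unique_successor:
  assumes fin: "finite V" and rad: "graph_radius V R \<le> 1"
    and conn: "\<And>u v. u \<in> V \<Longrightarrow> v \<in> V \<Longrightarrow> (u, v) \<in> (edges V R)\<^sup>*"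
    and v: "v \<in> V" "w1 \<in> V" "w2 \<in> V" "R v w1" "R v w2"
  shows "w1 = w2"
proof (rule ccontr)
  assume ne: "w1 \<noteq> w2"
  have succ: "\<exists>x\<in>V. R u x" if u: "u \<in> V" for u
  proof (cases "u = v")
    case False
    from conn[OF u v(1)] show ?thesis using False by (cases rule: converse_rtranclE) auto
  qed (use v in auto)
  \<comment> \<open>Every vertex has a successor, so counts do not decrease with the length; this
    allows the return times \<open>a\<close> and \<open>b\<close> to be replaced by their maximum
    \<open>M\<close>.\<close>
  have mono1: "nwalks V R k u \<le> nwalks V R (Suc k) u" if "u \<in> V" for k u
    using that
  proof (induction k arbitrary: u)
    case 0
    have "finite {w\<in>V. R u w}" "{w\<in>V. R u w} \<noteq> {}" using fin succ[OF 0] by auto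
    then have "card {w\<in>V. R u w} > 0" by (simp add: card_gt_0_iff)
    then show ?case by simp
  next
    case (Suc k)
    then have "(\<Sum>w\<in>{w\<in>V. R u w}. nwalks V R k w) \<le> (\<Sum>w\<in>{w\<in>V. R u w}. nwalks V R (Suc k) w)"
      by (intro sum_mono) auto
    then show ?case by simp
  qed
  have mono: "nwalks V R k u \<le> nwalks V R l u" if "u \<in> V" "k \<le> l" for k l u
    using that(2) by (rule lift_Suc_mono_le[rotated]) (rule mono1[OF that(1)])
  obtain a b where ab: "(w1, v) \<in> edges V R ^^ a" "(w2, v) \<in> edges V R ^^ b"
    using conn[OF v(2,1)] conn[OF v(3,1)] unfolding rtrancl_power by blast
  define M where "M = max a b"
  \<comment> \<open>Walks starting with \<open>w1\<close> and with \<open>w2\<close> are counted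
    separately, and each family returns to \<open>v\<close> within \<open>M\<close> further
    steps.\<close>
  have dbl: "2 * nwalks V R k v \<le> nwalks V R (Suc M + k) v" for k
  proof -
    have "nwalks V R k v \<le> nwalks V R (M + k) w1"
      using nwalks_reach[OF ab(1) fin, of k] mono[OF v(2), of "a + k" "M + k"] by (simp add: M_def)
    moreover have "nwalks V R k v \<le> nwalks V R (M + k) w2"
      using nwalks_reach[OF ab(2) fin, of k] mono[OF v(3), of "b + k" "M + k"] by (simp add: M_def)
    moreover have "(\<Sum>w\<in>{w1, w2}. nwalks V R (M + k) w) \<le> (\<Sum>w\<in>{w\<in>V. R v w}. nwalks V R (M + k) w)"
      by (rule sum_mono2) (use v fin in auto)
    ultimately show ?thesis using ne by simp
  qed
  have pow2: "2 ^ j \<le> nwalks V R (j * Suc M) v" for j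
  proof (induction j)
    case (Suc j)
    have "2 ^ Suc j \<le> 2 * nwalks V R (j * Suc M) v" using Suc by simp
    also have "\<dots> \<le> nwalks V R (Suc M + j * Suc M) v" by (rule dbl)
    finally show ?case by (simp only: mult_Suc)
  qed simp
  \<comment> \<open>Chosen so that \<sigma> > 1 while its growth over \<open>Suc M\<close> steps is
    3/2, short of the doubling just shown.\<close>
  define \<sigma> where "\<sigma> = root (Suc M) (3/2)"
  have \<sigma>: "\<sigma> > 1" "\<sigma> ^ Suc M = 3/2"
    using real_root_pow_pos2[of "Suc M" "3/2"] by (simp_all add: \<sigma>_def del: power_Suc)
  have "graph_radius V R < \<sigma>" using rad \<sigma>(1) by linarith
  then obtain C where C: "C \<ge> 0" "\<And>k v. v \<in> V \<Longrightarrow> real (nwalks V R k v) \<le> C * \<sigma> ^ k"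
    using nwalks_growth[OF fin] by blast
  have "(4/3) ^ j \<le> C" for j :: nat
  proof -
    have "2 ^ j \<le> real (nwalks V R (j * Suc M) v)" using of_nat_mono[OF pow2[of j], where ?'a = real] by simp
    also have "\<dots> \<le> C * \<sigma> ^ (j * Suc M)" by (rule C(2)[OF v(1)])
    also have "\<sigma> ^ (j * Suc M) = (3/2) ^ j" unfolding \<sigma>(2)[symmetric] power_mult[symmetric] by (simp only: mult.commute)
    finally have "2 ^ j / (3/2) ^ j \<le> C" by (simp add: pos_divide_le_eq)
    then show ?thesis by (simp flip: power_divide)
  qed
  moreover obtain j :: nat where "C < (4/3) ^ j" using real_arch_pow[of "4/3" C] by auto
  ultimately show False by (meson not_le)
qed

section \<open>Reachability and strong components\<close>

lemma reachable_digraph_of: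
  "u \<rightarrow>\<^sup>*\<^bsub>digraph_of V R\<^esub> v \<longleftrightarrow> u \<in> V \<and> v \<in> V \<and> (u, v) \<in> (edges V R)\<^sup>*"
proof
  assume "u \<rightarrow>\<^sup>*\<^bsub>digraph_of V R\<^esub> v"
  then have "(u, v) \<in> rtrancl_on V (edges V R)"
    by (simp add: reachable_def arcs_ends_digraph_of digraph_of_def[of V R, THEN arg_cong[where f = verts]])
  then show "u \<in> V \<and> v \<in> V \<and> (u, v) \<in> (edges V R)\<^sup>*"
    by induction (auto intro: converse_rtrancl_into_rtrancl)
next
  assume *: "u \<in> V \<and> v \<in> V \<and> (u, v) \<in> (edges V R)\<^sup>*"
  then have "(u, v) \<in> (edges V R)\<^sup>*" by simp
  then have "(u, v) \<in> rtrancl_on V (edges V R)"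
  proof (induction rule: rtrancl_induct)
    case base
    then show ?case using * by (auto intro: rtrancl_on.intros)
  next
    case (step y z)
    then show ?case by (auto intro: rtrancl_on.intros)
  qed
  then show "u \<rightarrow>\<^sup>*\<^bsub>digraph_of V R\<^esub> v"
    by (simp add: reachable_def arcs_ends_digraph_of digraph_of_def[of V R, THEN arg_cong[where f = verts]])
qed

lemma strong_components_digraph_of:
  "H \<in> strong_components (digraph_of V R) \<longleftrightarrow> H \<noteq> {} \<and> H \<subseteq> V \<and>
    (\<forall>u\<in>H. \<forall>v\<in>H. (u, v) \<in> (edges V R)\<^sup>*) \<and>
    (\<forall>u\<in>H. \<forall>v\<in>V. (u, v) \<in> (edges V R)\<^sup>* \<longrightarrow> (v, u) \<in> (edges V R)\<^sup>* \<longrightarrow> v \<in> H)"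
  unfolding pre_digraph.sccs_verts_def reachable_digraph_of by blast

lemma strong_component_of:
  assumes "w \<in> V"
  shows "{u\<in>V. (u, w) \<in> (edges V R)\<^sup>* \<and> (w, u) \<in> (edges V R)\<^sup>*} \<in> strong_components (digraph_of V R)"
  unfolding strong_components_digraph_of using assms by (auto intro: rtrancl_trans)

text \<open>A path between two vertices of a component never leaves it: each intermediate vertex
  reaches the end point and from there every vertex of the component.\<close>

lemma strong_component_connected:
  assumes H: "H \<in> strong_components (digraph_of V R)" and "u \<in> H" "v \<in> H"
  shows "(u, v) \<in> (edges H R)\<^sup>*"
proof -
  note H' = H[unfolded strong_components_digraph_of]
  have "(u, v) \<in> (edges V R)\<^sup>*" using H' assms by auto
  then show ?thesis using \<open>u \<in> H\<close>
  proof (induction rule: converse_rtrancl_induct)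
    case (step y z)
    have "(v, y) \<in> (edges V R)\<^sup>*" using H' step.prems assms by auto
    then have "(y, z) \<in> (edges V R)\<^sup>*" "(z, y) \<in> (edges V R)\<^sup>*" "z \<in> V"
      using step by (auto intro: rtrancl_trans)
    then have "z \<in> H" using H' step.prems by blast
    then show ?case using step by (auto intro: converse_rtrancl_into_rtrancl)
  qed auto
qed

lemma finite_strong_components: "finite V \<Longrightarrow> finite (strong_components (digraph_of V R))"
  by (rule finite_subset[of _ "Pow V"]) (auto simp: strong_components_digraph_of)

section \<open>Points coded by infinite paths\<close>

text \<open>The residues along an infinite path from \<open>v\<close> are the base \<open>n\<close> digits of \<open>z\<close>; that of \<open>v\<close> itself
  is not used. In \<open>walk_code\<close> the digits of a finite walk are read as an integer in the same way.\<close>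
coinductive coded :: "nat \<Rightarrow> 'a set \<Rightarrow> ('a \<Rightarrow> 'a \<Rightarrow> bool) \<Rightarrow> ('a \<Rightarrow> int) \<Rightarrow> 'a \<Rightarrow> real \<Rightarrow> bool"
  for n V R res where
  "\<lbrakk>w \<in> V; R v w; 0 \<le> z; z \<le> 1; real n * z = real_of_int (res w) + z'; coded n V R res w z'\<rbrakk>
   \<Longrightarrow> coded n V R res v z"

inductive walk_code :: "nat \<Rightarrow> 'a set \<Rightarrow> ('a \<Rightarrow> 'a \<Rightarrow> bool) \<Rightarrow> ('a \<Rightarrow> int) \<Rightarrow> nat \<Rightarrow> 'a \<Rightarrow> 'a \<Rightarrow> int \<Rightarrow> bool"
  for n V R res where
  walk_code_0: "walk_code n V R res 0 u u 0"
| walk_code_Suc: "\<lbrakk>w \<in> V; R u w; walk_code n V R res k w v Q\<rbrakk> \<Longrightarrow>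
     walk_code n V R res (Suc k) u v (res w * int n ^ k + Q)"

lemma coded_bounds:
  assumes "coded n V R res v z" shows "0 \<le> z" "z \<le> 1"
  using assms by (auto elim: coded.cases)

lemma coded_mono:
  assumes "coded n V R res v z" "V \<subseteq> V'" shows "coded n V' R res v z"
  using assms(1)
proof (coinduction arbitrary: v z)
  case coded
  then show ?case using assms(2) by (cases rule: coded.cases) blast
qed

lemma walk_code_mono:
  assumes "walk_code n V R res k u v Q" "V \<subseteq> V'" shows "walk_code n V' R res k u v Q"
  using assms by induction (auto intro: walk_code.intros)

lemma walk_code_append:
  assumes "walk_code n V R res k u v Q" "walk_code n V R res j v w Q'"
  shows "walk_code n V R res (k + j) u w (Q * int n ^ j + Q')"
  using assms
proof (induction)
  case (walk_code_Suc x u k v Q)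
  have "walk_code n V R res (Suc (k + j)) u w (res x * int n ^ (k + j) + (Q * int n ^ j + Q'))"
    using walk_code_Suc by (intro walk_code.intros) auto
  then show ?case by (simp add: power_add algebra_simps)
qed auto

lemma walk_code_exists:
  assumes "(u, v) \<in> (edges V R)\<^sup>*"
  shows "\<exists>k Q. walk_code n V R res k u v Q"
  using assms
proof (induction rule: converse_rtrancl_induct)
  case (step y z)
  then show ?case by (blast intro: walk_code_Suc)
qed (blast intro: walk_code_0)

text \<open>The common abstraction of G_\<Xi> and G*. By \<open>resolving\<close>, a walk is
  determined by its start and its residues, so counting walks means counting n-adic
  cylinders.\<close>

locale residue_graph =
  fixes n :: nat and V :: "'a set" and R :: "'a \<Rightarrow> 'a \<Rightarrow> bool" and res :: "'a \<Rightarrow> int"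
  assumes n2: "n \<ge> 2"
    and fin: "finite V"
    and res_range: "\<And>v. v \<in> V \<Longrightarrow> 0 \<le> res v \<and> res v < int n"
    and resolving: "\<And>u v w. u \<in> V \<Longrightarrow> v \<in> V \<Longrightarrow> w \<in> V \<Longrightarrow> R u v \<Longrightarrow> R u w \<Longrightarrow> res v = res w \<Longrightarrow> v = w"
begin

lemma subgraph: "H \<subseteq> V \<Longrightarrow> residue_graph n H R res"
  by unfold_locales (use n2 fin res_range resolving in \<open>blast intro: finite_subset\<close>)+

lemma walk_code_range: "walk_code n V R res k u v Q \<Longrightarrow> 0 \<le> Q \<and> Q < int n ^ k"
proof (induction rule: walk_code.induct)
  case (walk_code_Suc w u k v Q)
  have r: "0 \<le> res w" "res w + 1 \<le> int n" using res_range walk_code_Suc.hyps by force+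
  have "(res w + 1) * int n ^ k \<le> int n * int n ^ k" using r by (intro mult_right_mono) auto
  then show ?case using walk_code_Suc.IH r by (auto simp: algebra_simps)
qed simp

text \<open>Prepending a walk with digit integer \<open>Q\<close> prepends its digits to the
  expansion; thus the points coded from \<open>u\<close> contain a copy, scaled by n^(-k), of those
  coded from \<open>v\<close>.\<close>

lemma coded_walk_code:
  assumes "walk_code n V R res k u v Q" "coded n V R res v z"
  shows "coded n V R res u ((real_of_int Q + z) / real n ^ k)"
  using assms
proof (induction)
  case (walk_code_Suc w u k v Q)
  let ?z = "(real_of_int Q + z) / real n ^ k"
  have IH: "coded n V R res w ?z" using walk_code_Suc by blast
  have r: "0 \<le> res w" "res w + 1 \<le> int n" using res_range walk_code_Suc.hyps by force+
  have n0: "real n > 0" using n2 by simp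
  have e: "(real_of_int (res w * int n ^ k + Q) + z) / real n ^ Suc k = (real_of_int (res w) + ?z) / real n"
    using n0 by (simp add: field_simps)
  have r2: "real_of_int (res w) + 1 \<le> real n" using r(2) by linarith
  show ?case unfolding e
  proof (rule coded.intros[OF walk_code_Suc.hyps(1,2) _ _ _ IH])
    show "0 \<le> (real_of_int (res w) + ?z) / real n" using coded_bounds[OF IH] r n0 by simp
    have "real_of_int (res w) + ?z \<le> real n" using coded_bounds(2)[OF IH] r2 by linarith
    then show "(real_of_int (res w) + ?z) / real n \<le> 1" using n0 by simp
  qed (use n0 in simp)
qed simp

text \<open>Distinct first vertices have distinct residues by \<open>resolving\<close>, and that
  residue is the leading digit of the code, so the codes split disjointly as the walks do.\<close>

lemma card_walk_codes:
  assumes "u \<in> V"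
  shows "finite {Q. \<exists>v. walk_code n V R res k u v Q}"
    and "card {Q. \<exists>v. walk_code n V R res k u v Q} = nwalks V R k u"
proof -
  have "finite {Q. \<exists>v. walk_code n V R res k u v Q} \<and> card {Q. \<exists>v. walk_code n V R res k u v Q} = nwalks V R k u"
    using assms
  proof (induction k arbitrary: u)
    case 0
    have "{Q. \<exists>v. walk_code n V R res 0 u v Q} = {0}"
      by (auto intro: walk_code.intros elim: walk_code.cases)
    then show ?case by simp
  next
    case (Suc k)
    let ?S = "{w\<in>V. R u w}" and ?C = "\<lambda>w. {Q. \<exists>v. walk_code n V R res k w v Q}"
    let ?f = "\<lambda>w Q. res w * int n ^ k + Q"
    have eq: "{Q. \<exists>v. walk_code n V R res (Suc k) u v Q} = (\<Union>w\<in>?S. ?f w ` ?C w)"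
    proof (intro subset_antisym subsetI)
      fix Q assume "Q \<in> {Q. \<exists>v. walk_code n V R res (Suc k) u v Q}"
      then obtain v where "walk_code n V R res (Suc k) u v Q" by blast
      then show "Q \<in> (\<Union>w\<in>?S. ?f w ` ?C w)" by (cases rule: walk_code.cases) auto
    qed (auto intro: walk_code.intros)
    have div: "Q div int n ^ k = res w" if "Q \<in> ?f w ` ?C w" for Q w
    proof -
      from that obtain Q' v where Q': "Q = res w * int n ^ k + Q'" "walk_code n V R res k w v Q'" by auto
      have "0 \<le> Q'" "Q' < int n ^ k" "int n ^ k \<noteq> 0" using walk_code_range[OF Q'(2)] n2 by auto
      then show ?thesis by (simp add: Q'(1))
    qed
    have "card (\<Union>w\<in>?S. ?f w ` ?C w) = (\<Sum>w\<in>?S. card (?f w ` ?C w))"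
    proof (rule card_UN_disjoint)
      show "\<forall>i\<in>?S. \<forall>j\<in>?S. i \<noteq> j \<longrightarrow> ?f i ` ?C i \<inter> ?f j ` ?C j = {}"
      proof (intro ballI impI)
        fix i j assume *: "i \<in> ?S" "j \<in> ?S" "i \<noteq> j"
        then have "res i \<noteq> res j" using resolving[of u i j] Suc.prems by auto
        then show "?f i ` ?C i \<inter> ?f j ` ?C j = {}" using div by (metis disjoint_iff)
      qed
    qed (use fin Suc.IH in auto)
    also have "\<dots> = (\<Sum>w\<in>?S. nwalks V R k w)"
      by (rule sum.cong) (use Suc.IH in \<open>auto simp: card_image\<close>)
    finally show ?case unfolding eq using fin Suc.IH by auto
  qed
  then show "finite {Q. \<exists>v. walk_code n V R res k u v Q}"
    "card {Q. \<exists>v. walk_code n V R res k u v Q} = nwalks V R k u" by auto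
qed

lemma walk_code_target: "walk_code n V R res k u v Q \<Longrightarrow> u \<in> V \<Longrightarrow> v \<in> V"
  by (induction rule: walk_code.induct) auto

text \<open>Fixing the end vertex costs only the factor \<open>card V\<close>. This is for later
  use, where many walks are to be prolonged by one and the same further walk.\<close>

lemma nwalks_pigeonhole:
  assumes "u \<in> V"
  obtains v where "v \<in> V" "nwalks V R k u \<le> card V * card {Q. walk_code n V R res k u v Q}"
proof -
  let ?C = "\<lambda>v. {Q. walk_code n V R res k u v Q}"
  have "{Q. \<exists>v. walk_code n V R res k u v Q} \<subseteq> (\<Union>v\<in>V. ?C v)"
    using walk_code_target assms by blast
  moreover have finC: "finite (?C v)" for v
    by (rule finite_subset[OF _ card_walk_codes(1)[OF assms, of k]]) auto
  ultimately have "nwalks V R k u \<le> card (\<Union>v\<in>V. ?C v)"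
    unfolding card_walk_codes(2)[OF assms, symmetric] using fin by (intro card_mono) auto
  also have "\<dots> \<le> (\<Sum>v\<in>V. card (?C v))" by (rule card_UN_le[OF fin])
  finally have le: "nwalks V R k u \<le> (\<Sum>v\<in>V. card (?C v))" .
  have "\<exists>v\<in>V. nwalks V R k u \<le> card V * card (?C v)"
  proof (rule ccontr)
    assume "\<not> ?thesis"
    then have *: "card V * card (?C v) < nwalks V R k u" if "v \<in> V" for v using that by force
    have "card V * (\<Sum>v\<in>V. card (?C v)) = (\<Sum>v\<in>V. card V * card (?C v))" by (rule sum_distrib_left)
    also have "\<dots> < (\<Sum>v\<in>V. nwalks V R k u)"
      by (rule sum_strict_mono) (use fin assms * in auto)
    also have "\<dots> = card V * nwalks V R k u" by simp
    finally show False using mult_le_mono2[OF le, of "card V"] by linarith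
  qed
  then show ?thesis using that by blast
qed

text \<open>Unfolding \<open>coded\<close> once writes the set at \<open>v\<close> as a union of
  copies, scaled by 1/n, of the sets at its successors; the recursion for the number of pieces is
  that of \<open>nwalks\<close>.\<close>

lemma coded_covers:
  "\<exists>\<C>. finite \<C> \<and> {z. coded n V R res v z} \<subseteq> \<Union>\<C> \<and> card \<C> \<le> nwalks V R k v \<and>
     (\<forall>D\<in>\<C>. bounded D \<and> diameter D \<le> real n powr (- real k))"
proof (induction k arbitrary: v)
  case 0
  show ?case using n2
    by (intro exI[of _ "{{0..1}}"]) (auto dest: coded_bounds)
next
  case (Suc k)
  then obtain \<C> where \<C>: "\<And>w. finite (\<C> w)" "\<And>w. {z. coded n V R res w z} \<subseteq> \<Union>(\<C> w)"
      "\<And>w. card (\<C> w) \<le> nwalks V R k w"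
      "\<And>w D. D \<in> \<C> w \<Longrightarrow> bounded D \<and> diameter D \<le> real n powr (- real k)" by metis
  let ?S = "{w\<in>V. R v w}" and ?f = "\<lambda>w z. (real_of_int (res w) + z) / real n"
  let ?D = "\<Union>w\<in>?S. (`) (?f w) ` \<C> w"
  have n0: "real n > 0" using n2 by simp
  have "card ?D \<le> (\<Sum>w\<in>?S. card ((`) (?f w) ` \<C> w))" by (rule card_UN_le) (use fin in simp)
  also have "\<dots> \<le> (\<Sum>w\<in>?S. nwalks V R k w)"
    by (rule sum_mono) (use \<C>(1,3) card_image_le order_trans in blast)
  finally have "card ?D \<le> nwalks V R (Suc k) v" by simp
  moreover have "finite ?D" using fin \<C>(1) by auto
  moreover have "{z. coded n V R res v z} \<subseteq> \<Union>?D"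
  proof safe
    fix z assume "coded n V R res v z"
    then obtain w z' where w: "w \<in> ?S" "real n * z = real_of_int (res w) + z'" "coded n V R res w z'"
      by (auto elim: coded.cases)
    then obtain B where B: "B \<in> \<C> w" "z' \<in> B" using \<C>(2) by blast
    have "z = ?f w z'" using w(2) n0 by (simp add: field_simps)
    then have "z \<in> ?f w ` B" using B by blast
    then show "z \<in> \<Union>?D" using w B by blast
  qed
  moreover have "bounded D \<and> diameter D \<le> real n powr (- real (Suc k))" if "D \<in> ?D" for D
  proof -
    from that obtain w B where w: "D = ?f w ` B" "B \<in> \<C> w" by auto
    have d: "dist (?f w x) (?f w y) \<le> (1 / real n) * dist x y" for x y
      using n0 by (simp add: dist_real_def diff_divide_distrib[symmetric] abs_divide)
    have "bounded D" "diameter D \<le> (1 / real n) * diameter B"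
      using diameter_lipschitz_image[of B "1 / real n" "?f w"] \<C>(4)[OF w(2)] n0 d w(1) by auto
    moreover have "(1 / real n) * diameter B \<le> (1 / real n) * real n powr (- real k)"
      using \<C>(4)[OF w(2)] n0 by (intro mult_left_mono) auto
    moreover have "(1 / real n) * real n powr (- real k) = real n powr (- real (Suc k))"
      using n0 by (simp add: powr_minus_divide powr_realpow del: of_nat_Suc)
    ultimately show ?thesis by simp
  qed
  ultimately show ?case by blast
qed

lemma coded_null:
  assumes "v \<in> V" "s > 0" "graph_radius V R < real n powr s"
  shows "hausdorff_measure s {z. coded n V R res v z} = 0"
proof -
  \<comment> \<open>Above the radius, so that walk counts are controlled, and below n^s, so that the
    covers become cheap.\<close>
  define \<sigma> where "\<sigma> = (graph_radius V R + real n powr s) / 2"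
  have \<sigma>: "graph_radius V R < \<sigma>" "\<sigma> < real n powr s" "0 < \<sigma>"
    using assms graph_radius_nonneg[OF fin, of R] by (auto simp: \<sigma>_def)
  obtain C where C: "C \<ge> 0" "\<And>k v. v \<in> V \<Longrightarrow> real (nwalks V R k v) \<le> C * \<sigma> ^ k"
    using nwalks_growth[OF fin \<sigma>(1)] by blast
  show ?thesis
  proof (rule hausdorff_null_finite_covers[OF assms(2) _ \<sigma>(3,2) C(1)])
    fix k
    obtain \<C> where *: "finite \<C>" "{z. coded n V R res v z} \<subseteq> \<Union>\<C>" "card \<C> \<le> nwalks V R k v"
      "\<forall>D\<in>\<C>. bounded D \<and> diameter D \<le> real n powr (- real k)" using coded_covers[of v k] by blast
    have "real (card \<C>) \<le> C * \<sigma> ^ k" using *(3) C(2)[OF assms(1), of k] by linarith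
    then show "\<exists>\<C>. finite \<C> \<and> {z. coded n V R res v z} \<subseteq> \<Union> \<C> \<and> real (card \<C>) \<le> C * \<sigma> ^ k \<and>
        (\<forall>D\<in>\<C>. bounded D \<and> diameter D \<le> real n powr - real k)" using * by blast
  qed (use n2 in simp)
qed

text \<open>With at most one successor per vertex, two points coded from \<open>v\<close> share all
  digits and differ by at most n^(-k) for every k.\<close>

lemma coded_unique:
  assumes uniq: "\<And>v w w'. v \<in> V \<Longrightarrow> w \<in> V \<Longrightarrow> w' \<in> V \<Longrightarrow> R v w \<Longrightarrow> R v w' \<Longrightarrow> w = w'"
    and v: "v \<in> V" "coded n V R res v z" "coded n V R res v z'"
  shows "z = z'"
proof -
  have n0: "real n > 0" using n2 by simp
  have *: "\<bar>z - z'\<bar> \<le> (1 / real n) ^ k" if "v \<in> V" "coded n V R res v z" "coded n V R res v z'" for k v z z'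
    using that
  proof (induction k arbitrary: v z z')
    case 0
    then show ?case using coded_bounds[OF 0(2)] coded_bounds[OF 0(3)] by simp
  next
    case (Suc k)
    obtain w y where w: "w \<in> V" "R v w" "real n * z = real_of_int (res w) + y" "coded n V R res w y"
      using Suc.prems(2) by (auto elim: coded.cases)
    obtain w' y' where w': "w' \<in> V" "R v w'" "real n * z' = real_of_int (res w') + y'" "coded n V R res w' y'"
      using Suc.prems(3) by (auto elim: coded.cases)
    have "w = w'" using uniq Suc.prems(1) w w' by blast
    then have "\<bar>y - y'\<bar> \<le> (1 / real n) ^ k" using Suc.IH[of w y y'] w w' by simp
    moreover have "real n * \<bar>z - z'\<bar> = \<bar>y - y'\<bar>"
      using w(3) w'(3) \<open>w = w'\<close> n0 by (simp add: abs_mult_pos' right_diff_distrib)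
    ultimately have "real n * \<bar>z - z'\<bar> \<le> (1 / real n) ^ k" by simp
    then show ?case using n0 by (simp add: pos_le_divide_eq mult.commute)
  qed
  have "(\<lambda>k. (1 / real n) ^ k) \<longlonglongrightarrow> 0" using n2 by (intro LIMSEQ_power_zero) auto
  then have "\<bar>z - z'\<bar> \<le> 0"
    by (rule LIMSEQ_le_const) (use *[OF v] in auto)
  then show ?thesis by simp
qed

lemma coded_path:
  assumes "coded n V R res v z"
  obtains p \<zeta> where "p 0 = v" "\<zeta> 0 = z" "\<And>k. p (Suc k) \<in> V" "\<And>k. R (p k) (p (Suc k))"
    "\<And>k. real n * \<zeta> k = real_of_int (res (p (Suc k))) + \<zeta> (Suc k)" "\<And>k. coded n V R res (p k) (\<zeta> k)"
proof -
  \<comment> \<open>The clause for \<open>k = 0\<close> pins the start of the sequence given by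
    dependent choice; \<open>v0\<close> and \<open>z0\<close> rename the start, whose names the case
    patterns shadow.\<close>
  have "\<exists>f. \<forall>k. (case f k of (v, z) \<Rightarrow> coded n V R res v z \<and> (k = 0 \<longrightarrow> (v, z) = (v0, z0))) \<and>
     (case f k of (v, z) \<Rightarrow> case f (Suc k) of (w, y) \<Rightarrow> w \<in> V \<and> R v w \<and> real n * z = real_of_int (res w) + y)"
    if *: "v0 = v" "z0 = z" for v0 z0
  proof (rule dependent_nat_choice)
    show "\<exists>x. case x of (v, z) \<Rightarrow> coded n V R res v z \<and> (0 = 0 \<longrightarrow> (v, z) = (v0, z0))"
      using assms * by auto
    fix x and k :: nat
    assume "case x of (v, z) \<Rightarrow> coded n V R res v z \<and> (k = 0 \<longrightarrow> (v, z) = (v0, z0))"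
    then obtain v z where vz: "x = (v, z)" "coded n V R res v z" by (cases x) auto
    then obtain w y where "w \<in> V" "R v w" "real n * z = real_of_int (res w) + y" "coded n V R res w y"
      by (auto elim: coded.cases)
    then show "\<exists>y. (case y of (v, z) \<Rightarrow> coded n V R res v z \<and> (Suc k = 0 \<longrightarrow> (v, z) = (v0, z0))) \<and>
        (case x of (v, z) \<Rightarrow> case y of (w, y) \<Rightarrow> w \<in> V \<and> R v w \<and> real n * z = real_of_int (res w) + y)"
      using vz by (intro exI[of _ "(w, y)"]) auto
  qed
  then obtain f where f: "\<And>k. (case f k of (v', z') \<Rightarrow> coded n V R res v' z' \<and> (k = 0 \<longrightarrow> (v', z') = (v, z)))"
     "\<And>k. (case f k of (v, z) \<Rightarrow> case f (Suc k) of (w, y) \<Rightarrow> w \<in> V \<and> R v w \<and> real n * z = real_of_int (res w) + y)"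
    by meson
  show ?thesis
    by (rule that[of "fst \<circ> f" "snd \<circ> f"]) (use f in \<open>force simp: case_prod_unfold\<close>)+
qed

text \<open>By finiteness some vertex \<open>p j0\<close> recurs infinitely often. Every later
  vertex lies between two visits to it, hence in its strong component, and the tail of the path is
  coded there.\<close>

lemma coded_in_component:
  assumes "v \<in> V" "coded n V R res v z"
  obtains k Q H w \<zeta> where "H \<in> strong_components (digraph_of V R)" "w \<in> H" "(v, w) \<in> (edges V R)\<^sup>*"
    "coded n H R res w \<zeta>" "z = (real_of_int Q + \<zeta>) / real n ^ k"
proof -
  obtain p \<zeta> where p: "p 0 = v" "\<zeta> 0 = z" "\<And>k. p (Suc k) \<in> V" "\<And>k. R (p k) (p (Suc k))"
    "\<And>k. real n * \<zeta> k = real_of_int (res (p (Suc k))) + \<zeta> (Suc k)" "\<And>k. coded n V R res (p k) (\<zeta> k)"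
    using coded_path[OF assms(2)] by blast
  have pV: "p k \<in> V" for k using p(1,3) assms(1) by (cases k) auto
  have n0: "real n > 0" using n2 by simp
  have path: "(p i, p (i + d)) \<in> (edges V R)\<^sup>*" for i d
  proof (induction d)
    case (Suc d)
    then show ?case using pV p(4) by (auto intro: rtrancl_into_rtrancl)
  qed simp
  have path': "(p i, p j) \<in> (edges V R)\<^sup>*" if "i \<le> j" for i j using path[of i "j - i"] that by simp
  have "\<exists>a\<in>UNIV. infinite {k\<in>UNIV. p k = p a}"
    by (rule pigeonhole_infinite) (use fin pV in \<open>auto intro: finite_subset[of _ V]\<close>)
  then obtain j0 where inf: "infinite {k. p k = p j0}" by auto
  define H where "H = {u\<in>V. (u, p j0) \<in> (edges V R)\<^sup>* \<and> (p j0, u) \<in> (edges V R)\<^sup>*}"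
  have H: "H \<in> strong_components (digraph_of V R)" unfolding H_def by (rule strong_component_of) (rule pV)
  have pH: "p j \<in> H" if "j0 \<le> j" for j
  proof -
    obtain j' where "j < j'" "p j' = p j0" using inf by (auto simp: infinite_nat_iff_unbounded)
    then show ?thesis unfolding H_def using path'[of j j'] path'[OF that] pV by simp
  qed
  have "coded n H R res a b" if "\<exists>i\<ge>j0. a = p i \<and> b = \<zeta> i" for a b
    using that
  proof (coinduction arbitrary: a b)
    case coded
    then obtain i where i: "i \<ge> j0" "a = p i" "b = \<zeta> i" by blast
    show ?case
      by (rule exI[of _ "p (Suc i)"], rule exI[of _ a], rule exI[of _ b], rule exI[of _ "\<zeta> (Suc i)"])
        (use i pH[of "Suc i"] p coded_bounds[OF p(6)] in \<open>auto intro!: exI[of _ "Suc i"]\<close>)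
  qed
  moreover have "\<exists>Q. z = (real_of_int Q + \<zeta> k) / real n ^ k" for k
  proof (induction k)
    case 0
    show ?case using p by (intro exI[of _ 0]) auto
  next
    case (Suc k)
    then obtain Q where "z = (real_of_int Q + \<zeta> k) / real n ^ k" by blast
    moreover have "\<zeta> k = (real_of_int (res (p (Suc k))) + \<zeta> (Suc k)) / real n"
      using p(5)[of k] n0 by (simp add: field_simps)
    ultimately show ?case using n0
      by (intro exI[of _ "Q * int n + res (p (Suc k))"]) (simp add: field_simps)
  qed
  then obtain Q where "z = (real_of_int Q + \<zeta> j0) / real n ^ j0" by blast
  ultimately show ?thesis using that[OF H pH[of j0]] path'[of 0 j0] p(1) by blast
qed

end

section \<open>Lower bound for the measure: scales and digit limits\<close>

lemma ex_power_between:
  fixes \<eta> b :: real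
  assumes "0 < \<eta>" "\<eta> \<le> 1" "b > 1"
  obtains k where "\<eta> \<le> (1 / b) ^ k" "(1 / b) ^ k \<le> b * \<eta>"
proof -
  have ex: "\<exists>k. (1 / b) ^ k < \<eta>" using real_arch_pow_inv[of \<eta> "1 / b"] assms by auto
  define k where "k = (LEAST k. (1 / b) ^ k < \<eta>)"
  have k: "(1 / b) ^ k < \<eta>" unfolding k_def using LeastI_ex[OF ex] .
  then obtain j where j: "k = Suc j" using assms(2) by (cases k) auto
  then have "\<not> (1 / b) ^ j < \<eta>" unfolding k_def by (metis lessI not_less_Least)
  moreover have "(1 / b) ^ j = b * (1 / b) ^ k" using assms j by simp
  ultimately show ?thesis using that[of j] k assms by simp
qed

text \<open>Rounds a diameter up to a power of 1/b at the cost of a factor b^s. The summand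
  \<epsilon> pays for sets of diameter 0, which have no comparable scale.\<close>

lemma ex_scale:
  fixes s b \<epsilon> :: real
  assumes "b > 1" "s > 0" "\<epsilon> > 0" "0 \<le> D" "D \<le> 1"
  obtains k where "D \<le> (1 / b) ^ k" "((1 / b) ^ k) powr s \<le> b powr s * D powr s + \<epsilon>"
proof (cases "D = 0")
  case True
  define \<eta> where "\<eta> = min 1 ((\<epsilon> / b powr s) powr (1 / s))"
  have "0 < \<eta>" "\<eta> \<le> 1" using assms by (auto simp: \<eta>_def)
  then obtain k where k: "\<eta> \<le> (1 / b) ^ k" "(1 / b) ^ k \<le> b * \<eta>" using ex_power_between assms(1) by metis
  have "((1 / b) ^ k) powr s \<le> (b * \<eta>) powr s" using k assms by (intro powr_mono2) auto
  also have "\<dots> = b powr s * \<eta> powr s" using assms \<open>0 < \<eta>\<close> by (simp add: powr_mult)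
  also have "\<eta> powr s \<le> ((\<epsilon> / b powr s) powr (1 / s)) powr s"
    using assms \<open>0 < \<eta>\<close> by (intro powr_mono2) (auto simp: \<eta>_def)
  also have "\<dots> = \<epsilon> / b powr s" using assms by (simp add: powr_powr)
  finally have "((1 / b) ^ k) powr s \<le> \<epsilon>" using assms by simp
  then show ?thesis using that[of k] True assms by simp
next
  case False
  then obtain k where k: "D \<le> (1 / b) ^ k" "(1 / b) ^ k \<le> b * D" using ex_power_between[of D b] assms by auto
  have "((1 / b) ^ k) powr s \<le> (b * D) powr s" using k assms by (intro powr_mono2) auto
  also have "\<dots> = b powr s * D powr s" using assms by (simp add: powr_mult)
  finally show ?thesis using that[OF k(1)] assms by simp
qed

text \<open>The intervals [Q k / n^k, (Q k + 1) / n^k] are nested; the supremum of their left end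
  points lies in all of them.\<close>

lemma digit_limit:
  fixes Q r :: "nat \<Rightarrow> int" and n :: nat
  assumes n: "n \<ge> 1" and Q: "\<And>k. Q (Suc k) = int n * Q k + r k" and r: "\<And>k. 0 \<le> r k \<and> r k < int n"
  obtains z :: real where "\<And>k. real_of_int (Q k) \<le> real n ^ k * z" "\<And>k. real n ^ k * z \<le> real_of_int (Q k) + 1"
proof -
  have n0: "real n > 0" using n by simp
  define a where "a k = real_of_int (Q k) / real n ^ k" for k
  define b where "b k = (real_of_int (Q k) + 1) / real n ^ k" for k
  have "a k \<le> a (Suc k)" for k
  proof -
    have "real_of_int (int n * Q k) \<le> real_of_int (Q (Suc k))" using Q r[of k] by (intro of_int_le_iff[THEN iffD2]) simp
    then have "real n * real_of_int (Q k) \<le> real_of_int (Q (Suc k))" by simp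
    then show ?thesis unfolding a_def using n0 by (simp add: field_simps)
  qed
  then have inc: "a i \<le> a j" if "i \<le> j" for i j using that by (rule lift_Suc_mono_le)
  have "b (Suc k) \<le> b k" for k
  proof -
    have "Q (Suc k) + 1 \<le> int n * (Q k + 1)" using Q r[of k] by (simp add: algebra_simps)
    then have "real_of_int (Q (Suc k) + 1) \<le> real_of_int (int n * (Q k + 1))" by (rule of_int_le_iff[THEN iffD2])
    then have "real_of_int (Q (Suc k)) + 1 \<le> real n * (real_of_int (Q k) + 1)" by simp
    then have "b (Suc k) \<le> (real n * (real_of_int (Q k) + 1)) / real n ^ Suc k"
      unfolding b_def using n0 by (intro divide_right_mono) auto
    then show ?thesis unfolding b_def using n0 by simp
  qed
  then have dec: "b j \<le> b i" if "i \<le> j" for i j using that by (rule lift_Suc_antimono_le)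
  have ab: "a i \<le> b j" for i j
  proof -
    have "a i \<le> a (max i j)" by (rule inc) simp
    also have "\<dots> \<le> b (max i j)" unfolding a_def b_def using n0 by (intro divide_right_mono) auto
    also have "\<dots> \<le> b j" by (rule dec) simp
    finally show ?thesis .
  qed
  define z where "z = (SUP k. a k)"
  have bdd: "bdd_above (range a)" unfolding bdd_above_def using ab[of _ 0] by blast
  show ?thesis
  proof (rule that[of z])
    fix k
    have "a k \<le> z" unfolding z_def by (rule cSUP_upper[OF _ bdd]) simp
    then show "real_of_int (Q k) \<le> real n ^ k * z" unfolding a_def using n0 by (simp add: field_simps)
    have "z \<le> b k" unfolding z_def by (rule cSUP_least) (use ab in auto)
    then show "real n ^ k * z \<le> real_of_int (Q k) + 1" unfolding b_def using n0 by (simp add: field_simps)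
  qed
qed

context residue_graph
begin

text \<open>A mass distribution argument without a measure: if the cylinders listed in \<open>B\<close>, weighted by
  \<open>\<rho>\<^sup>-\<^sup>k\<close>, are too light compared with the subeigenvector \<open>h\<close>, then one can descend
  through the graph keeping the weight of the remaining cylinders below \<open>h\<close>, hence avoiding them all.\<close>
lemma coded_avoid:
  fixes h :: "'a \<Rightarrow> real" and \<rho> hm :: real and lev :: "nat \<Rightarrow> nat" and B :: "nat \<Rightarrow> int set"
  assumes h: "\<And>v. v \<in> V \<Longrightarrow> 0 \<le> h v" "\<And>v. v \<in> V \<Longrightarrow> h v \<le> hm"
    "\<And>v. v \<in> V \<Longrightarrow> \<rho> * h v \<le> (\<Sum>w\<in>{w\<in>V. R v w}. h w)"
    and \<rho>: "\<rho> > 0" and v0: "v0 \<in> V"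
    and B: "\<And>i. finite (B i)"
    and light: "(\<Sum>i. ennreal (real (card (B i)) * hm / \<rho> ^ lev i)) < ennreal (h v0)"
  obtains z Q where "coded n V R res v0 z"
    "\<And>k. real_of_int (Q k) \<le> real n ^ k * z" "\<And>k. real n ^ k * z \<le> real_of_int (Q k) + 1"
    "\<And>i. Q (lev i) \<notin> B i"
proof -
  have hm: "hm \<ge> 0" using h(1,2)[OF v0] by linarith
  \<comment> \<open>The members of \<open>B i\<close> inside the cylinder \<open>q\<close> of level
    \<open>k\<close>, found by dropping their last \<open>lev i - k\<close> digits. Cylinders of
    smaller level have been dealt with by then and no longer count.\<close>
  define D where "D k q i = (if k \<le> lev i then {q'\<in>B i. q' div int n ^ (lev i - k) = q} else {})" for k q i
  define cost where "cost k q = (\<Sum>i. ennreal (real (card (D k q i)) * hm / \<rho> ^ lev i))" for k q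
  have fD: "finite (D k q i)" for k q i using B by (simp add: D_def)
  have cost0: "cost 0 0 < ennreal (h v0)"
  proof -
    have "cost 0 0 \<le> (\<Sum>i. ennreal (real (card (B i)) * hm / \<rho> ^ lev i))"
      unfolding cost_def
    proof (rule suminf_le)
      fix i
      have "card (D 0 0 i) \<le> card (B i)" by (rule card_mono[OF B]) (auto simp: D_def)
      then show "ennreal (real (card (D 0 0 i)) * hm / \<rho> ^ lev i) \<le> ennreal (real (card (B i)) * hm / \<rho> ^ lev i)"
        using hm \<rho> by (intro ennreal_leI divide_right_mono mult_right_mono) auto
    qed auto
    then show ?thesis using light by simp
  qed
  \<comment> \<open>Were every successor too expensive, the subeigenvector inequality would force
    \<open>cost k q\<close> up to h(v) / \<rho>^k: cylinders below different successors are
    disjoint, since their residues differ.\<close>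
  have step: "\<exists>w\<in>V. R v w \<and> cost (Suc k) (int n * q + res w) < ennreal (h w / \<rho> ^ Suc k)"
    if v: "v \<in> V" and c: "cost k q < ennreal (h v / \<rho> ^ k)" for k q v
  proof (rule ccontr)
    let ?S = "{w\<in>V. R v w}"
    assume neg: "\<not> ?thesis"
    have ge: "ennreal (h w / \<rho> ^ Suc k) \<le> cost (Suc k) (int n * q + res w)" if "w \<in> ?S" for w
      using neg that unfolding not_less[symmetric] by blast
    have fS: "finite ?S" using fin by simp
    have "h v / \<rho> ^ k = (\<rho> * h v) / \<rho> ^ Suc k" using \<rho> by simp
    also have "\<dots> \<le> (\<Sum>w\<in>?S. h w) / \<rho> ^ Suc k" using h(3)[OF v] \<rho> by (intro divide_right_mono) auto
    finally have "ennreal (h v / \<rho> ^ k) \<le> ennreal (\<Sum>w\<in>?S. h w / \<rho> ^ Suc k)"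
      by (intro ennreal_leI) (simp add: sum_divide_distrib)
    also have "\<dots> = (\<Sum>w\<in>?S. ennreal (h w / \<rho> ^ Suc k))"
      using h(1) \<rho> by (intro sum_ennreal[symmetric]) auto
    also have "\<dots> \<le> (\<Sum>w\<in>?S. cost (Suc k) (int n * q + res w))" by (rule sum_mono) (rule ge)
    also have "\<dots> = (\<Sum>i. \<Sum>w\<in>?S. ennreal (real (card (D (Suc k) (int n * q + res w) i)) * hm / \<rho> ^ lev i))"
      unfolding cost_def by (rule suminf_sum[symmetric]) auto
    also have "\<dots> \<le> cost k q"
      unfolding cost_def
    proof (rule suminf_le)
      fix i
      have sub: "(\<Union>w\<in>?S. D (Suc k) (int n * q + res w) i) \<subseteq> D k q i"
      proof
        fix x assume "x \<in> (\<Union>w\<in>?S. D (Suc k) (int n * q + res w) i)"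
        then obtain w where w: "w \<in> V" "x \<in> B i" "Suc k \<le> lev i" "x div int n ^ (lev i - Suc k) = int n * q + res w"
          by (auto simp: D_def split: if_splits)
        have "lev i - k = Suc (lev i - Suc k)" using w by simp
        then have "x div int n ^ (lev i - k) = x div (int n ^ (lev i - Suc k) * int n)" by (simp add: mult.commute)
        also have "\<dots> = (int n * q + res w) div int n" using n2 by (simp add: zdiv_zmult2_eq w(4)[symmetric])
        also have "\<dots> = q" using res_range[OF w(1)] n2 by simp
        finally show "x \<in> D k q i" using w by (simp add: D_def)
      qed
      have "(\<Sum>w\<in>?S. card (D (Suc k) (int n * q + res w) i)) = card (\<Union>w\<in>?S. D (Suc k) (int n * q + res w) i)"
      proof (rule card_UN_disjoint[symmetric, OF fS])
        show "\<forall>w\<in>?S. \<forall>w'\<in>?S. w \<noteq> w' \<longrightarrow> D (Suc k) (int n * q + res w) i \<inter> D (Suc k) (int n * q + res w') i = {}"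
        proof (intro ballI impI)
          fix w w' assume "w \<in> ?S" "w' \<in> ?S" "w \<noteq> w'"
          then have "res w \<noteq> res w'" using resolving[OF v, of w w'] by auto
          then show "D (Suc k) (int n * q + res w) i \<inter> D (Suc k) (int n * q + res w') i = {}" by (auto simp: D_def)
        qed
      qed (use fD in auto)
      also have "\<dots> \<le> card (D k q i)" by (rule card_mono[OF fD sub])
      finally have le: "(\<Sum>w\<in>?S. card (D (Suc k) (int n * q + res w) i)) \<le> card (D k q i)" .
      have "(\<Sum>w\<in>?S. ennreal (real (card (D (Suc k) (int n * q + res w) i)) * hm / \<rho> ^ lev i)) =
          ennreal (\<Sum>w\<in>?S. real (card (D (Suc k) (int n * q + res w) i)) * hm / \<rho> ^ lev i)"
        using hm \<rho> by (intro sum_ennreal) auto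
      also have "\<dots> = ennreal (real (\<Sum>w\<in>?S. card (D (Suc k) (int n * q + res w) i)) * hm / \<rho> ^ lev i)"
        by (simp add: sum_divide_distrib sum_distrib_right)
      also have "\<dots> \<le> ennreal (real (card (D k q i)) * hm / \<rho> ^ lev i)"
        using hm \<rho> of_nat_mono[OF le, where ?'a = real] by (intro ennreal_leI divide_right_mono mult_right_mono) auto
      finally show "(\<Sum>w\<in>?S. ennreal (real (card (D (Suc k) (int n * q + res w) i)) * hm / \<rho> ^ lev i))
          \<le> ennreal (real (card (D k q i)) * hm / \<rho> ^ lev i)" .
    qed auto
    finally show False using c by simp
  qed
  let ?P = "\<lambda>k x. fst x \<in> V \<and> cost k (snd x) < ennreal (h (fst x) / \<rho> ^ k) \<and> (k = 0 \<longrightarrow> x = (v0, 0))"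
  let ?Q = "\<lambda>x y. R (fst x) (fst y) \<and> snd y = int n * snd x + res (fst y)"
  have "\<exists>f. \<forall>k. ?P k (f k) \<and> ?Q (f k) (f (Suc k))"
  proof (rule dependent_nat_choice)
    show "\<exists>x. ?P 0 x" using v0 cost0 by (intro exI[of _ "(v0, 0)"]) simp
    fix x k assume x: "?P k x"
    then obtain w where "w \<in> V" "R (fst x) w" "cost (Suc k) (int n * snd x + res w) < ennreal (h w / \<rho> ^ Suc k)"
      using step[of "fst x" k "snd x"] by blast
    then show "\<exists>y. ?P (Suc k) y \<and> ?Q x y"
      by (intro exI[of _ "(w, int n * snd x + res w)"]) simp
  qed
  then obtain f where f: "\<And>k. ?P k (f k)" "\<And>k. ?Q (f k) (f (Suc k))" by blast
  define p where "p k = fst (f k)" for k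
  define Q where "Q k = snd (f k)" for k
  have p: "p 0 = v0" "p k \<in> V" "R (p k) (p (Suc k))" for k using f by (auto simp: p_def)
  have Q: "Q 0 = 0" "Q (Suc k) = int n * Q k + res (p (Suc k))" for k using f by (auto simp: p_def Q_def)
  obtain z where z: "\<And>k. real_of_int (Q k) \<le> real n ^ k * z" "\<And>k. real n ^ k * z \<le> real_of_int (Q k) + 1"
    using digit_limit[of n Q "\<lambda>k. res (p (Suc k))"] n2 Q(2) res_range p(2) by (metis le_trans one_le_numeral)
  have "coded n V R res (p k) (real n ^ k * z - real_of_int (Q k))" for k
  proof (coinduction arbitrary: k)
    case coded
    show ?case
      by (rule exI[of _ "p (Suc k)"], rule exI[of _ "p k"], rule exI[of _ "real n ^ k * z - real_of_int (Q k)"],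
          rule exI[of _ "real n ^ Suc k * z - real_of_int (Q (Suc k))"])
        (use p(2,3)[of k] p(2)[of "Suc k"] Q z[of k] in \<open>auto simp: algebra_simps intro: exI[of _ "Suc k"]\<close>)
  qed
  from this[of 0] have "coded n V R res v0 z" using p(1) Q(1) by simp
  moreover have "Q (lev i) \<notin> B i" for i
  proof
    \<comment> \<open>At its own level a listed cylinder alone costs
      \<open>hm / \<rho> ^ lev i\<close>, which the invariant forbids because h \<le>
      \<open>hm\<close>.\<close>
    assume "Q (lev i) \<in> B i"
    then have "D (lev i) (Q (lev i)) i = {Q (lev i)}" by (auto simp: D_def)
    then have "ennreal (hm / \<rho> ^ lev i) = ennreal (real (card (D (lev i) (Q (lev i)) i)) * hm / \<rho> ^ lev i)" by simp
    also have "\<dots> = (\<Sum>j\<in>{i}. ennreal (real (card (D (lev i) (Q (lev i)) j)) * hm / \<rho> ^ lev j))" by simp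
    also have "\<dots> \<le> cost (lev i) (Q (lev i))" unfolding cost_def by (rule sum_le_suminf) auto
    also have "\<dots> < ennreal (h (p (lev i)) / \<rho> ^ lev i)" using f(1)[of "lev i"] by (simp add: p_def Q_def)
    also have "\<dots> \<le> ennreal (hm / \<rho> ^ lev i)"
      using h(2)[OF p(2)] \<rho> by (intro ennreal_leI divide_right_mono) auto
    finally show False by simp
  qed
  ultimately show ?thesis using z that by blast
qed

text \<open>A cover that is too cheap is turned into lists of n-adic cylinders touching its members;
  these are light, so \<open>coded_avoid\<close> produces a coded point outside all of them, hence
  outside the cover.\<close>

lemma coded_positive_start:
  assumes rad: "graph_radius V R > 1" and s: "real n powr s = graph_radius V R"
  obtains v where "v \<in> V" "hausdorff_measure s {z. coded n V R res v z} \<noteq> 0"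
proof -
  define \<rho> where "\<rho> = graph_radius V R"
  have \<rho>: "\<rho> > 1" using rad by (simp add: \<rho>_def)
  have n1: "real n > 1" using n2 by simp
  have s0: "s > 0"
  proof (rule ccontr)
    assume "\<not> s > 0"
    then have "real n powr s \<le> 1" using n1 powr_mono[of s 0 "real n"] by simp
    then show False using rad s by simp
  qed
  have ne: "V \<noteq> {}"
  proof
    assume "V = {}"
    then have "graph_radius V R = 0" using vertex_list_digraph_of[of V R]
      by (simp add: real_spectral_radius_def adjacency_mat_def Let_def)
    with rad show False by simp
  qed
  obtain h :: "'a \<Rightarrow> real" where h: "\<And>v. h v \<ge> 0" "\<exists>v\<in>V. h v > 0"
    "\<And>v. v \<in> V \<Longrightarrow> \<rho> * h v \<le> (\<Sum>w\<in>{w\<in>V. R v w}. h w)"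
    using graph_radius_subeigenvector[OF fin ne] unfolding \<rho>_def by blast
  then obtain v0 where v0: "v0 \<in> V" "h v0 > 0" by blast
  define hm where "hm = Max (h ` V)"
  have hm: "h v \<le> hm" if "v \<in> V" for v unfolding hm_def using fin that by simp
  have hm0: "hm > 0" using hm[OF v0(1)] v0(2) by simp
  \<comment> \<open>Each cover set touches at most 4 cylinders of weight at most \<open>hm\<close>.
    The diameters and the rounding errors contribute at most 4 hm \<epsilon> = h(v0) / 4 each, in
    total h(v0) / 2.\<close>
  define \<epsilon> where "\<epsilon> = h v0 / (16 * hm)"
  have \<epsilon>: "\<epsilon> > 0" using v0 hm0 by (simp add: \<epsilon>_def)
  have "hausdorff_premeasure s 1 {z. coded n V R res v0 z} \<ge> ennreal (\<epsilon> / \<rho>)"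
  proof (rule ccontr)
    assume "\<not> ?thesis"
    then have "hausdorff_premeasure s 1 {z. coded n V R res v0 z} < ennreal (\<epsilon> / \<rho>)" by simp
    then obtain C where C: "{z. coded n V R res v0 z} \<subseteq> (\<Union>i. C i)" "\<And>i. bounded (C i)" "\<And>i. diameter (C i) \<le> 1"
        "(\<Sum>i. diam_power s (C i)) < ennreal (\<epsilon> / \<rho>)"
      using hausdorff_premeasure_cover by metis
    have dn: "0 \<le> diameter (C i)" for i using diameter_ge_0[OF C(2)] .
    have "\<exists>k. diameter (C i) \<le> (1 / real n) ^ k \<and>
       ((1 / real n) ^ k) powr s \<le> real n powr s * diameter (C i) powr s + \<epsilon> * (1/2) ^ Suc i" for i
    proof -
      have "\<epsilon> * (1/2) ^ Suc i > 0" using \<epsilon> by simp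
      from ex_scale[OF n1 s0 this dn C(3)] show ?thesis by metis
    qed
    then obtain lev where lev: "\<And>i. diameter (C i) \<le> (1 / real n) ^ lev i"
       "\<And>i. ((1 / real n) ^ lev i) powr s \<le> real n powr s * diameter (C i) powr s + \<epsilon> * (1/2) ^ Suc i" by metis
    have pw: "((1 / real n) ^ k) powr s = 1 / \<rho> ^ k" for k
    proof -
      have "((1 / real n) ^ k) powr s = (1 / real n ^ k) powr s" by (simp add: power_one_over)
      also have "\<dots> = 1 / (real n ^ k) powr s" using n1 by (simp add: powr_divide)
      also have "(real n ^ k) powr s = (real n powr s) ^ k"
        using n1 by (simp add: powr_powr powr_realpow[symmetric] mult.commute)
      finally show ?thesis by (simp add: s \<rho>_def)
    qed
    \<comment> \<open>Closed cylinders are used, since the point found by avoidance is located in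
      closed ones only.\<close>
    define B where "B i = {q::int. \<exists>z\<in>C i. real_of_int q \<le> real n ^ lev i * z \<and> real n ^ lev i * z \<le> real_of_int q + 1}" for i
    have B4: "finite (B i) \<and> card (B i) \<le> 4" for i
    proof (cases "C i = {}")
      case False
      then obtain z0 where z0: "z0 \<in> C i" by blast
      define m0 where "m0 = \<lfloor>real n ^ lev i * z0\<rfloor>"
      \<comment> \<open>After scaling, \<open>C i\<close> lies within distance 1 of a point with
        integer part \<open>m0\<close>, that is, in [m0 - 1, m0 + 2); a closed unit interval meeting
        this range starts at one of four integers.\<close>
      have "B i \<subseteq> {m0 - 2..m0 + 1}"
      proof
        fix q assume "q \<in> B i"
        then obtain z where z: "z \<in> C i" "real_of_int q \<le> real n ^ lev i * z" "real n ^ lev i * z \<le> real_of_int q + 1"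
          by (auto simp: B_def)
        have "\<bar>z - z0\<bar> \<le> (1 / real n) ^ lev i"
          using diameter_bounded_bound[OF C(2) z(1) z0] lev(1)[of i] by (simp add: dist_real_def)
        then have "real n ^ lev i * \<bar>z - z0\<bar> \<le> real n ^ lev i * (1 / real n) ^ lev i"
          using n1 by (intro mult_left_mono) auto
        also have "\<dots> = 1" using n1 by (simp add: power_one_over)
        finally have "\<bar>real n ^ lev i * z - real n ^ lev i * z0\<bar> \<le> 1"
          using n1 by (simp add: abs_mult right_diff_distrib[symmetric])
        then show "q \<in> {m0 - 2..m0 + 1}" using z(2,3) unfolding m0_def atLeastAtMost_iff by linarith
      qed
      from finite_subset[OF this] card_mono[OF _ this] show ?thesis by simp
    qed (simp add: B_def)
    have "(\<Sum>i. ennreal (real (card (B i)) * hm / \<rho> ^ lev i)) \<le>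
        (\<Sum>i. ennreal (4 * hm * \<rho>) * diam_power s (C i) + ennreal (4 * hm * \<epsilon> * (1/2) ^ Suc i))"
    proof (rule suminf_le)
      fix i
      have "real (card (B i)) * hm / \<rho> ^ lev i \<le> 4 * hm / \<rho> ^ lev i"
        using B4[of i] hm0 \<rho> by (intro divide_right_mono mult_right_mono) auto
      also have "\<dots> = 4 * hm * (1 / \<rho> ^ lev i)" by simp
      also have "\<dots> \<le> 4 * hm * (\<rho> * diameter (C i) powr s + \<epsilon> * (1/2) ^ Suc i)"
        using lev(2)[of i] hm0 unfolding pw s \<rho>_def[symmetric] by (intro mult_left_mono) auto
      finally have 1: "real (card (B i)) * hm / \<rho> ^ lev i \<le> 4 * hm * \<rho> * diameter (C i) powr s + 4 * hm * \<epsilon> * (1/2) ^ Suc i"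
        by (simp add: algebra_simps)
      show "ennreal (real (card (B i)) * hm / \<rho> ^ lev i) \<le> ennreal (4 * hm * \<rho>) * diam_power s (C i) + ennreal (4 * hm * \<epsilon> * (1/2) ^ Suc i)"
      proof (cases "C i = {}")
        case True
        then show ?thesis using hm0 \<epsilon> by (simp add: B_def)
      next
        case False
        have "ennreal (real (card (B i)) * hm / \<rho> ^ lev i) \<le> ennreal (4 * hm * \<rho> * diameter (C i) powr s + 4 * hm * \<epsilon> * (1/2) ^ Suc i)"
          by (rule ennreal_leI[OF 1])
        also have "\<dots> = ennreal (4 * hm * \<rho>) * diam_power s (C i) + ennreal (4 * hm * \<epsilon> * (1/2) ^ Suc i)"
          using False s0 hm0 \<epsilon> \<rho> by (simp add: diam_power_def ennreal_mult)
        finally show ?thesis .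
      qed
    qed auto
    also have "\<dots> = ennreal (4 * hm * \<rho>) * (\<Sum>i. diam_power s (C i)) + (\<Sum>i. ennreal (4 * hm * \<epsilon> * (1/2) ^ Suc i))"
      by (subst suminf_add[symmetric]) auto
    also have "(\<Sum>i. ennreal (4 * hm * \<epsilon> * (1/2) ^ Suc i)) = ennreal (4 * hm * \<epsilon>)"
    proof -
      have "(\<lambda>i. 4 * hm * \<epsilon> * (1/2) ^ Suc i) sums (4 * hm * \<epsilon> * 1)" by (intro sums_mult power_half_series)
      then show ?thesis using hm0 \<epsilon> by (subst suminf_ennreal_eq) auto
    qed
    also have "ennreal (4 * hm * \<rho>) * (\<Sum>i. diam_power s (C i)) \<le> ennreal (4 * hm * \<rho>) * ennreal (\<epsilon> / \<rho>)"
      using C(4) by (intro mult_left_mono) auto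
    also have "ennreal (4 * hm * \<rho>) * ennreal (\<epsilon> / \<rho>) = ennreal (4 * hm * \<epsilon>)"
      using hm0 \<rho> \<epsilon> by (simp flip: ennreal_mult)
    also have "ennreal (4 * hm * \<epsilon>) + ennreal (4 * hm * \<epsilon>) = ennreal (h v0 / 2)"
      using hm0 v0 by (simp add: \<epsilon>_def flip: ennreal_plus)
    also have "\<dots> < ennreal (h v0)" using v0 by (simp add: ennreal_less_iff)
    finally have light: "(\<Sum>i. ennreal (real (card (B i)) * hm / \<rho> ^ lev i)) < ennreal (h v0)" by (simp add: add_right_mono)
    obtain z Q where z: "coded n V R res v0 z" "\<And>k. real_of_int (Q k) \<le> real n ^ k * z"
        "\<And>k. real n ^ k * z \<le> real_of_int (Q k) + 1" "\<And>i. Q (lev i) \<notin> B i"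
      by (rule coded_avoid[OF h(1) hm h(3) _ v0(1) _ light]) (use \<rho> B4 in auto)
    obtain i where "z \<in> C i" using z(1) C(1) by blast
    then show False using z(2,3)[of "lev i"] z(4)[of i] by (auto simp: B_def)
  qed
  moreover have "ennreal (\<epsilon> / \<rho>) > 0" using \<epsilon> \<rho> by simp
  ultimately have "0 < hausdorff_premeasure s 1 {z. coded n V R res v0 z}" by (rule less_le_trans[rotated])
  also have "\<dots> \<le> hausdorff_measure s {z. coded n V R res v0 z}"
    by (rule hausdorff_premeasure_le_measure) simp
  finally show ?thesis using that[OF v0(1)] by simp
qed

end

section \<open>Similar copies at n-adic positions\<close>

lemma hausdorff_measure_affine:
  fixes E :: "real set"
  assumes "s > 0" "c > 0"
  shows "hausdorff_measure s ((\<lambda>z. (q + z) / c) ` E) = ennreal ((1 / c) powr s) * hausdorff_measure s E"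
proof (rule antisym)
  have d: "dist ((q + x) / c) ((q + y) / c) = (1 / c) * dist x y" for x y
    using assms(2) by (simp add: dist_real_def diff_divide_distrib[symmetric] abs_divide)
  show "hausdorff_measure s ((\<lambda>z. (q + z) / c) ` E) \<le> ennreal ((1 / c) powr s) * hausdorff_measure s E"
    by (rule hausdorff_measure_lipschitz_image) (use assms d in auto)
  have "(\<lambda>z. c * z - q) ` (\<lambda>z. (q + z) / c) ` E = E"
    using assms(2) by (simp add: image_image)
  moreover have "hausdorff_measure s ((\<lambda>z. c * z - q) ` (\<lambda>z. (q + z) / c) ` E)
      \<le> ennreal (c powr s) * hausdorff_measure s ((\<lambda>z. (q + z) / c) ` E)"
    by (rule hausdorff_measure_lipschitz_image)
      (use assms in \<open>auto simp: dist_real_def right_diff_distrib[symmetric] abs_mult\<close>)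
  ultimately have "ennreal ((1 / c) powr s) * hausdorff_measure s E \<le>
      ennreal ((1 / c) powr s) * (ennreal (c powr s) * hausdorff_measure s ((\<lambda>z. (q + z) / c) ` E))"
    by (intro mult_left_mono) auto
  also have "\<dots> = hausdorff_measure s ((\<lambda>z. (q + z) / c) ` E)"
    using assms by (simp add: powr_divide flip: mult.assoc ennreal_mult)
  finally show "ennreal ((1 / c) powr s) * hausdorff_measure s E \<le> hausdorff_measure s ((\<lambda>z. (q + z) / c) ` E)" .
qed

lemma hausdorff_null_affine:
  fixes E :: "real set"
  assumes "s > 0" "c > 0"
  shows "hausdorff_measure s ((\<lambda>z. (q + z) / c) ` E) = 0 \<longleftrightarrow> hausdorff_measure s E = 0"
  unfolding hausdorff_measure_affine[OF assms] using assms by simp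

text \<open>All integer prefixes of all lengths are allowed, so the union is countable and
  membership of a shifted point passes back to the point itself
  (\<open>spread_pull\<close>).\<close>

definition spread :: "nat \<Rightarrow> real set \<Rightarrow> real set" where
  "spread n E = {(real_of_int Q + z) / real n ^ k | k Q z. z \<in> E}"

lemma spread_UN:
  "spread n E = (\<Union>(k, Q)\<in>UNIV. (\<lambda>z. (real_of_int Q + z) / real n ^ k) ` E)"
  by (auto simp: spread_def)

lemma hausdorff_null_spread:
  assumes "s > 0" "n > 0" "hausdorff_measure s E = 0"
  shows "hausdorff_measure s (spread n E) = 0"
  unfolding spread_UN
proof (rule hausdorff_null_UN_countable)
  fix i :: "nat \<times> int"
  show "hausdorff_measure s (case i of (k, Q) \<Rightarrow> (\<lambda>z. (real_of_int Q + z) / real n ^ k) ` E) = 0"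
    using hausdorff_null_affine[OF assms(1)] assms(2,3) by (cases i) simp
qed simp

lemma countable_spread: "countable E \<Longrightarrow> countable (spread n E)"
  unfolding spread_UN by (rule countable_UN) auto

lemma spread_pull:
  assumes "n > 0" "real n ^ j * x - real_of_int a \<in> spread n E"
  shows "x \<in> spread n E"
proof -
  obtain k Q z where *: "z \<in> E" "real n ^ j * x - real_of_int a = (real_of_int Q + z) / real n ^ k"
    using assms(2) by (auto simp: spread_def)
  have "x = (real_of_int (Q + a * int n ^ k) + z) / real n ^ (k + j)"
    using *(2) assms(1) by (simp add: field_simps power_add)
  then show ?thesis unfolding spread_def using *(1) by blast
qed

context residue_graph
begin

text \<open>Positivity at one vertex is carried to every vertex \<open>u\<close> by a walk from
  \<open>u\<close> to it, which embeds a similar copy.\<close>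

lemma coded_positive:
  assumes rad: "graph_radius V R > 1" and s: "real n powr s = graph_radius V R"
    and conn: "\<And>u v. u \<in> V \<Longrightarrow> v \<in> V \<Longrightarrow> (u, v) \<in> (edges V R)\<^sup>*" and u: "u \<in> V" and s0: "s > 0"
  shows "hausdorff_measure s {z. coded n V R res u z} \<noteq> 0"
proof
  assume 0: "hausdorff_measure s {z. coded n V R res u z} = 0"
  obtain v where v: "v \<in> V" "hausdorff_measure s {z. coded n V R res v z} \<noteq> 0"
    using coded_positive_start[OF rad s] by blast
  obtain k Q where "walk_code n V R res k u v Q" using walk_code_exists[OF conn[OF u v(1)]] by blast
  then have "(\<lambda>z. (real_of_int Q + z) / real n ^ k) ` {z. coded n V R res v z} \<subseteq> {z. coded n V R res u z}"
    using coded_walk_code by blast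
  from hausdorff_null_subset[OF this 0] show False
    using v(2) hausdorff_null_affine[OF s0] n2 by simp
qed

end

section \<open>Dimension and measure seen from a strong component\<close>

context residue_graph
begin

text \<open>Counterpart of \<open>max_exponent\<close> for an arbitrary residue graph, with the
  radius of the relation restricted to \<open>H'\<close> instead of that of the induced
  subgraph.\<close>

definition component_exponent :: "'a set \<Rightarrow> ereal" where
  "component_exponent H = Max {log_ratio n (graph_radius H' R) | H'.
     H' \<in> strong_components (digraph_of V R) \<and> component_le (digraph_of V R) H H'}"

lemma finite_exponents:
  "finite {log_ratio n (graph_radius H' R) | H'. H' \<in> strong_components (digraph_of V R) \<and> P H'}"
  using finite_strong_components[OF fin, of R] by (auto simp: setcompr_eq_image)

lemma component_exponent_ge:
  assumes "H' \<in> strong_components (digraph_of V R)" "component_le (digraph_of V R) H H'"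
  shows "log_ratio n (graph_radius H' R) \<le> component_exponent H"
  unfolding component_exponent_def by (rule Max_ge[OF finite_exponents]) (use assms in auto)

lemma component_exponent_attained:
  assumes "H \<in> strong_components (digraph_of V R)"
  obtains H' where "H' \<in> strong_components (digraph_of V R)" "component_le (digraph_of V R) H H'"
    "component_exponent H = log_ratio n (graph_radius H' R)"
proof -
  have "component_exponent H \<in> {log_ratio n (graph_radius H' R) | H'.
     H' \<in> strong_components (digraph_of V R) \<and> component_le (digraph_of V R) H H'}"
    unfolding component_exponent_def
    by (rule Max_in[OF finite_exponents]) (use assms in \<open>auto simp: component_le_def\<close>)
  then show ?thesis using that by blast
qed

lemma radius_powr_less:
  assumes "finite H" "s > 0" "log_ratio n (graph_radius H R) < ereal s"
  shows "graph_radius H R < real n powr s"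
proof (cases "graph_radius H R = 0")
  case True
  then show ?thesis using n2 by simp
next
  case False
  then have g: "graph_radius H R > 0" using graph_radius_nonneg[OF assms(1), of R] by simp
  then have "ln (graph_radius H R) < s * ln (real n)"
    using assms(3) n2 False by (simp add: log_ratio_def pos_divide_less_eq)
  also have "\<dots> = ln (real n powr s)" using n2 by (simp add: ln_powr)
  finally show ?thesis using g n2 by (subst (asm) ln_less_cancel_iff) auto
qed

lemma coded_component_cover:
  assumes "v \<in> V" "v \<in> H0" "H0 \<in> strong_components (digraph_of V R)"
  shows "{z. coded n V R res v z} \<subseteq>
    (\<Union>(H, w) \<in> {(H, w). H \<in> strong_components (digraph_of V R) \<and> w \<in> H \<and> component_le (digraph_of V R) H0 H}.
       spread n {z. coded n H R res w z})"
proof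
  fix z assume "z \<in> {z. coded n V R res v z}"
  then have cz: "coded n V R res v z" by simp
  obtain k Q H w \<zeta> where *: "H \<in> strong_components (digraph_of V R)" "w \<in> H" "(v, w) \<in> (edges V R)\<^sup>*"
    "coded n H R res w \<zeta>" "z = (real_of_int Q + \<zeta>) / real n ^ k"
    by (rule coded_in_component[OF assms(1) cz])
  have "w \<in> V" using * by (auto simp: strong_components_digraph_of)
  then have "component_le (digraph_of V R) H0 H"
    using * assms unfolding component_le_def reachable_digraph_of by blast
  moreover have "z \<in> spread n {z. coded n H R res w z}" unfolding spread_def using *(4,5) by blast
  ultimately show "z \<in> (\<Union>(H, w) \<in> {(H, w). H \<in> strong_components (digraph_of V R) \<and> w \<in> H \<and> component_le (digraph_of V R) H0 H}.
       spread n {z. coded n H R res w z})"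
    using * by (intro UN_I[of "(H, w)"]) auto
qed

lemma countable_component_index:
  "countable {(H, w). H \<in> strong_components (digraph_of V R) \<and> w \<in> H \<and> P H}"
proof (rule countable_finite, rule finite_subset)
  show "{(H, w). H \<in> strong_components (digraph_of V R) \<and> w \<in> H \<and> P H} \<subseteq> Pow V \<times> V"
    by (auto simp: strong_components_digraph_of)
qed (use fin in simp)

lemma component_subgraph:
  assumes "H \<in> strong_components (digraph_of V R)"
  shows "residue_graph n H R res" "finite H" "H \<subseteq> V"
proof -
  show "H \<subseteq> V" using assms by (simp add: strong_components_digraph_of)
  then show "residue_graph n H R res" "finite H" using subgraph fin by (auto intro: finite_subset)
qed

lemma coded_null_exponent:
  assumes "v \<in> H0" "H0 \<in> strong_components (digraph_of V R)" "s > 0" "component_exponent H0 < ereal s"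
  shows "hausdorff_measure s {z. coded n V R res v z} = 0"
proof (rule hausdorff_null_subset[OF coded_component_cover])
  show "v \<in> V" using assms by (auto simp: strong_components_digraph_of)
  show "hausdorff_measure s (\<Union>(H, w) \<in> {(H, w). H \<in> strong_components (digraph_of V R) \<and> w \<in> H \<and> component_le (digraph_of V R) H0 H}.
       spread n {z. coded n H R res w z}) = 0"
  proof (rule hausdorff_null_UN_countable[OF countable_component_index])
    fix i assume "i \<in> {(H, w). H \<in> strong_components (digraph_of V R) \<and> w \<in> H \<and> component_le (digraph_of V R) H0 H}"
    then obtain H w where i: "i = (H, w)" "H \<in> strong_components (digraph_of V R)" "w \<in> H"
       "component_le (digraph_of V R) H0 H" by auto
    have "graph_radius H R < real n powr s"
      by (rule radius_powr_less) (use component_subgraph[OF i(2)] assms component_exponent_ge[OF i(2,4)] in auto)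
    then have "hausdorff_measure s {z. coded n H R res w z} = 0"
      using residue_graph.coded_null[OF component_subgraph(1)[OF i(2)] i(3) assms(3)] by simp
    then show "hausdorff_measure s (case i of (H, w) \<Rightarrow> spread n {z. coded n H R res w z}) = 0"
      using hausdorff_null_spread[OF assms(3)] n2 i(1) by simp
  qed
qed (use assms in auto)

text \<open>Every reachable component has radius at most 1 (radius 0 counts as -\<infinity>), so its
  vertices have unique successors and each codes at most one point; only countably many prefixes can
  precede it.\<close>

lemma coded_countable_exponent:
  assumes "v \<in> H0" "H0 \<in> strong_components (digraph_of V R)" "component_exponent H0 \<le> 0"
  shows "countable {z. coded n V R res v z}"
proof (rule countable_subset[OF coded_component_cover])
  show "v \<in> V" using assms by (auto simp: strong_components_digraph_of)
  show "countable (\<Union>(H, w) \<in> {(H, w). H \<in> strong_components (digraph_of V R) \<and> w \<in> H \<and> component_le (digraph_of V R) H0 H}.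
       spread n {z. coded n H R res w z})"
  proof (rule countable_UN[OF countable_component_index])
    fix i assume "i \<in> {(H, w). H \<in> strong_components (digraph_of V R) \<and> w \<in> H \<and> component_le (digraph_of V R) H0 H}"
    then obtain H w where i: "i = (H, w)" "H \<in> strong_components (digraph_of V R)" "w \<in> H"
       "component_le (digraph_of V R) H0 H" by auto
    interpret H: residue_graph n H R res by (rule component_subgraph(1)[OF i(2)])
    have le: "log_ratio n (graph_radius H R) \<le> 0"
      using assms component_exponent_ge[OF i(2,4)] by simp
    have "graph_radius H R \<le> 1"
    proof (rule ccontr)
      assume "\<not> graph_radius H R \<le> 1"
      then have "0 < ln (graph_radius H R) / ln (real n)" "graph_radius H R \<noteq> 0" using n2 by auto
      then show False using le by (simp add: log_ratio_def zero_ereal_def del: zero_less_divide_iff)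
    qed
    from radius_le_1_unique_successor[OF component_subgraph(2)[OF i(2)] this strong_component_connected[OF i(2)]]
    have "z = z'" if "coded n H R res w z" "coded n H R res w z'" for z z'
      using H.coded_unique[OF _ i(3) that] by blast
    then have "{z. coded n H R res w z} = {} \<or> (\<exists>a. {z. coded n H R res w z} = {a})" by blast
    then have "countable {z. coded n H R res w z}" by auto
    then show "countable (case i of (H, w) \<Rightarrow> spread n {z. coded n H R res w z})"
      using i(1) by (simp add: countable_spread)
  qed
qed (use assms in auto)

text \<open>The maximum is attained at some component \<open>H\<close>, whose radius must exceed 1.
  A walk from \<open>v\<close> into \<open>H\<close> plants a similar copy of a set of positive
  measure among the points coded from \<open>v\<close>.\<close>

lemma coded_positive_exponent:
  assumes v: "v \<in> H0" and H0: "H0 \<in> strong_components (digraph_of V R)" and pos: "component_exponent H0 > 0"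
  obtains s where "s > 0" "component_exponent H0 = ereal s"
    "hausdorff_measure s {z. coded n V R res v z} \<noteq> 0"
proof -
  obtain H where H: "H \<in> strong_components (digraph_of V R)" "component_le (digraph_of V R) H0 H"
    "component_exponent H0 = log_ratio n (graph_radius H R)"
    using component_exponent_attained[OF H0] by blast
  interpret H: residue_graph n H R res by (rule component_subgraph(1)[OF H(1)])
  define s where "s = ln (graph_radius H R) / ln (real n)"
  have g0: "graph_radius H R \<noteq> 0" using pos H(3) by (auto simp: log_ratio_def)
  then have s: "component_exponent H0 = ereal s" using H(3) by (simp add: log_ratio_def s_def)
  have s0: "s > 0" using pos s by simp
  have g: "graph_radius H R > 0" using g0 graph_radius_nonneg[OF H.fin, of R] by simp
  have ns: "real n powr s = graph_radius H R" using g n2 by (simp add: s_def powr_def)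
  then have g1: "graph_radius H R > 1" using powr_less_mono[of 0 s "real n"] s0 n2 by simp
  obtain w where w: "w \<in> H" "(v, w) \<in> (edges V R)\<^sup>*"
  proof (cases "H0 = H")
    case True
    then show ?thesis using that[of v] v by simp
  next
    case False
    then obtain a b where ab: "a \<in> H0" "b \<in> H" "(a, b) \<in> (edges V R)\<^sup>*"
      using H(2) unfolding component_le_def reachable_digraph_of by blast
    have "(v, a) \<in> (edges V R)\<^sup>*" using H0 v ab unfolding strong_components_digraph_of by blast
    then have "(v, b) \<in> (edges V R)\<^sup>*" using ab(3) by (rule rtrancl_trans)
    then show ?thesis using that[of b] ab by simp
  qed
  have pw: "hausdorff_measure s {z. coded n H R res w z} \<noteq> 0"
    by (rule H.coded_positive[OF g1 ns strong_component_connected[OF H(1)] w(1) s0])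
  obtain k Q where kq: "walk_code n V R res k v w Q" using walk_code_exists[OF w(2)] by blast
  have sub: "(\<lambda>z. (real_of_int Q + z) / real n ^ k) ` {z. coded n H R res w z} \<subseteq> {z. coded n V R res v z}"
  proof safe
    fix z assume "coded n H R res w z"
    then have "coded n V R res w z" by (rule coded_mono[OF _ component_subgraph(3)[OF H(1)]])
    then show "coded n V R res v ((real_of_int Q + z) / real n ^ k)" by (rule coded_walk_code[OF kq])
  qed
  have "hausdorff_measure s {z. coded n V R res v z} \<noteq> 0"
  proof
    assume "hausdorff_measure s {z. coded n V R res v z} = 0"
    from hausdorff_null_subset[OF sub this] show False using pw hausdorff_null_affine[OF s0] n2 by simp
  qed
  then show ?thesis using that s0 s by blast
qed

end

section \<open>Fibres and the graph of unambiguous intervals\<close>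

text \<open>The countable exceptional set: exactly these points become integers under some power of
  n, so that the floor no longer singles out one interval.\<close>

definition nadic :: "nat \<Rightarrow> real set" where
  "nadic n = {x. \<exists>k. real n ^ k * x \<in> \<int>}"

lemma countable_nadic:
  assumes "n > 0" shows "countable (nadic n)"
proof (rule countable_subset)
  show "nadic n \<subseteq> (\<Union>k::nat. range (\<lambda>q::int. real_of_int q / real n ^ k))"
  proof
    fix x assume "x \<in> nadic n"
    then obtain k q where "real n ^ k * x = real_of_int q" by (auto simp: nadic_def elim: Ints_cases)
    then have "x = real_of_int q / real n ^ k" using assms by (simp add: field_simps)
    then show "x \<in> (\<Union>k::nat. range (\<lambda>q::int. real_of_int q / real n ^ k))" by blast
  qed
qed auto

lemma nadic_scale:
  assumes "n > 0" shows "real n * x - real_of_int a \<in> nadic n \<longleftrightarrow> x \<in> nadic n"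
proof
  assume "x \<in> nadic n"
  then obtain k where "real n ^ k * x \<in> \<int>" by (auto simp: nadic_def)
  then have "real n * (real n ^ k * x) \<in> \<int>" by (rule Ints_mult[OF Ints_of_nat])
  moreover have "real n ^ k * real_of_int a \<in> \<int>" by (intro Ints_mult Ints_power) auto
  ultimately have "real n * (real n ^ k * x) - real n ^ k * real_of_int a \<in> \<int>" by (rule Ints_diff)
  also have "real n * (real n ^ k * x) - real n ^ k * real_of_int a = real n ^ k * (real n * x - real_of_int a)"
    by (simp add: algebra_simps)
  finally show "real n * x - real_of_int a \<in> nadic n" unfolding nadic_def by blast
next
  assume "real n * x - real_of_int a \<in> nadic n"
  then obtain k where "real n ^ k * (real n * x - real_of_int a) \<in> \<int>" by (auto simp: nadic_def)
  then have "real n ^ k * (real n * x - real_of_int a) + real n ^ k * real_of_int a \<in> \<int>"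
    by (intro Ints_add[of "real n ^ k * (real n * x - real_of_int a)"] Ints_mult[of "real n ^ k" "real_of_int a"] Ints_power) auto
  also have "real n ^ k * (real n * x - real_of_int a) + real n ^ k * real_of_int a = real n ^ Suc k * x"
    by (simp add: algebra_simps)
  finally show "x \<in> nadic n" unfolding nadic_def by blast
qed

lemma nadic_shift:
  assumes "n > 0" shows "(x - real_of_int a) \<in> nadic n \<longleftrightarrow> x \<in> nadic n" "(real_of_int a + x) \<in> nadic n \<longleftrightarrow> x \<in> nadic n"
proof -
  have *: "x \<in> nadic n \<Longrightarrow> x + real_of_int a \<in> nadic n" for x a
    unfolding nadic_def by (auto simp: distrib_left intro!: Ints_add Ints_mult)
  show "(x - real_of_int a) \<in> nadic n \<longleftrightarrow> x \<in> nadic n"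
    using *[of x "- a"] *[of "x - real_of_int a" a] by auto
  show "(real_of_int a + x) \<in> nadic n \<longleftrightarrow> x \<in> nadic n"
    using *[of x a] *[of "real_of_int a + x" "- a"] by (auto simp: add.commute)
qed

lemma nadic_div_power:
  assumes "n > 0" shows "(real_of_int q + z) / real n ^ k \<in> nadic n \<longleftrightarrow> z \<in> nadic n"
proof (induction k arbitrary: q z)
  case 0
  then show ?case using nadic_shift[OF assms] by simp
next
  case (Suc k)
  have "real n * ((real_of_int q + z) / real n ^ Suc k) - real_of_int 0 = (real_of_int q + z) / real n ^ k"
    using assms by simp
  then show ?case using Suc nadic_scale[OF assms, of "(real_of_int q + z) / real n ^ Suc k" 0] by simp
qed

lemma nadic_power:
  assumes "n > 0" shows "real n ^ k * x - real_of_int a \<in> nadic n \<longleftrightarrow> x \<in> nadic n"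
  using nadic_div_power[OF assms, of a "real n ^ k * x - real_of_int a" k] assms by simp

lemma Ints_nadic: "x \<in> \<int> \<Longrightarrow> x \<in> nadic n"
  unfolding nadic_def by (auto intro: exI[of _ 0])

lemma nadic_interior:
  assumes "z \<notin> nadic n" "0 \<le> z" "z \<le> 1" shows "0 < z" "z < 1"
  using assms Ints_nadic[of 0 n] Ints_nadic[of 1 n] by (force simp: order_le_less)+

lemma floor_div_scaled: "n > 0 \<Longrightarrow> \<lfloor>real n * x\<rfloor> div int n = \<lfloor>x\<rfloor>"
  using floor_divide_real_eq_div[of "int n" "real n * x"] by simp

section \<open>Digits, cells and integer intervals\<close>

locale digit_projection =
  fixes n :: nat and A :: "'l::finite \<Rightarrow> int set" and K :: "'l \<Rightarrow> real set" and m :: "int ^ 'l"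
  assumes n2: "n \<ge> 2"
    and A_ne: "\<And>k. A k \<noteq> {}"
    and A_range: "\<And>k. A k \<subseteq> {0 .. int n - 1}"
    and self_similar: "\<And>k. is_self_similar_set n (A k) (K k)"
    and m_nz: "(\<Prod>k\<in>UNIV. m $ k) \<noteq> 0"
    and covering: "covering_condition n A m"
begin

abbreviation "lo \<equiv> m_lower m"
abbreviation "hi \<equiv> m_upper m"
abbreviation "P \<equiv> digit_vectors A"
abbreviation "F \<equiv> fibre K m"

definition \<phi> :: "int ^ 'l \<Rightarrow> int" where "\<phi> i = (\<Sum>k\<in>UNIV. m $ k * i $ k)"

text \<open>The integer form of: the interval of \<open>u\<close> lies in the projected cell of the
  digit vector \<open>i\<close>. The difference \<open>u - \<phi> i\<close> is then the resulting
  type.\<close>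

definition admissible :: "int \<Rightarrow> int ^ 'l \<Rightarrow> bool" where
  "admissible u i \<longleftrightarrow> i \<in> P \<and> lo \<le> u - \<phi> i \<and> u - \<phi> i < hi"

definition cube :: "(real ^ 'l) set" where "cube = {y. \<forall>k. 0 \<le> y $ k \<and> y $ k \<le> 1}"

text \<open>Puts a digit vector in front of the expansions of the coordinates.\<close>

definition cons :: "int ^ 'l \<Rightarrow> real ^ 'l \<Rightarrow> real ^ 'l" where
  "cons i y = (real_vec i + y) /\<^sub>R real n"

lemma n0: "n > 0" "real n > 0" using n2 by auto

lemma phi_real: "real_vec m \<bullet> real_vec i = real_of_int (\<phi> i)"
  by (simp add: inner_vec_def real_vec_def \<phi>_def)

lemma inner_cons: "real_vec m \<bullet> cons i y = (real_of_int (\<phi> i) + real_vec m \<bullet> y) / real n"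
  by (simp add: cons_def inner_add_right phi_real divide_inverse_commute)

lemma m_component: "m $ k \<noteq> 0"
  using m_nz by (simp add: prod_zero_iff)

lemma lo_le_0: "lo \<le> 0" and hi_ge_0: "0 \<le> hi"
  unfolding m_lower_def m_upper_def by (auto intro: sum_nonpos sum_nonneg)

lemma lo_less_hi: "lo < hi"
proof -
  obtain k :: 'l where True by simp
  consider "m $ k > 0" | "m $ k < 0" using m_component[of k] by linarith
  then show ?thesis
  proof cases
    case 1
    then have "m $ k \<le> hi" unfolding m_upper_def by (intro member_le_sum) auto
    then show ?thesis using lo_le_0 1 by linarith
  next
    case 2
    then have "- m $ k \<le> (\<Sum>k | m $ k < 0. - m $ k)" by (intro member_le_sum) auto
    then have "lo \<le> m $ k" unfolding m_lower_def by (simp add: sum_negf)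
    then show ?thesis using hi_ge_0 2 by linarith
  qed
qed

lemma inner_cube:
  assumes "y \<in> cube" shows "real_of_int lo \<le> real_vec m \<bullet> y" "real_vec m \<bullet> y \<le> real_of_int hi"
proof -
  have e: "real_vec m \<bullet> y = (\<Sum>k\<in>UNIV. real_of_int (m $ k) * y $ k)" by (simp add: inner_vec_def real_vec_def)
  have l: "real_of_int lo = (\<Sum>k\<in>UNIV. if m $ k < 0 then real_of_int (m $ k) else 0)"
    unfolding m_lower_def of_int_sum by (rule sum.mono_neutral_cong_left) auto
  have h: "real_of_int hi = (\<Sum>k\<in>UNIV. if m $ k > 0 then real_of_int (m $ k) else 0)"
    unfolding m_upper_def of_int_sum by (rule sum.mono_neutral_cong_left) auto
  have y: "0 \<le> y $ k" "y $ k \<le> 1" for k using assms by (auto simp: cube_def)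
  show "real_of_int lo \<le> real_vec m \<bullet> y" unfolding e l
  proof (rule sum_mono)
    fix k show "(if m $ k < 0 then real_of_int (m $ k) else 0) \<le> real_of_int (m $ k) * y $ k"
      using mult_left_mono_neg[OF y(2)[of k], of "real_of_int (m $ k)"] y[of k] by auto
  qed
  show "real_vec m \<bullet> y \<le> real_of_int hi" unfolding e h
  proof (rule sum_mono)
    fix k show "real_of_int (m $ k) * y $ k \<le> (if m $ k > 0 then real_of_int (m $ k) else 0)"
      using mult_left_mono[OF y(2)[of k], of "real_of_int (m $ k)"] y[of k] by (auto simp: mult_nonpos_nonneg)
  qed
qed

lemma inner_cube_surj:
  assumes "real_of_int lo \<le> c" "c \<le> real_of_int hi"
  obtains y where "y \<in> cube" "real_vec m \<bullet> y = c"
proof -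
  define t where "t = (c - real_of_int lo) / real_of_int (hi - lo)"
  have d: "real_of_int (hi - lo) > 0" using lo_less_hi by simp
  have t: "0 \<le> t" "t \<le> 1" using assms d by (auto simp: t_def)
  \<comment> \<open>The diagonal from the vertex of the cube where the functional is minimal to the
    one where it is maximal.\<close>
  define y :: "real ^ 'l" where "y = (\<chi> k. if m $ k > 0 then t else 1 - t)"
  have e: "real_vec m \<bullet> y = (\<Sum>k\<in>UNIV. (if m $ k > 0 then real_of_int (m $ k) else 0) * t
      + (if m $ k < 0 then real_of_int (m $ k) else 0) * (1 - t))"
    unfolding inner_vec_def real_vec_def y_def using m_component
    by (intro sum.cong refl) (auto simp: not_less order_le_less)
  have l: "real_of_int lo = (\<Sum>k\<in>UNIV. if m $ k < 0 then real_of_int (m $ k) else 0)"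
    unfolding m_lower_def of_int_sum by (rule sum.mono_neutral_cong_left) auto
  have h: "real_of_int hi = (\<Sum>k\<in>UNIV. if m $ k > 0 then real_of_int (m $ k) else 0)"
    unfolding m_upper_def of_int_sum by (rule sum.mono_neutral_cong_left) auto
  have "real_vec m \<bullet> y = real_of_int hi * t + real_of_int lo * (1 - t)"
    unfolding e l h sum.distrib sum_distrib_right ..
  also have "\<dots> = real_of_int lo + real_of_int (hi - lo) * t" by (simp add: algebra_simps)
  also have "\<dots> = c" using d by (simp add: t_def)
  finally show ?thesis using that[of y] t by (auto simp: cube_def y_def)
qed

lemma cbox_cube: "cbox 0 (1 :: real ^ 'l) = cube"
  by (auto simp: cube_def mem_box_cart)

lemma cell_projection_eq:
  "cell_projection n m i = {real_of_int (\<phi> i + lo) / real n .. real_of_int (\<phi> i + hi) / real n}"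
proof (intro subset_antisym subsetI)
  fix x assume "x \<in> cell_projection n m i"
  then obtain y where y: "y \<in> cube" "x = real_vec m \<bullet> cons i y"
    unfolding cell_projection_def cell_def cbox_cube cons_def[symmetric] by auto
  then show "x \<in> {real_of_int (\<phi> i + lo) / real n .. real_of_int (\<phi> i + hi) / real n}"
    using inner_cube[OF y(1)] n0 by (auto simp: inner_cons intro!: divide_right_mono)
next
  fix x assume x: "x \<in> {real_of_int (\<phi> i + lo) / real n .. real_of_int (\<phi> i + hi) / real n}"
  then have "real_of_int lo \<le> real n * x - real_of_int (\<phi> i)" "real n * x - real_of_int (\<phi> i) \<le> real_of_int hi"
    using n0 by (auto simp: field_simps)
  from inner_cube_surj[OF this] obtain y where y: "y \<in> cube" "real_vec m \<bullet> y = real n * x - real_of_int (\<phi> i)" by blast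
  then have "x = real_vec m \<bullet> cons i y" using n0 by (simp add: inner_cons)
  then show "x \<in> cell_projection n m i" unfolding cell_projection_def cell_def cbox_cube cons_def[symmetric] using y(1) by blast
qed

lemma div_le_iff: "real_of_int a / real n \<le> real_of_int b / real n \<longleftrightarrow> a \<le> b"
  using n0 by (simp add: divide_le_cancel)

lemma interval_of_subset_cell:
  "interval_of n u \<subseteq> cell_projection n m i \<longleftrightarrow> lo \<le> u - \<phi> i \<and> u - \<phi> i < hi"
proof -
  have "real_of_int u / real n \<le> (real_of_int u + 1) / real n" using n0 by (simp add: divide_right_mono)
  then have "interval_of n u \<subseteq> cell_projection n m i \<longleftrightarrow>
     real_of_int (\<phi> i + lo) / real n \<le> real_of_int u / real n \<and> real_of_int (u + 1) / real n \<le> real_of_int (\<phi> i + hi) / real n"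
    unfolding interval_of_def cell_projection_eq atLeastatMost_subset_iff by auto
  also have "\<dots> \<longleftrightarrow> lo \<le> u - \<phi> i \<and> u - \<phi> i < hi" unfolding div_le_iff by auto
  finally show ?thesis .
qed

lemma integer_intervals_iff: "u \<in> integer_intervals n m \<longleftrightarrow> int n * lo \<le> u \<and> u < int n * hi"
proof -
  have "real_of_int u / real n \<le> (real_of_int u + 1) / real n" using n0 by (simp add: divide_right_mono)
  then have "u \<in> integer_intervals n m \<longleftrightarrow>
     real_of_int lo \<le> real_of_int u / real n \<and> real_of_int (u + 1) / real n \<le> real_of_int hi"
    unfolding integer_intervals_def interval_of_def hull_interval_def mem_Collect_eq atLeastatMost_subset_iff by auto
  also have "real_of_int lo = real_of_int (int n * lo) / real n" using n0 by simp
  also have "real_of_int hi = real_of_int (int n * hi) / real n" using n0 by simp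
  finally show ?thesis unfolding div_le_iff by auto
qed

lemma Xi_iff: "u \<in> Xi n A m \<longleftrightarrow> int n * lo \<le> u \<and> u < int n * hi \<and> (\<exists>!i. admissible u i)"
  unfolding Xi_def mem_Collect_eq integer_intervals_iff interval_of_subset_cell admissible_def by blast

lemma of_type_iff: "of_type A m u t \<longleftrightarrow> (\<exists>i. admissible u i \<and> t = u - \<phi> i)"
  unfolding of_type_def admissible_def working_types_def phi_real of_int_diff[symmetric] of_int_eq_iff by force

text \<open>An interval [v/n, (v+1)/n] lies in [t, t+1] exactly when \<open>v div n = t\<close>. An
  edge thus prescribes the quotient of its target and leaves the residue, the next digit,
  free.\<close>

lemma interval_step_iff: "interval_step n A m u v \<longleftrightarrow> (\<exists>i. admissible u i \<and> v div int n = u - \<phi> i)"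
proof -
  have "interval_of n v \<subseteq> working_interval t \<longleftrightarrow> v div int n = t" for t
  proof -
    have "real_of_int v / real n \<le> (real_of_int v + 1) / real n" using n0 by (simp add: divide_right_mono)
    then have "interval_of n v \<subseteq> working_interval t \<longleftrightarrow>
       real_of_int t \<le> real_of_int v / real n \<and> real_of_int (v + 1) / real n \<le> real_of_int (t + 1)"
      unfolding interval_of_def working_interval_def atLeastatMost_subset_iff by auto
    also have "real_of_int t = real_of_int (int n * t) / real n" using n0 by simp
    also have "real_of_int (t + 1) = real_of_int (int n * (t + 1)) / real n" using n0 by simp
    finally have "interval_of n v \<subseteq> working_interval t \<longleftrightarrow> int n * t \<le> v \<and> v < int n * t + int n"
      unfolding div_le_iff by (auto simp: algebra_simps)
    also have "\<dots> \<longleftrightarrow> v div int n = t"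
    proof
      assume "int n * t \<le> v \<and> v < int n * t + int n"
      then show "v div int n = t" using int_div_pos_eq[of v "int n" t "v - int n * t"] by simp
    next
      assume "v div int n = t"
      moreover have "0 \<le> v mod int n" "v mod int n < int n" using n0 by auto
      moreover have "int n * (v div int n) + v mod int n = v" by simp
      ultimately show "int n * t \<le> v \<and> v < int n * t + int n" by auto
    qed
    finally show ?thesis .
  qed
  then show ?thesis unfolding interval_step_def of_type_iff
    by (auto simp: admissible_def working_types_def)
qed

text \<open>Meaningful for \<open>u\<close> in \<Xi>, where the digit vector is unique;
  \<open>ty\<close> is then the only type of \<open>u\<close>.\<close>

definition dig :: "int \<Rightarrow> int ^ 'l" where "dig u = (THE i. admissible u i)"
definition ty :: "int \<Rightarrow> int" where "ty u = u - \<phi> (dig u)"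

abbreviation "\<Xi> \<equiv> Xi n A m"
abbreviation "step \<equiv> interval_step n A m"
abbreviation "coded_Xi \<equiv> coded n \<Xi> step (\<lambda>u. u mod int n)"

lemma dig_unique: "u \<in> \<Xi> \<Longrightarrow> admissible u i \<longleftrightarrow> i = dig u"
  unfolding Xi_iff dig_def by (metis theI)

lemma step_Xi: "u \<in> \<Xi> \<Longrightarrow> step u v \<longleftrightarrow> v div int n = ty u"
  unfolding interval_step_iff ty_def by (simp add: dig_unique)

lemma of_type_Xi: "u \<in> \<Xi> \<Longrightarrow> of_type A m u t \<longleftrightarrow> t = ty u"
  unfolding of_type_iff ty_def by (simp add: dig_unique)

lemma dig_P: "u \<in> \<Xi> \<Longrightarrow> dig u \<in> P"
  using dig_unique[of u "dig u"] by (auto simp: admissible_def)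

lemma finite_Xi: "finite \<Xi>"
  by (rule finite_subset[of _ "{int n * lo..int n * hi}"]) (auto simp: Xi_iff)

text \<open>The source of an edge fixes the quotient of its target by n, and the residue fixes the
  rest.\<close>

sublocale Xi: residue_graph n \<Xi> step "\<lambda>u. u mod int n"
proof
  fix u v w assume "u \<in> \<Xi>" "v \<in> \<Xi>" "w \<in> \<Xi>" "step u v" "step u w" "v mod int n = w mod int n"
  then have "v div int n = w div int n" by (simp add: step_Xi)
  then show "v = w" using \<open>v mod int n = w mod int n\<close> by (metis div_mult_mod_eq)
qed (use n2 finite_Xi in auto)

section \<open>The self-similar product and its fibres\<close>

lemma K_image: "z \<in> K k \<longleftrightarrow> (\<exists>a\<in>A k. \<exists>z'\<in>K k. z = (z' + real_of_int a) / real n)"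
  using self_similar[of k] unfolding is_self_similar_set_def by blast

lemma K_props: "K k \<noteq> {}" "compact (K k)"
  using self_similar[of k] by (auto simp: is_self_similar_set_def)

text \<open>The largest point b satisfies n b \<le> b + n - 1, and the smallest point c satisfies n
  c \<ge> c.\<close>

lemma K_unit: "z \<in> K k \<Longrightarrow> 0 \<le> z \<and> z \<le> 1"
proof -
  obtain b where b: "b \<in> K k" "\<And>z. z \<in> K k \<Longrightarrow> z \<le> b" using compact_attains_sup[OF K_props(2,1)] by blast
  obtain c where c: "c \<in> K k" "\<And>z. z \<in> K k \<Longrightarrow> c \<le> z" using compact_attains_inf[OF K_props(2,1)] by blast
  obtain a b' where a: "a \<in> A k" "b' \<in> K k" "b = (b' + real_of_int a) / real n" using b(1) K_image by blast
  have "a + 1 \<le> int n" using a(1) A_range by force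
  then have ar: "real_of_int a + 1 \<le> real n" by linarith
  have "real n * b = b' + real_of_int a" using a(3) n0 by simp
  also have "\<dots> \<le> b + (real n - 1)" using b(2)[OF a(2)] ar by linarith
  finally have "(real n - 1) * b \<le> (real n - 1) * 1" by (simp add: algebra_simps)
  then have b1: "b \<le> 1" using n2 by (subst (asm) mult_le_cancel_left_pos) auto
  obtain a' c' where a': "a' \<in> A k" "c' \<in> K k" "c = (c' + real_of_int a') / real n" using c(1) K_image by blast
  have "0 \<le> a'" using a'(1) A_range by force
  moreover have "real n * c = c' + real_of_int a'" using a'(3) n0 by simp
  ultimately have "(real n - 1) * c \<ge> (real n - 1) * 0" using c(2)[OF a'(2)] by (simp add: algebra_simps)
  then have c0: "c \<ge> 0" using n2 by (subst (asm) mult_le_cancel_left_pos) auto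
  assume "z \<in> K k"
  then show "0 \<le> z \<and> z \<le> 1" using b(2) c(2) b1 c0 by force
qed

definition KK :: "(real ^ 'l) set" where "KK = {y. \<forall>k. y $ k \<in> K k}"

lemma F_iff: "y \<in> F x \<longleftrightarrow> y \<in> KK \<and> real_vec m \<bullet> y = x"
  by (simp add: fibre_def KK_def)

lemma KK_cube: "KK \<subseteq> cube"
  using K_unit by (auto simp: KK_def cube_def)

lemma cons_nth: "cons i y $ k = (y $ k + real_of_int (i $ k)) / real n"
  by (simp add: cons_def real_vec_def divide_inverse_commute add.commute)

lemma KK_image: "y \<in> KK \<longleftrightarrow> (\<exists>i\<in>P. \<exists>y'\<in>KK. y = cons i y')"
proof
  assume "y \<in> KK"
  then have "\<forall>k. \<exists>a z. a \<in> A k \<and> z \<in> K k \<and> y $ k = (z + real_of_int a) / real n"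
    unfolding KK_def using K_image by blast
  then obtain a z where az: "\<And>k. a k \<in> A k \<and> z k \<in> K k \<and> y $ k = (z k + real_of_int (a k)) / real n" by metis
  have "y = cons (\<chi> k. a k) (\<chi> k. z k)" unfolding Finite_Cartesian_Product.vec_eq_iff cons_nth using az by simp
  moreover have "(\<chi> k. a k) \<in> P" "(\<chi> k. z k) \<in> KK" using az by (auto simp: digit_vectors_def KK_def)
  ultimately show "\<exists>i\<in>P. \<exists>y'\<in>KK. y = cons i y'" by blast
next
  assume "\<exists>i\<in>P. \<exists>y'\<in>KK. y = cons i y'"
  then obtain i y' where iy: "i \<in> P" "y' \<in> KK" "y = cons i y'" by blast
  have "y $ k \<in> K k" for k
  proof -
    have "i $ k \<in> A k" "y' $ k \<in> K k" using iy(1,2) by (simp_all add: digit_vectors_def KK_def)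
    then show ?thesis unfolding iy(3) cons_nth by (subst K_image) blast
  qed
  then show "y \<in> KK" by (simp add: KK_def)
qed

text \<open>Preimages are sorted by their first digit vector. The union need not be disjoint, as
  expansions may be ambiguous.\<close>

lemma F_rec: "F x = (\<Union>i\<in>P. cons i ` F (real n * x - real_of_int (\<phi> i)))"
proof (intro subset_antisym subsetI)
  fix y assume "y \<in> F x"
  then have y: "y \<in> KK" "real_vec m \<bullet> y = x" by (simp_all add: F_iff)
  obtain i y' where iy: "i \<in> P" "y' \<in> KK" "y = cons i y'" "real_vec m \<bullet> y = x"
    using y(1)[unfolded KK_image[of y]] y(2) by blast
  have "real_vec m \<bullet> y' = real n * x - real_of_int (\<phi> i)" using iy(4) n0 unfolding iy(3) inner_cons by auto
  then have "y' \<in> F (real n * x - real_of_int (\<phi> i))" using iy(2) by (simp add: F_iff)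
  then show "y \<in> (\<Union>i\<in>P. cons i ` F (real n * x - real_of_int (\<phi> i)))" using iy by blast
next
  fix y assume "y \<in> (\<Union>i\<in>P. cons i ` F (real n * x - real_of_int (\<phi> i)))"
  then obtain i y' where iy: "i \<in> P" "y' \<in> F (real n * x - real_of_int (\<phi> i))" "y = cons i y'" by blast
  have "real_vec m \<bullet> y = x" using iy(2) n0 unfolding F_iff iy(3) inner_cons by simp
  moreover have "y \<in> KK" using iy unfolding F_iff KK_image[of y] by blast
  ultimately show "y \<in> F x" by (simp add: F_iff)
qed

lemma F_range: "F x \<noteq> {} \<Longrightarrow> real_of_int lo \<le> x \<and> x \<le> real_of_int hi"
proof -
  assume "F x \<noteq> {}"
  then obtain y where "y \<in> cube" "real_vec m \<bullet> y = x" using KK_cube F_iff by blast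
  then show ?thesis using inner_cube[of y] by simp
qed

lemma cover_step:
  assumes "real_of_int lo \<le> x" "x \<le> real_of_int hi"
  obtains i where "i \<in> P" "real_of_int lo \<le> real n * x - real_of_int (\<phi> i)" "real n * x - real_of_int (\<phi> i) \<le> real_of_int hi"
proof -
  have "x \<in> (\<Union>i\<in>P. cell_projection n m i)"
    using covering assms unfolding covering_condition_def hull_interval_def by simp
  then obtain i where "i \<in> P" "x \<in> cell_projection n m i" by blast
  then show ?thesis using that[of i] n0 by (auto simp: cell_projection_eq field_simps)
qed

text \<open>The covering condition allows a point of the hull to be shifted inside the hull again
  and again, so it is approximated by the projection of the product up to (hi - lo) / n^k; that
  projection is closed by compactness.\<close>

lemma F_nonempty_iff: "F x \<noteq> {} \<longleftrightarrow> real_of_int lo \<le> x \<and> x \<le> real_of_int hi"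
proof
  assume x: "real_of_int lo \<le> x \<and> x \<le> real_of_int hi"
  define Q where "Q = (\<lambda>y. real_vec m \<bullet> y) ` KK"
  have "closed KK"
  proof -
    have "closed {y :: real ^ 'l. y $ k \<in> K k}" for k
      using closed_vimage[OF compact_imp_closed[OF K_props(2)[of k]], of "\<lambda>y :: real ^ 'l. y $ k"]
      by (simp add: vimage_def continuous_on_component)
    then have "closed (\<Inter>k. {y :: real ^ 'l. y $ k \<in> K k})" by blast
    moreover have "(\<Inter>k. {y :: real ^ 'l. y $ k \<in> K k}) = KK" by (auto simp: KK_def)
    ultimately show ?thesis by simp
  qed
  moreover have "bounded KK" using KK_cube bounded_cbox[of 0 "1 :: real ^ 'l"] unfolding cbox_cube by (rule bounded_subset[rotated])
  ultimately have "compact KK" by (simp add: compact_eq_bounded_closed)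
  then have "closed Q" unfolding Q_def
    by (intro compact_imp_closed compact_continuous_image continuous_intros)
  have "KK \<noteq> {}"
  proof -
    have "(SOME z. z \<in> K k) \<in> K k" for k using K_props(1) by (simp add: some_in_eq)
    then have "(\<chi> k. SOME z. z \<in> K k) \<in> KK" by (simp add: KK_def)
    then show ?thesis by blast
  qed
  then have Qne: "Q \<noteq> {}" by (simp add: Q_def)
  have near: "\<exists>q\<in>Q. \<bar>q - x\<bar> \<le> real_of_int (hi - lo) * (1 / real n) ^ k"
    if "real_of_int lo \<le> x" "x \<le> real_of_int hi" for k x using that
  proof (induction k arbitrary: x)
    case 0
    obtain q where "q \<in> Q" using Qne by blast
    moreover then have "real_of_int lo \<le> q" "q \<le> real_of_int hi" using inner_cube KK_cube by (auto simp: Q_def)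
    ultimately show ?case using 0 by (intro bexI[of _ q]) (auto simp: abs_le_iff)
  next
    case (Suc k)
    obtain i where i: "i \<in> P" "real_of_int lo \<le> real n * x - real_of_int (\<phi> i)" "real n * x - real_of_int (\<phi> i) \<le> real_of_int hi"
      using cover_step[OF Suc.prems] .
    obtain q where q: "q \<in> Q" "\<bar>q - (real n * x - real_of_int (\<phi> i))\<bar> \<le> real_of_int (hi - lo) * (1 / real n) ^ k"
      using Suc.IH[OF i(2,3)] by blast
    obtain y where y: "y \<in> KK" "q = real_vec m \<bullet> y" using q(1) by (auto simp: Q_def)
    have "cons i y \<in> KK" using KK_image i(1) y(1) by blast
    then have "(real_of_int (\<phi> i) + q) / real n \<in> Q" unfolding Q_def y(2) inner_cons[symmetric] by blast
    moreover have "(real_of_int (\<phi> i) + q) / real n - x = (q - (real n * x - real_of_int (\<phi> i))) / real n"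
      using n0 by (simp add: field_simps)
    then have "\<bar>(real_of_int (\<phi> i) + q) / real n - x\<bar> \<le> real_of_int (hi - lo) * (1 / real n) ^ k / real n"
      using q(2) n0 by (simp add: divide_right_mono)
    ultimately show ?case by (intro bexI[of _ "(real_of_int (\<phi> i) + q) / real n"]) auto
  qed
  have lim: "(\<lambda>k. real_of_int (hi - lo) * (1 / real n) ^ k) \<longlonglongrightarrow> real_of_int (hi - lo) * 0"
    using n2 by (intro tendsto_mult tendsto_const LIMSEQ_power_zero) auto
  have "x \<in> closure Q"
    unfolding closure_approachable
  proof (intro allI impI)
    fix e :: real assume "e > 0"
    then have "eventually (\<lambda>k. real_of_int (hi - lo) * (1 / real n) ^ k < e) sequentially"
      using order_tendstoD(2)[OF lim] by simp
    then obtain k where "real_of_int (hi - lo) * (1 / real n) ^ k < e" by (auto simp: eventually_sequentially)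
    moreover obtain q where "q \<in> Q" "\<bar>q - x\<bar> \<le> real_of_int (hi - lo) * (1 / real n) ^ k" using near x by blast
    ultimately show "\<exists>y\<in>Q. dist y x < e" by (intro bexI[of _ q]) (auto simp: dist_real_def)
  qed
  then have "x \<in> Q" using \<open>closed Q\<close> by simp
  then show "F x \<noteq> {}" by (auto simp: Q_def F_iff)
qed (rule F_range)

lemma cons_dist: "norm (cons i y - cons i y') = norm (y - y') / real n"
proof -
  have "cons i y - cons i y' = (y - y') /\<^sub>R real n" by (simp add: cons_def scaleR_diff_right[symmetric])
  then show ?thesis by (simp add: divide_inverse_commute)
qed

lemma inj_cons: "inj_on (cons i) S"
  using n0 by (auto simp: inj_on_def cons_def)

lemma KK_diameter:
  assumes "y \<in> KK" "y' \<in> KK" shows "norm (y - y') \<le> real CARD('l)"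
proof -
  have "\<bar>(y - y') $ k\<bar> \<le> 1" for k
  proof -
    have "0 \<le> y $ k" "y $ k \<le> 1" "0 \<le> y' $ k" "y' $ k \<le> 1" using assms KK_cube by (auto simp: cube_def)
    then show ?thesis by (simp add: abs_le_iff)
  qed
  then have "(\<Sum>k\<in>UNIV. \<bar>(y - y') $ k\<bar>) \<le> (\<Sum>k\<in>(UNIV :: 'l set). 1)" by (intro sum_mono) auto
  then show ?thesis using norm_le_l1_cart[of "y - y'"] by simp
qed

lemma nadic_step: "real n * x - real_of_int a \<notin> nadic n \<longleftrightarrow> x \<notin> nadic n"
  using nadic_scale[OF n0(1)] by simp

text \<open>Off the n-adic points n x is no integer, so the closed bounds on n x - (m, i) are
  equivalent to integer bounds on the floor of n x.\<close>

lemma admissible_floor: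
  assumes x: "x \<notin> nadic n" and i: "i \<in> P"
  shows "F (real n * x - real_of_int (\<phi> i)) \<noteq> {} \<longleftrightarrow> admissible \<lfloor>real n * x\<rfloor> i"
proof -
  have ni: "real n * x \<noteq> real_of_int a" for a
    using x nadic_step[of x 0] Ints_nadic[of "real_of_int a" n] by auto
  have "real_of_int lo \<le> real n * x - real_of_int (\<phi> i) \<longleftrightarrow> lo \<le> \<lfloor>real n * x\<rfloor> - \<phi> i"
    using le_floor_iff[of "lo + \<phi> i" "real n * x"] by (auto simp: algebra_simps)
  moreover have "real n * x - real_of_int (\<phi> i) \<le> real_of_int hi \<longleftrightarrow> \<lfloor>real n * x\<rfloor> - \<phi> i < hi"
    using floor_less_iff[of "real n * x" "hi + \<phi> i"] ni[of "hi + \<phi> i"] by (auto simp: algebra_simps order_le_less)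
  ultimately show ?thesis unfolding F_nonempty_iff admissible_def using i by simp
qed

lemma F_Xi:
  assumes "x \<notin> nadic n" "\<lfloor>real n * x\<rfloor> \<in> \<Xi>"
  shows "F x = cons (dig \<lfloor>real n * x\<rfloor>) ` F (real n * x - real_of_int (\<phi> (dig \<lfloor>real n * x\<rfloor>)))"
proof -
  let ?d = "dig \<lfloor>real n * x\<rfloor>"
  have "F x = (\<Union>i\<in>P. cons i ` F (real n * x - real_of_int (\<phi> i)))" by (rule F_rec)
  also have "\<dots> = (\<Union>i\<in>{?d}. cons i ` F (real n * x - real_of_int (\<phi> i)))"
  proof -
    have "F (real n * x - real_of_int (\<phi> i)) = {}" if "i \<in> P" "i \<noteq> ?d" for i
      using admissible_floor[OF assms(1) that(1)] dig_unique[OF assms(2)] that(2) by blast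
    then show ?thesis using dig_P[OF assms(2)] by auto
  qed
  finally show ?thesis by simp
qed

lemma card_F_Xi:
  assumes "x \<notin> nadic n" "\<lfloor>real n * x\<rfloor> \<in> \<Xi>"
  shows "card (F x) = card (F (real n * x - real_of_int (\<phi> (dig \<lfloor>real n * x\<rfloor>))))"
  unfolding F_Xi[OF assms] by (rule card_image[OF inj_cons])

text \<open>How infinite paths in G_\<Xi> arise: a set of points closed under removal of the forced
  first digit vector, with all current intervals in \<Xi>. The integer part of n x is the vertex,
  its fractional part the coded point.\<close>

lemma coded_Xi_coinduct:
  assumes S: "\<And>x. x \<in> S \<Longrightarrow> x \<notin> nadic n \<and> \<lfloor>real n * x\<rfloor> \<in> \<Xi> \<and>
       real n * x - real_of_int (\<phi> (dig \<lfloor>real n * x\<rfloor>)) \<in> S"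
    and x: "x \<in> S"
  shows "coded_Xi \<lfloor>real n * x\<rfloor> (real n * x - real_of_int \<lfloor>real n * x\<rfloor>)"
proof -
  have "coded_Xi u z" if "\<exists>x\<in>S. u = \<lfloor>real n * x\<rfloor> \<and> z = real n * x - real_of_int u" for u z
    using that
  proof (coinduction arbitrary: u z)
    case coded
    then obtain x where x: "x \<in> S" "u = \<lfloor>real n * x\<rfloor>" "z = real n * x - real_of_int u" by blast
    define x1 where "x1 = real n * x - real_of_int (\<phi> (dig u))"
    have x1: "x1 \<in> S" "u \<in> \<Xi>" using S[OF x(1)] x(2) by (auto simp: x1_def)
    \<comment> \<open>The shifted point lies in the working interval of type \<open>ty u\<close>,
      which is what makes the next vertex a successor of \<open>u\<close>.\<close>
    have fl: "\<lfloor>x1\<rfloor> = ty u" unfolding x1_def ty_def using x(2) by linarith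
    then have dv: "\<lfloor>real n * x1\<rfloor> div int n = ty u" using floor_div_scaled[OF n0(1), of x1] by simp
    have zx: "z = x1 - real_of_int (ty u)" using x(3) by (simp add: x1_def ty_def)
    have md: "\<lfloor>real n * x1\<rfloor> mod int n = \<lfloor>real n * x1\<rfloor> - int n * ty u"
      unfolding dv[symmetric] by (rule minus_mult_div_eq_mod[symmetric])
    have "real n * z = real_of_int (\<lfloor>real n * x1\<rfloor> mod int n) + (real n * x1 - real_of_int \<lfloor>real n * x1\<rfloor>)"
      unfolding md zx by (simp add: algebra_simps)
    moreover have "0 \<le> z" "z \<le> 1" unfolding x(3) x(2) by linarith+
    ultimately show ?case using x1 S[OF x1(1)] dv
      by (intro exI[of _ "\<lfloor>real n * x1\<rfloor>"] exI[of _ u] exI[of _ z] exI[of _ "real n * x1 - real_of_int \<lfloor>real n * x1\<rfloor>"])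
        (auto simp: step_Xi)
  qed
  then show ?thesis using x by blast
qed

text \<open>The converse reading: a coded point in an interval of \<Xi> is shifted to a coded point
  at the next vertex of its path.\<close>

lemma coded_Xi_step:
  assumes u: "u \<in> \<Xi>" and c: "coded_Xi u z" and z: "z \<notin> nadic n"
  defines "x \<equiv> (real_of_int u + z) / real n"
  obtains w z' where "w \<in> \<Xi>" "coded_Xi w z'" "z' \<notin> nadic n" "x \<notin> nadic n" "\<lfloor>real n * x\<rfloor> = u"
    "real n * x - real_of_int (\<phi> (dig u)) = (real_of_int w + z') / real n"
proof -
  obtain w z' where w: "w \<in> \<Xi>" "step u w" "real n * z = real_of_int (w mod int n) + z'" "coded_Xi w z'"
    using c by (auto elim: coded.cases)
  have z01: "0 < z" "z < 1" using nadic_interior[OF z] coded_bounds[OF c] by auto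
  have nx: "real n * x = real_of_int u + z" using n0 by (simp add: x_def)
  have "\<lfloor>real n * x\<rfloor> = u" unfolding nx using z01 by linarith
  moreover have "x \<notin> nadic n" using z nadic_div_power[OF n0(1), of u z 1] by (simp add: x_def)
  moreover have "z' = real n * z - real_of_int (w mod int n)" using w(3) by simp
  then have "z' \<notin> nadic n" using nadic_step z by simp
  moreover have "real n * x - real_of_int (\<phi> (dig u)) = (real_of_int w + z') / real n"
  proof -
    have "w = int n * ty u + w mod int n" using w(2) u mult_div_mod_eq[of "int n" w] by (simp add: step_Xi)
    then have "real_of_int w = real n * real_of_int (ty u) + real_of_int (w mod int n)"
      by (metis of_int_add of_int_mult of_int_of_nat_eq)
    then have "real_of_int w + z' = real n * (real_of_int (ty u) + z)" using w(3) by (simp add: algebra_simps)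
    then show ?thesis unfolding nx ty_def using n0 by simp
  qed
  ultimately show ?thesis using that w by blast
qed

text \<open>Along the path each digit vector is forced, so two preimages agree to every order and
  their distance is at most \<open>CARD('l)\<close> / n^k. Existence comes from
  \<open>F_nonempty_iff\<close>.\<close>

lemma coded_Xi_card:
  assumes "u \<in> \<Xi>" "coded_Xi u z" "z \<notin> nadic n"
  shows "card (F ((real_of_int u + z) / real n)) = 1"
proof -
  have dist: "norm (y - y') \<le> real CARD('l) * (1 / real n) ^ k"
    if "u \<in> \<Xi>" "coded_Xi u z" "z \<notin> nadic n" "y \<in> F ((real_of_int u + z) / real n)" "y' \<in> F ((real_of_int u + z) / real n)"
    for k u z y y' using that
  proof (induction k arbitrary: u z y y')
    case 0
    then show ?case using KK_diameter by (simp add: F_iff)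
  next
    case (Suc k)
    let ?x = "(real_of_int u + z) / real n"
    obtain w z' where w: "w \<in> \<Xi>" "coded_Xi w z'" "z' \<notin> nadic n" "?x \<notin> nadic n" "\<lfloor>real n * ?x\<rfloor> = u"
      "real n * ?x - real_of_int (\<phi> (dig u)) = (real_of_int w + z') / real n"
      using coded_Xi_step[OF Suc.prems(1-3)] by blast
    have "F ?x = cons (dig u) ` F ((real_of_int w + z') / real n)"
      using F_Xi[OF w(4)] w(5,6) Suc.prems(1) by simp
    then obtain a a' where a: "y = cons (dig u) a" "y' = cons (dig u) a'"
       "a \<in> F ((real_of_int w + z') / real n)" "a' \<in> F ((real_of_int w + z') / real n)" using Suc.prems(4,5) by auto
    have "norm (a - a') \<le> real CARD('l) * (1 / real n) ^ k" using Suc.IH[OF w(1-3) a(3,4)] .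
    then have "norm (y - y') \<le> real CARD('l) * (1 / real n) ^ k / real n"
      unfolding a(1,2) cons_dist using n0 by (intro divide_right_mono) auto
    then show ?case by simp
  qed
  let ?x = "(real_of_int u + z) / real n"
  have lim: "(\<lambda>k. real CARD('l) * (1 / real n) ^ k) \<longlonglongrightarrow> real CARD('l) * 0"
    using n2 by (intro tendsto_mult tendsto_const LIMSEQ_power_zero) auto
  have eq: "y = y'" if "y \<in> F ?x" "y' \<in> F ?x" for y y'
  proof -
    have "norm (y - y') \<le> real CARD('l) * 0"
      by (rule LIMSEQ_le_const[OF lim]) (use dist[OF assms that] in auto)
    then show ?thesis by simp
  qed
  have z01: "0 \<le> z" "z \<le> 1" using coded_bounds[OF assms(2)] by auto
  have "F ?x \<noteq> {}" unfolding F_nonempty_iff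
  proof
    have "real_of_int (int n * lo) \<le> real_of_int u" "real_of_int (u + 1) \<le> real_of_int (int n * hi)"
      using assms(1) unfolding Xi_iff of_int_le_iff by auto
    then show "real_of_int lo \<le> ?x" "?x \<le> real_of_int hi" using z01 n0 by (auto simp: field_simps)
  qed
  then obtain y where "F ?x = {y}" using eq by blast
  then show ?thesis by simp
qed

end

section \<open>Finite fibres and the upper bound for the dimension\<close>

context digit_projection
begin

lemma digit_range: "i \<in> P \<Longrightarrow> 0 \<le> i $ k \<and> i $ k \<le> int n - 1"
  using A_range[of k] by (force simp: digit_vectors_def)

lemma Xi_floor:
  assumes x: "x \<notin> nadic n" and ne: "F x \<noteq> {}"
  shows "\<lfloor>real n * x\<rfloor> \<in> \<Xi> \<longleftrightarrow> (\<exists>!i. admissible \<lfloor>real n * x\<rfloor> i)"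
proof -
  have ni: "real n * x \<noteq> real_of_int a" for a
    using x nadic_step[of x 0] Ints_nadic[of "real_of_int a" n] by auto
  have "real_of_int lo \<le> x" "x \<le> real_of_int hi" using F_range[OF ne] by auto
  then have "real n * real_of_int lo \<le> real n * x" "real n * x \<le> real n * real_of_int hi"
    using n0 by (auto intro: mult_left_mono)
  then have "real_of_int (int n * lo) \<le> real n * x" "real n * x < real_of_int (int n * hi)"
    using ni[of "int n * hi"] by auto
  then have "int n * lo \<le> \<lfloor>real n * x\<rfloor>" "\<lfloor>real n * x\<rfloor> < int n * hi"
    unfolding le_floor_iff floor_less_iff by auto
  then show ?thesis by (simp add: Xi_iff)
qed

definition extreme :: "real ^ 'l \<Rightarrow> 'l set" where "extreme y = {k. y $ k = 0 \<or> y $ k = 1}"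

lemma extreme_cons:
  assumes i: "i \<in> P" and y: "y \<in> KK"
  shows "cons i y $ k = 0 \<longleftrightarrow> i $ k = 0 \<and> y $ k = 0" "cons i y $ k = 1 \<longleftrightarrow> i $ k = int n - 1 \<and> y $ k = 1"
proof -
  have y01: "0 \<le> y $ k" "y $ k \<le> 1" using y KK_cube by (auto simp: cube_def)
  have i01: "0 \<le> i $ k" "i $ k \<le> int n - 1" using digit_range[OF i] by auto
  have i01': "0 \<le> real_of_int (i $ k)" using i01 by simp
  have i2: "real_of_int (i $ k) \<le> real n - 1" using i01(2) by linarith
  show "cons i y $ k = 0 \<longleftrightarrow> i $ k = 0 \<and> y $ k = 0"
    unfolding cons_nth using y01 i01' n0 by (auto simp: add_nonneg_eq_0_iff)
  have "cons i y $ k = 1 \<longleftrightarrow> y $ k + real_of_int (i $ k) = real n" unfolding cons_nth using n0 by auto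
  also have "\<dots> \<longleftrightarrow> real_of_int (i $ k) = real n - 1 \<and> y $ k = 1" using y01 i2 by linarith
  also have "real_of_int (i $ k) = real n - 1 \<longleftrightarrow> i $ k = int n - 1" by linarith
  finally show "cons i y $ k = 1 \<longleftrightarrow> i $ k = int n - 1 \<and> y $ k = 1" .
qed

text \<open>A point whose cell is ambiguous has a coordinate with two expansions in base \<open>n\<close>. That coordinate
  of the shifted point is \<open>0\<close> or \<open>1\<close> and stays there, so ambiguity occurs at most \<open>CARD('l)\<close> times.\<close>
lemma singleton_fibre_step:
  assumes x: "x \<notin> nadic n" and F: "F x = {y}"
  obtains i y1 where "i \<in> P" "F (real n * x - real_of_int (\<phi> i)) = {y1}"
    "extreme y \<subseteq> extreme y1" "\<lfloor>real n * x\<rfloor> \<in> \<Xi> \<Longrightarrow> i = dig \<lfloor>real n * x\<rfloor>"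
    "\<lfloor>real n * x\<rfloor> \<notin> \<Xi> \<Longrightarrow> extreme y \<subset> extreme y1"
proof -
  obtain i y1 where i: "i \<in> P" "y1 \<in> F (real n * x - real_of_int (\<phi> i))" "y = cons i y1"
    using F F_rec[of x] by blast
  have y1: "y1 \<in> KK" using i(2) by (simp add: F_iff)
  have single: "F (real n * x - real_of_int (\<phi> i)) = {y1}"
  proof -
    have "y' = y1" if "y' \<in> F (real n * x - real_of_int (\<phi> i))" for y'
    proof -
      have "cons i y' \<in> F x" using that i(1) F_rec[of x] by blast
      then have "cons i y' = cons i y1" using F i(3) by simp
      then show ?thesis using inj_cons[of i UNIV] by (simp add: inj_eq)
    qed
    then show ?thesis using i(2) by blast
  qed
  have sub: "extreme y \<subseteq> extreme y1"
    unfolding extreme_def i(3) using extreme_cons[OF i(1) y1] by auto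
  have adm: "admissible \<lfloor>real n * x\<rfloor> i" using admissible_floor[OF x i(1)] i(2) by blast
  show ?thesis
  proof (rule that[OF i(1) single sub])
    assume "\<lfloor>real n * x\<rfloor> \<in> \<Xi>"
    then show "i = dig \<lfloor>real n * x\<rfloor>" using adm dig_unique by blast
  next
    assume "\<lfloor>real n * x\<rfloor> \<notin> \<Xi>"
    \<comment> \<open>A second admissible digit vector also leads to a preimage; as the fibre is a
      single point, \<open>y\<close> itself has two expansions.\<close>
    then obtain i' where i': "admissible \<lfloor>real n * x\<rfloor> i'" "i' \<noteq> i"
      using Xi_floor[OF x] F adm by blast
    have "i' \<in> P" using i'(1) by (simp add: admissible_def)
    then obtain y1' where y1': "y1' \<in> F (real n * x - real_of_int (\<phi> i'))"
      using admissible_floor[OF x] i'(1) by blast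
    then have "cons i' y1' \<in> F x" using \<open>i' \<in> P\<close> F_rec[of x] by blast
    then have eq: "cons i y1 = cons i' y1'" using F i(3) by simp
    have y1'K: "y1' \<in> KK" using y1' by (simp add: F_iff)
    obtain k where k: "i $ k \<noteq> i' $ k" using i'(2) by (metis Finite_Cartesian_Product.vec_eq_iff)
    have "y1 $ k + real_of_int (i $ k) = y1' $ k + real_of_int (i' $ k)"
      using arg_cong[OF eq, of "\<lambda>v. v $ k"] n0 unfolding cons_nth by simp
    moreover have "0 \<le> y1 $ k" "y1 $ k \<le> 1" "0 \<le> y1' $ k" "y1' $ k \<le> 1"
      using y1 y1'K KK_cube by (auto simp: cube_def)
    ultimately have "y1 $ k = 0 \<or> y1 $ k = 1" using k by linarith
    then have "k \<in> extreme y1" by (simp add: extreme_def)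
    \<comment> \<open>Were coordinate \<open>k\<close> of \<open>y\<close> equal to 0 or 1, both
      expansions would start with the digit 0, or both with n - 1, although they differ
      there.\<close>
    moreover have "k \<notin> extreme y"
      using extreme_cons[OF i(1) y1, of k] extreme_cons[OF \<open>i' \<in> P\<close> y1'K, of k] k
      unfolding extreme_def i(3) eq by auto
    ultimately show "extreme y \<subset> extreme y1" using sub by blast
  qed
qed

definition eventually_Xi :: "real set" where
  "eventually_Xi = (\<Union>u\<in>\<Xi>. spread n {z. coded_Xi u z})"

lemma eventually_Xi_pull: "real n ^ j * x - real_of_int a \<in> eventually_Xi \<Longrightarrow> x \<in> eventually_Xi"
  unfolding eventually_Xi_def using spread_pull[OF n0(1)] by blast

text \<open>Induction on the number of coordinates other than 0 and 1: an ambiguous cell lowers it,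
  and if no ambiguous cell ever occurs the shifts form a path in G_\<Xi>.\<close>

lemma singleton_fibre_eventually_Xi:
  assumes "x \<notin> nadic n" "card (F x) = 1"
  shows "x \<in> eventually_Xi"
proof -
  have "x \<in> eventually_Xi" if "x \<notin> nadic n" "F x = {y}" for x y
    using that
  proof (induction "CARD('l) - card (extreme y)" arbitrary: x y rule: less_induct)
    case less
    have ext: "card (extreme y') \<le> CARD('l)" for y' by (rule card_mono) auto
    show ?case
    proof (rule ccontr)
      assume x: "x \<notin> eventually_Xi"
      \<comment> \<open>Closed under the shift. If some element were outside \<Xi>, the induction
        hypothesis would apply to its shift and pull the element back into
        \<open>eventually_Xi\<close>.\<close>
      define S where "S = {x'. x' \<notin> nadic n \<and> x' \<notin> eventually_Xi \<and> (\<exists>y'. F x' = {y'} \<and> extreme y \<subseteq> extreme y')}"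
      have "coded_Xi \<lfloor>real n * x\<rfloor> (real n * x - real_of_int \<lfloor>real n * x\<rfloor>)" and S: "\<lfloor>real n * x\<rfloor> \<in> \<Xi>"
      proof -
        have S: "x' \<notin> nadic n \<and> \<lfloor>real n * x'\<rfloor> \<in> \<Xi> \<and> real n * x' - real_of_int (\<phi> (dig \<lfloor>real n * x'\<rfloor>)) \<in> S"
          if "x' \<in> S" for x'
        proof -
          obtain y' where x': "x' \<notin> nadic n" "x' \<notin> eventually_Xi" "F x' = {y'}" "extreme y \<subseteq> extreme y'"
            using \<open>x' \<in> S\<close> by (auto simp: S_def)
          obtain i y1 where i: "i \<in> P" "F (real n * x' - real_of_int (\<phi> i)) = {y1}" "extreme y' \<subseteq> extreme y1"
            "\<lfloor>real n * x'\<rfloor> \<in> \<Xi> \<Longrightarrow> i = dig \<lfloor>real n * x'\<rfloor>" "\<lfloor>real n * x'\<rfloor> \<notin> \<Xi> \<Longrightarrow> extreme y' \<subset> extreme y1"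
            using singleton_fibre_step[OF x'(1,3)] by metis
          have nx: "real n * x' - real_of_int (\<phi> i) \<notin> nadic n" using nadic_step x'(1) by simp
          have ev: "real n * x' - real_of_int (\<phi> i) \<notin> eventually_Xi" using eventually_Xi_pull[of 1 x' "\<phi> i"] x'(2) by auto
          have "\<lfloor>real n * x'\<rfloor> \<in> \<Xi>"
          proof (rule ccontr)
            assume "\<lfloor>real n * x'\<rfloor> \<notin> \<Xi>"
            then have "extreme y \<subset> extreme y1" using i(5) x'(4) by blast
            then have "card (extreme y) < card (extreme y1)" by (intro psubset_card_mono) auto
            then have "CARD('l) - card (extreme y1) < CARD('l) - card (extreme y)" using ext[of y1] by linarith
            from less.hyps[OF this nx i(2)] show False using ev by blast
          qed
          then show ?thesis using x'(1) i x'(4) nx ev by (auto simp: S_def)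
        qed
        have "x \<in> S" using less.prems x by (auto simp: S_def)
        from coded_Xi_coinduct[of S, OF S this] S[OF this]
        show "coded_Xi \<lfloor>real n * x\<rfloor> (real n * x - real_of_int \<lfloor>real n * x\<rfloor>)" "\<lfloor>real n * x\<rfloor> \<in> \<Xi>" by auto
      qed
      moreover have "x = (real_of_int \<lfloor>real n * x\<rfloor> + (real n * x - real_of_int \<lfloor>real n * x\<rfloor>)) / real n ^ 1"
        using n0 by simp
      ultimately have "x \<in> spread n {z. coded_Xi \<lfloor>real n * x\<rfloor> z}" unfolding spread_def by blast
      then show False using x S unfolding eventually_Xi_def by blast
    qed
  qed
  then show ?thesis using assms by (auto simp: card_1_singleton_iff)
qed

lemma eventually_Xi_null:
  assumes "s > 0" "graph_radius \<Xi> step < real n powr s"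
  shows "hausdorff_measure s eventually_Xi = 0"
  unfolding eventually_Xi_def
  by (rule hausdorff_null_UN_countable)
    (use finite_Xi Xi.coded_null[OF _ assms] hausdorff_null_spread[OF assms(1) n0(1)] in \<open>auto intro: countable_finite\<close>)

lemma finite_P: "finite P"
proof -
  have "finite (PiE UNIV A)" using A_range by (intro finite_PiE) (auto intro: finite_subset)
  moreover have "P \<subseteq> (\<lambda>f. \<chi> k. f k) ` PiE UNIV A"
  proof
    fix i assume "i \<in> P"
    then have "(\<lambda>k. i $ k) \<in> PiE UNIV A" by (auto simp: digit_vectors_def)
    moreover have "i = (\<chi> k. i $ k)" by simp
    ultimately show "i \<in> (\<lambda>f. \<chi> k. f k) ` PiE UNIV A" by blast
  qed
  ultimately show ?thesis by (meson finite_imageI finite_subset)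
qed

definition words :: "nat \<Rightarrow> (int ^ 'l) list set" where "words k = {w. set w \<subseteq> P \<and> length w = k}"

text \<open>The translation part of a composed branch: putting the word w of length k in front of y
  turns (m, y) into (val w + (m, y)) / n^k.\<close>

primrec val :: "(int ^ 'l) list \<Rightarrow> int" where
  "val [] = 0"
| "val (i # w) = int n ^ length w * \<phi> i + val w"

lemma finite_words: "finite (words k)"
  unfolding words_def by (rule finite_lists_length_eq[OF finite_P])

lemma words_0: "words 0 = {[]}" by (auto simp: words_def)

lemma words_Suc: "w \<in> words (Suc k) \<longleftrightarrow> (\<exists>i\<in>P. \<exists>w'\<in>words k. w = i # w')"
  unfolding words_def by (cases w) auto

lemma val_Cons_shift:
  assumes "w \<in> words k"
  shows "real n ^ Suc k * x - real_of_int (val (i # w)) = real n ^ k * (real n * x - real_of_int (\<phi> i)) - real_of_int (val w)"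
  using assms by (simp add: words_def algebra_simps)

lemma F_words: "F x = (\<Union>w\<in>words k. foldr cons w ` F (real n ^ k * x - real_of_int (val w)))"
proof (induction k arbitrary: x)
  case (Suc k)
  have "F x = (\<Union>i\<in>P. cons i ` (\<Union>w\<in>words k. foldr cons w ` F (real n ^ k * (real n * x - real_of_int (\<phi> i)) - real_of_int (val w))))"
    unfolding F_rec[of x] by (subst Suc.IH) simp
  also have "\<dots> = (\<Union>i\<in>P. \<Union>w\<in>words k. foldr cons (i # w) ` F (real n ^ k * (real n * x - real_of_int (\<phi> i)) - real_of_int (val w)))"
    by (simp add: image_UN image_image)
  also have "\<dots> = (\<Union>i\<in>P. \<Union>w\<in>words k. foldr cons (i # w) ` F (real n ^ Suc k * x - real_of_int (val (i # w))))"
    by (intro SUP_cong refl) (simp only: val_Cons_shift)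
  also have "\<dots> = (\<Union>w\<in>words (Suc k). foldr cons w ` F (real n ^ Suc k * x - real_of_int (val w)))"
    by (fastforce simp: words_Suc)
  finally show ?case .
qed (simp add: words_0)

lemma foldr_cons_dist: "norm (foldr cons w y - foldr cons w y') = norm (y - y') / real n ^ length w"
  by (induction w) (simp_all add: cons_dist)

text \<open>A finite fibre has a least distance between distinct points; once cells of generation
  \<open>k\<close> are smaller than that, no cell holds two of them.\<close>

lemma finite_fibre_separation:
  assumes "finite (F x)"
  obtains k where "\<And>w y y'. w \<in> words k \<Longrightarrow> y \<in> F (real n ^ k * x - real_of_int (val w)) \<Longrightarrow>
     y' \<in> F (real n ^ k * x - real_of_int (val w)) \<Longrightarrow> y = y'"
proof -
  \<comment> \<open>The element 1 keeps the set non-empty when the fibre has fewer than two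
    points.\<close>
  define D where "D = insert 1 ((\<lambda>(a, b). norm (a - b)) ` ((F x \<times> F x) - {(a, b). a = b}))"
  have fD: "finite D" "D \<noteq> {}" using assms by (auto simp: D_def)
  have pD: "d > 0" if "d \<in> D" for d using that by (auto simp: D_def)
  define e where "e = Min D"
  have e: "e > 0" unfolding e_def using fD pD by simp
  have sep: "e \<le> norm (a - b)" if "a \<in> F x" "b \<in> F x" "a \<noteq> b" for a b
    unfolding e_def by (rule Min_le[OF fD(1)]) (use that in \<open>auto simp: D_def intro!: image_eqI[of _ _ "(a, b)"]\<close>)
  have lim: "(\<lambda>k. real CARD('l) * (1 / real n) ^ k) \<longlonglongrightarrow> real CARD('l) * 0"
    using n2 by (intro tendsto_mult tendsto_const LIMSEQ_power_zero) auto
  then have "eventually (\<lambda>k. real CARD('l) * (1 / real n) ^ k < e) sequentially"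
    using order_tendstoD(2)[OF lim] e by simp
  then obtain k where k: "real CARD('l) * (1 / real n) ^ k < e" by (auto simp: eventually_sequentially)
  show ?thesis
  proof (rule that[of k], rule ccontr)
    fix w y y' assume w: "w \<in> words k" "y \<in> F (real n ^ k * x - real_of_int (val w))"
      "y' \<in> F (real n ^ k * x - real_of_int (val w))" "y \<noteq> y'"
    have l: "length w = k" using w(1) by (simp add: words_def)
    have in_F: "foldr cons w y \<in> F x" "foldr cons w y' \<in> F x" using w F_words[of x k] by blast+
    have "norm (foldr cons w y - foldr cons w y') = norm (y - y') / real n ^ k"
      unfolding foldr_cons_dist l ..
    moreover have "norm (y - y') / real n ^ k > 0" using w(4) n0 by simp
    ultimately have "norm (foldr cons w y - foldr cons w y') > 0" by simp
    then have "foldr cons w y \<noteq> foldr cons w y'" by simp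
    from sep[OF in_F this] have "e \<le> norm (y - y') / real n ^ k" unfolding foldr_cons_dist l .
    also have "\<dots> \<le> real CARD('l) / real n ^ k"
      using KK_diameter w(2,3) n0 by (intro divide_right_mono) (auto simp: F_iff)
    finally show False using k by (simp add: power_one_over)
  qed
qed

lemma finite_fibre_eventually_Xi:
  assumes x: "x \<notin> nadic n" and F: "finite (F x)" "F x \<noteq> {}"
  shows "x \<in> eventually_Xi"
proof -
  obtain k where k: "\<And>w y y'. w \<in> words k \<Longrightarrow> y \<in> F (real n ^ k * x - real_of_int (val w)) \<Longrightarrow>
     y' \<in> F (real n ^ k * x - real_of_int (val w)) \<Longrightarrow> y = y'"
    using finite_fibre_separation[OF F(1)] by blast
  obtain w y where w: "w \<in> words k" "y \<in> F (real n ^ k * x - real_of_int (val w))"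
    using F(2) F_words[of x k] by blast
  then have "F (real n ^ k * x - real_of_int (val w)) = {y}" using k by blast
  moreover have "real n ^ k * x - real_of_int (val w) \<notin> nadic n" using nadic_power[OF n0(1)] x by simp
  ultimately have "real n ^ k * x - real_of_int (val w) \<in> eventually_Xi"
    using singleton_fibre_eventually_Xi by simp
  then show ?thesis by (rule eventually_Xi_pull)
qed

lemma multiplicity_set_null:
  assumes "r > 0" "s > 0" "graph_radius \<Xi> step < real n powr s"
  shows "hausdorff_measure s (multiplicity_set K m r) = 0"
proof (rule hausdorff_null_diff_countable[OF assms(2) countable_nadic[OF n0(1)]])
  have "multiplicity_set K m r - nadic n \<subseteq> eventually_Xi"
    using finite_fibre_eventually_Xi assms(1) card_gt_0_iff by (fastforce simp: multiplicity_set_def)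
  then show "hausdorff_measure s (multiplicity_set K m r - nadic n) = 0"
    by (rule hausdorff_null_subset) (rule eventually_Xi_null[OF assms(2,3)])
qed

text \<open>The left end of the hull is reached only with digit n - 1 where m is negative and 0
  elsewhere; covering makes these digits available. The leftmost interval is thus unambiguous and of
  type \<open>lo\<close>.\<close>

lemma lo_loop: "int n * lo \<in> \<Xi>" "step (int n * lo) (int n * lo)"
proof -
  \<comment> \<open>Writes the excess over the minimum as a sum of non-negative terms; if it is 0,
    each term vanishes and every digit is determined.\<close>
  have excess: "\<phi> i - (int n - 1) * lo = (\<Sum>k\<in>UNIV. m $ k * (i $ k - (if m $ k < 0 then int n - 1 else 0)))" for i
  proof -
    have "lo = (\<Sum>k\<in>UNIV. if m $ k < 0 then m $ k else 0)"
      unfolding m_lower_def by (rule sum.mono_neutral_cong_left) auto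
    then have "(int n - 1) * lo = (\<Sum>k\<in>UNIV. m $ k * (if m $ k < 0 then int n - 1 else 0))"
      by (auto simp: sum_distrib_left intro!: sum.cong)
    then show ?thesis by (simp add: \<phi>_def sum_subtractf right_diff_distrib)
  qed
  have nonneg: "0 \<le> m $ k * (i $ k - (if m $ k < 0 then int n - 1 else 0))" if "i \<in> P" for i k
    using digit_range[OF that, of k] by (auto simp: mult_nonneg_nonneg mult_nonpos_nonpos)
  have adm: "admissible (int n * lo) i \<longleftrightarrow> i \<in> P \<and> \<phi> i = (int n - 1) * lo" for i
  proof -
    have "(int n - 1) * lo \<le> \<phi> i" if "i \<in> P"
      using excess[of i] sum_nonneg[of UNIV "\<lambda>k. m $ k * (i $ k - (if m $ k < 0 then int n - 1 else 0))"] nonneg[OF that]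
      by simp
    moreover have "(int n - 1) * lo = int n * lo - lo" by (simp add: left_diff_distrib)
    ultimately show ?thesis unfolding admissible_def using lo_less_hi by auto
  qed
  obtain i where i: "i \<in> P" "real_of_int lo \<le> real n * real_of_int lo - real_of_int (\<phi> i)"
    "real n * real_of_int lo - real_of_int (\<phi> i) \<le> real_of_int hi"
    using cover_step[of "real_of_int lo"] lo_less_hi by auto
  have "lo \<le> int n * lo - \<phi> i"
    using i(2) by (metis of_int_diff of_int_le_iff of_int_mult of_int_of_nat_eq)
  moreover have "(int n - 1) * lo \<le> \<phi> i"
    using excess[of i] sum_nonneg[of UNIV "\<lambda>k. m $ k * (i $ k - (if m $ k < 0 then int n - 1 else 0))"] nonneg[OF i(1)]
    by simp
  moreover have "(int n - 1) * lo = int n * lo - lo" by (simp add: left_diff_distrib)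
  ultimately have ai: "admissible (int n * lo) i" using adm i(1) by simp
  have zero: "m $ k * (i $ k - (if m $ k < 0 then int n - 1 else 0)) = 0" if "admissible (int n * lo) i" for i k
  proof -
    have i: "i \<in> P" "\<phi> i - (int n - 1) * lo = 0" using that adm by auto
    have "\<forall>k\<in>UNIV. m $ k * (i $ k - (if m $ k < 0 then int n - 1 else 0)) = 0"
      using i(2) nonneg[OF i(1)] unfolding excess by (subst (asm) sum_nonneg_eq_0_iff) auto
    then show ?thesis by blast
  qed
  have "i' = i" if "admissible (int n * lo) i'" for i'
    unfolding Finite_Cartesian_Product.vec_eq_iff using zero[OF that] zero[OF ai] m_component by auto
  then have ex1: "\<exists>!i. admissible (int n * lo) i" using ai by blast
  moreover have "int n * lo < int n * hi" using lo_less_hi n0 by simp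
  ultimately show "int n * lo \<in> \<Xi>" by (simp add: Xi_iff)
  have "\<phi> i = (int n - 1) * lo" using ai adm by simp
  then show "step (int n * lo) (int n * lo)" unfolding interval_step_iff
    using ai n0 by (intro exI[of _ i]) (simp add: left_diff_distrib)
qed

text \<open>The loop keeps at least one walk of every length, so walk counts do not decay. It makes
  the bound on the dimension a non-negative real instead of possibly -\<infinity>.\<close>

lemma graph_radius_Xi_ge_1: "graph_radius \<Xi> step \<ge> 1"
proof (rule ccontr)
  let ?u = "int n * lo"
  assume "\<not> ?thesis"
  then obtain \<sigma> where \<sigma>: "graph_radius \<Xi> step < \<sigma>" "\<sigma> < 1" using dense[of "graph_radius \<Xi> step" 1] by auto
  then have \<sigma>0: "0 \<le> \<sigma>" using graph_radius_nonneg[OF finite_Xi, of step] by simp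
  obtain C where C: "C \<ge> 0" "\<And>k v. v \<in> \<Xi> \<Longrightarrow> real (nwalks \<Xi> step k v) \<le> C * \<sigma> ^ k"
    using nwalks_growth[OF finite_Xi \<sigma>(1)] by blast
  have ge: "1 \<le> nwalks \<Xi> step k ?u" for k
  proof (induction k)
    case (Suc k)
    have "nwalks \<Xi> step k ?u \<le> (\<Sum>w\<in>{w\<in>\<Xi>. step ?u w}. nwalks \<Xi> step k w)"
      by (rule member_le_sum) (use lo_loop finite_Xi in auto)
    then show ?case using Suc by simp
  qed simp
  have "(\<lambda>k. C * \<sigma> ^ k) \<longlonglongrightarrow> C * 0"
    using \<sigma> \<sigma>0 by (intro tendsto_mult tendsto_const LIMSEQ_power_zero) auto
  then have "eventually (\<lambda>k. C * \<sigma> ^ k < 1) sequentially" using order_tendstoD(2) by fastforce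
  then obtain k where "C * \<sigma> ^ k < 1" by (auto simp: eventually_sequentially)
  then show False using C(2)[OF lo_loop(1), of k] ge[of k] by linarith
qed

lemma dim_le_radius:
  assumes "r > 0"
  shows "hausdorff_dim (multiplicity_set K m r) \<le> log_ratio n (graph_radius \<Xi> step)"
proof -
  define s0 where "s0 = ln (graph_radius \<Xi> step) / ln (real n)"
  have s0: "s0 \<ge> 0" using graph_radius_Xi_ge_1 n2 by (simp add: s0_def)
  have lr: "log_ratio n (graph_radius \<Xi> step) = ereal s0"
    using graph_radius_Xi_ge_1 by (simp add: log_ratio_def s0_def)
  show ?thesis unfolding lr
  proof (rule hausdorff_dim_leI[OF s0])
    fix s assume "s0 < s"
    then show "hausdorff_measure s (multiplicity_set K m r) = 0"
      using s0 Xi.radius_powr_less[OF finite_Xi, of s] lr by (intro multiplicity_set_null[OF assms]) auto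
  qed
qed

end

section \<open>Exit times and infinite measure\<close>

lemma irreducible_connected:
  assumes fin: "finite V" and irr: "irreducible_nonneg_mat (adjacency_mat (digraph_of V R))"
    and uv: "u \<in> V" "v \<in> V"
  shows "(u, v) \<in> (edges V R)\<^sup>*"
proof -
  define vs where "vs = vertex_list (digraph_of V R)"
  have vs: "set vs = V" unfolding vs_def using vertex_list_digraph_of[OF fin] by simp
  define M where "M = adjacency_mat (digraph_of V R)"
  have M: "M \<in> carrier_mat (length vs) (length vs)"
    by (simp add: M_def adjacency_mat_def Let_def vs_def)
  have entry: "(vs ! i, vs ! j) \<in> edges V R" if "i < length vs" "j < length vs" "M $$ (i, j) \<noteq> 0" for i j
    using that unfolding M_def adjacency_mat_def Let_def vs_def[symmetric] arcs_ends_digraph_of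
    by (auto split: if_splits)
  have pow: "(vs ! i, vs ! j) \<in> (edges V R)\<^sup>*"
    if "i < length vs" "j < length vs" "(M ^\<^sub>m k) $$ (i, j) \<noteq> 0" for i j k
    using that
  proof (induction k arbitrary: j)
    case 0
    then show ?case using M by (cases "i = j") auto
  next
    case (Suc k)
    have Mk: "M ^\<^sub>m k \<in> carrier_mat (length vs) (length vs)" using M by simp
    have "(M ^\<^sub>m Suc k) $$ (i, j) = (\<Sum>l\<in>{0..<length vs}. (M ^\<^sub>m k) $$ (i, l) * M $$ (l, j))"
      using M Mk Suc.prems(1,2) by (auto simp: scalar_prod_def intro!: sum.cong)
    then obtain l where l: "l < length vs" "(M ^\<^sub>m k) $$ (i, l) * M $$ (l, j) \<noteq> 0"
      using Suc.prems(3) by (metis (no_types, lifting) atLeastLessThan_iff sum.not_neutral_contains_not_neutral)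
    then have "(vs ! i, vs ! l) \<in> (edges V R)\<^sup>*" using Suc.IH[OF Suc.prems(1) l(1)] by simp
    moreover have "(vs ! l, vs ! j) \<in> edges V R" using entry[OF l(1) Suc.prems(2)] l(2) by simp
    ultimately show ?case by (rule rtrancl_into_rtrancl)
  qed
  obtain i j where ij: "i < length vs" "u = vs ! i" "j < length vs" "v = vs ! j"
    using uv vs by (metis in_set_conv_nth)
  have "dim_row M = length vs" using M by simp
  then obtain k where "(M ^\<^sub>m k) $$ (i, j) > 0"
    using irr ij unfolding irreducible_nonneg_mat_def M_def[symmetric] by metis
  then show ?thesis using pow[of i j k] ij by simp
qed

lemma ennreal_multiples_bounded:
  fixes X c :: ennreal
  assumes c: "c \<noteq> 0" and le: "\<And>j::nat. of_nat j * c \<le> X"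
  shows "X = \<infinity>"
proof (cases c)
  case top
  then show ?thesis using le[of 1] by (simp add: top.extremum_unique)
next
  case (real e)
  then have e: "e > 0" using c by auto
  show ?thesis
  proof (cases X)
    case (real x)
    obtain j :: nat where "x < real j * e" using reals_Archimedean3[OF e] by blast
    moreover have "ennreal (real j * e) \<le> ennreal x"
      using le[of j] \<open>c = ennreal e\<close> \<open>X = ennreal x\<close> e by (simp add: ennreal_mult ennreal_of_nat_eq_real_of_nat)
    ultimately show ?thesis using real(1) by (simp add: ennreal_le_iff)
  qed simp
qed

context digit_projection
begin

abbreviation "U \<equiv> multiplicity_set K m"

text \<open>Counts the forced shifts made before the current interval first lies outside \<Xi>.
  Points staying in \<Xi> for ever, and n-adic points, have no exit time.\<close>

inductive exits :: "real \<Rightarrow> nat \<Rightarrow> bool" where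
  exits_0: "\<lbrakk>x \<notin> nadic n; \<lfloor>real n * x\<rfloor> \<notin> \<Xi>\<rbrakk> \<Longrightarrow> exits x 0"
| exits_Suc: "\<lbrakk>x \<notin> nadic n; \<lfloor>real n * x\<rfloor> \<in> \<Xi>; exits (real n * x - real_of_int (\<phi> (dig \<lfloor>real n * x\<rfloor>))) N\<rbrakk>
    \<Longrightarrow> exits x (Suc N)"

lemma exits_nadic: "exits x N \<Longrightarrow> x \<notin> nadic n"
  by (auto elim: exits.cases)

lemma exits_unique: "exits x N \<Longrightarrow> exits x N' \<Longrightarrow> N = N'"
proof (induction arbitrary: N' rule: exits.induct)
  case (exits_0 x)
  from exits_0.prems show ?case
  proof cases
    case (exits_Suc N)
    then show ?thesis using exits_0.hyps by simp
  qed simp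
next
  case (exits_Suc x N)
  from exits_Suc.prems show ?case
  proof cases
    case exits_0
    then show ?thesis using exits_Suc.hyps by simp
  next
    case (exits_Suc N'')
    then show ?thesis using \<open>\<And>N'. exits (real n * x - real_of_int (\<phi> (dig \<lfloor>real n * x\<rfloor>))) N' \<Longrightarrow> N = N'\<close> by simp
  qed
qed

lemma floor_div_power: "\<lfloor>real n ^ (a + b) * x\<rfloor> div int n ^ b = \<lfloor>real n ^ a * x\<rfloor>"
proof -
  have "real n ^ (a + b) * x / real_of_int (int n ^ b) = real n ^ a * x" using n0 by (simp add: power_add)
  then show ?thesis using floor_divide_real_eq_div[of "int n ^ b" "real n ^ (a + b) * x"] by simp
qed

text \<open>An exit at time \<open>N\<close> is decided by the integer part and the first
  \<open>N + 1\<close> fractional digits. Exit times up to \<open>M\<close> are therefore functions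
  of a floor, as \<open>hausdorff_measure_sum_le\<close> requires.\<close>

lemma exits_cong:
  assumes "exits x N" "y \<notin> nadic n" "\<lfloor>real n ^ Suc M * x\<rfloor> = \<lfloor>real n ^ Suc M * y\<rfloor>" "N \<le> M"
  shows "exits y N"
  using assms
proof (induction arbitrary: y M rule: exits.induct)
  case (exits_0 x)
  have "\<lfloor>real n * x\<rfloor> = \<lfloor>real n * y\<rfloor>"
    using floor_div_power[of 1 M x] floor_div_power[of 1 M y] exits_0 by simp
  then show ?case using exits_0 by (intro exits.exits_0) auto
next
  case (exits_Suc x N)
  then obtain M' where M': "M = Suc M'" by (cases M) auto
  have fl: "\<lfloor>real n * x\<rfloor> = \<lfloor>real n * y\<rfloor>"
    using floor_div_power[of 1 M x] floor_div_power[of 1 M y] exits_Suc by simp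
  have "\<lfloor>real n ^ Suc M' * (real n * z - real_of_int a)\<rfloor> = \<lfloor>real n ^ Suc M * z\<rfloor> - int n ^ Suc M' * a" for z a
  proof -
    have "real n ^ Suc M' * (real n * z - real_of_int a) = real n ^ Suc M * z - real_of_int (int n ^ Suc M' * a)"
      by (simp add: M' algebra_simps)
    then show ?thesis by (simp only: floor_diff_of_int)
  qed
  then have "exits (real n * y - real_of_int (\<phi> (dig \<lfloor>real n * y\<rfloor>))) N"
    using exits_Suc.IH[of "real n * y - real_of_int (\<phi> (dig \<lfloor>real n * y\<rfloor>))" M'] exits_Suc.prems fl nadic_step M' by simp
  then show ?case using exits_Suc fl by (intro exits.exits_Suc) auto
qed

lemma U_step:
  assumes "x \<notin> nadic n" "\<lfloor>real n * x\<rfloor> \<in> \<Xi>"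
  shows "real n * x - real_of_int (\<phi> (dig \<lfloor>real n * x\<rfloor>)) \<in> U r \<longleftrightarrow> x \<in> U r"
  using card_F_Xi[OF assms] by (simp add: multiplicity_set_def)

text \<open>A point that never leaves \<Xi> has one preimage, which \<open>r \<ge> 2\<close>
  excludes; shifts inside \<Xi> preserve the number of preimages, so the exit point is again in
  \<open>U r\<close>.\<close>

lemma U_exit_cover:
  assumes x: "x \<in> U r" "x \<notin> nadic n" and r: "r \<ge> 2"
  shows "x \<in> spread n {v\<in>U r. exits v 0}" (is "x \<in> ?E")
proof (rule ccontr)
  assume neg: "x \<notin> ?E"
  define S where "S = {x\<in>U r. x \<notin> nadic n \<and> x \<notin> ?E}"
  have S: "x \<notin> nadic n \<and> \<lfloor>real n * x\<rfloor> \<in> \<Xi> \<and> real n * x - real_of_int (\<phi> (dig \<lfloor>real n * x\<rfloor>)) \<in> S" if "x \<in> S" for x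
  proof -
    have x: "x \<in> U r" "x \<notin> nadic n" "x \<notin> ?E" using that by (auto simp: S_def)
    have u: "\<lfloor>real n * x\<rfloor> \<in> \<Xi>"
    proof (rule ccontr)
      assume "\<lfloor>real n * x\<rfloor> \<notin> \<Xi>"
      then have "exits x 0" using x by (intro exits_0)
      moreover have "x = (real_of_int 0 + x) / real n ^ 0" by simp
      ultimately have "x \<in> ?E" unfolding spread_def using x(1) by blast
      then show False using x by simp
    qed
    have "real n * x - real_of_int (\<phi> (dig \<lfloor>real n * x\<rfloor>)) \<notin> ?E"
      using spread_pull[OF n0(1), of 1 x] x(3) by auto
    then show ?thesis using u x U_step[OF x(2) u] nadic_step by (simp add: S_def)
  qed
  have xS: "x \<in> S" using x neg by (simp add: S_def)
  have "coded_Xi \<lfloor>real n * x\<rfloor> (real n * x - real_of_int \<lfloor>real n * x\<rfloor>)" by (rule coded_Xi_coinduct[OF S xS])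
  then have "card (F ((real_of_int \<lfloor>real n * x\<rfloor> + (real n * x - real_of_int \<lfloor>real n * x\<rfloor>)) / real n)) = 1"
    using S[OF xS] nadic_step by (intro coded_Xi_card) auto
  then have "card (F x) = 1" using n0 by simp
  then show False using x(1) r by (simp add: multiplicity_set_def)
qed

text \<open>Since \<open>u - ty u\<close> is \<open>\<phi> (dig u)\<close>, \<open>y\<close> is the
  point that the forced shift in the interval \<open>u\<close> sends to \<open>x\<close>; the exit
  time grows by one and the multiplicity is kept.\<close>

lemma exits_pull:
  assumes u: "u \<in> \<Xi>" and x: "exits x N" "\<lfloor>x\<rfloor> = ty u" "x \<in> U r"
  defines "y \<equiv> (real_of_int (u - ty u) + x) / real n"
  shows "exits y (Suc N)" "\<lfloor>real n * y\<rfloor> = u" "y \<in> U r"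
proof -
  have ny: "real n * y = real_of_int (u - ty u) + x" using n0 by (simp add: y_def)
  show fl: "\<lfloor>real n * y\<rfloor> = u" unfolding ny using x(2) by linarith
  have nd: "y \<notin> nadic n" using exits_nadic[OF x(1)] nadic_div_power[OF n0(1), of "u - ty u" x 1] by (simp add: y_def)
  have bk: "real n * y - real_of_int (\<phi> (dig \<lfloor>real n * y\<rfloor>)) = x"
    unfolding fl by (simp add: ny ty_def)
  show "exits y (Suc N)" by (rule exits_Suc) (use nd fl u x bk in auto)
  show "y \<in> U r" using U_step[of y r] nd fl u x bk by auto
qed

text \<open>The integer u n^k + Q spells the whole walk including its start; \<open>ty v\<close> is
  subtracted because it is the integer part of \<open>x\<close>, already accounted for by the last
  vertex.\<close>

lemma exits_walk:
  assumes "walk_code n \<Xi> step (\<lambda>u. u mod int n) k u v Q" "u \<in> \<Xi>"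
    "exits x 0" "\<lfloor>x\<rfloor> = ty v" "x \<in> U r"
  shows "let y = (real_of_int (u * int n ^ k + Q - ty v) + x) / real n ^ Suc k in
    exits y (Suc k) \<and> \<lfloor>real n * y\<rfloor> = u \<and> y \<in> U r"
  using assms
proof (induction rule: walk_code.induct)
  case (walk_code_0 v)
  then show ?case using exits_pull[of v x 0 r] by (simp add: Let_def)
next
  case (walk_code_Suc w u k v Q)
  define x1 where "x1 = (real_of_int (w * int n ^ k + Q - ty v) + x) / real n ^ Suc k"
  have IH: "exits x1 (Suc k)" "\<lfloor>real n * x1\<rfloor> = w" "x1 \<in> U r"
    using walk_code_Suc.IH walk_code_Suc.hyps(1) walk_code_Suc.prems by (auto simp: Let_def x1_def)
  have tw: "w div int n = ty u" using walk_code_Suc.hyps(2) walk_code_Suc.prems(1) by (simp add: step_Xi)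
  have "\<lfloor>x1\<rfloor> = ty u" using floor_div_scaled[OF n0(1), of x1] IH(2) tw by simp
  from exits_pull[OF walk_code_Suc.prems(1) IH(1) this IH(3)]
  have *: "exits ((real_of_int (u - ty u) + x1) / real n) (Suc (Suc k))"
     "\<lfloor>real n * ((real_of_int (u - ty u) + x1) / real n)\<rfloor> = u" "(real_of_int (u - ty u) + x1) / real n \<in> U r" by auto
  have "w mod int n = w - int n * ty u" unfolding tw[symmetric] by (rule minus_mult_div_eq_mod[symmetric])
  then have wr: "real_of_int (w mod int n) = real_of_int w - real n * real_of_int (ty u)" by simp
  have "(real_of_int (u * int n ^ Suc k + (w mod int n * int n ^ k + Q) - ty v) + x) / real n ^ Suc (Suc k) =
      (real_of_int (u - ty u) + x1) / real n"
    unfolding x1_def using n0 by (simp add: wr field_simps)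
  then show ?case using * by (simp only: Let_def)
qed

lemma graph_Xi_eq: "graph_Xi n A m = digraph_of \<Xi> step"
  by (simp add: graph_Xi_def)

text \<open>The balance: walks of length k in the dominating component number at least n^(s k) up to
  a constant, and pulling back along one of them scales measures by n^(-s k) up to a constant. So
  the loss does not accumulate with k.\<close>

lemma infinite_measure:
  assumes r: "r \<ge> 2" and s: "s > 0" and pos: "hausdorff_measure s (U r) \<noteq> 0" and dom: "dominated n A m (ereal s)"
  shows "hausdorff_measure s (U r) = \<infinity>"
proof -
  define V where "V t = {v\<in>U r. exits v 0 \<and> \<lfloor>v\<rfloor> = t}" for t
  \<comment> \<open>Up to n-adic points, \<open>U r\<close> is covered by the countably many copies
    of the finitely many \<open>V t\<close>, so these cannot all be null.\<close>
  have "\<exists>t\<in>{lo..hi - 1}. hausdorff_measure s (V t) \<noteq> 0"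
  proof (rule ccontr)
    assume "\<not> ?thesis"
    then have V0: "hausdorff_measure s (V t) = 0" if "t \<in> {lo..hi - 1}" for t using that by blast
    have "U r - nadic n \<subseteq> (\<Union>t\<in>{lo..hi - 1}. spread n (V t))"
    proof
      fix x assume "x \<in> U r - nadic n"
      then have "x \<in> spread n {v\<in>U r. exits v 0}" using U_exit_cover[OF _ _ r, of x] by blast
      then obtain k q v where *: "v \<in> U r" "exits v 0" "x = (real_of_int q + v) / real n ^ k"
        by (auto simp: spread_def)
      have nv: "v \<notin> nadic n" using exits_nadic[OF *(2)] .
      have "F v \<noteq> {}" using *(1) r by (auto simp: multiplicity_set_def)
      then have lh: "real_of_int lo \<le> v" "v \<le> real_of_int hi" using F_range by auto
      have "v \<noteq> real_of_int hi" using nv Ints_nadic[of "real_of_int hi" n] by auto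
      then have "\<lfloor>v\<rfloor> \<in> {lo..hi - 1}" using lh by (auto simp: le_floor_iff floor_less_iff)
      moreover have "x \<in> spread n (V \<lfloor>v\<rfloor>)" unfolding spread_def V_def using * by blast
      ultimately show "x \<in> (\<Union>t\<in>{lo..hi - 1}. spread n (V t))" by blast
    qed
    moreover have "hausdorff_measure s (\<Union>t\<in>{lo..hi - 1}. spread n (V t)) = 0"
      by (rule hausdorff_null_UN_countable)
        (use V0 hausdorff_null_spread[OF s n0(1)] in \<open>auto intro!: countable_finite\<close>)
    ultimately have "hausdorff_measure s (U r - nadic n) = 0" by (rule hausdorff_null_subset)
    then show False using hausdorff_null_diff_countable[OF s countable_nadic[OF n0(1)]] pos by blast
  qed
  then obtain t where t: "t \<in> {lo..hi - 1}" "hausdorff_measure s (V t) \<noteq> 0" by blast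
  have "t \<in> working_types m" using t(1) by (simp add: working_types_def)
  then obtain H where H: "H \<in> strong_components (digraph_of \<Xi> step)" "component_reaches n A m H t"
    "ereal s \<le> log_ratio n (component_radius (digraph_of \<Xi> step) H)"
    using dom unfolding dominated_def graph_Xi_eq by blast
  have HX: "H \<subseteq> \<Xi>" "finite H" "residue_graph n H step (\<lambda>u. u mod int n)" using Xi.component_subgraph[OF H(1)] by auto
  interpret H: residue_graph n H step "\<lambda>u. u mod int n" by (rule HX(3))
  have Hne: "H \<noteq> {}" using H(1) by (simp add: strong_components_digraph_of)
  obtain u0 v where uv: "u0 \<in> H" "v \<in> \<Xi>" "(u0, v) \<in> (edges \<Xi> step)\<^sup>*" "of_type A m v t"
    using H(2) unfolding component_reaches_def graph_Xi_eq reachable_digraph_of by blast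
  have tv: "ty v = t" using of_type_Xi[OF uv(2)] uv(4) by simp
  have rad: "real n powr s \<le> graph_radius H step"
  proof (rule ccontr)
    assume "\<not> ?thesis"
    then have lt: "graph_radius H step < real n powr s" by simp
    have lr: "ereal s \<le> log_ratio n (graph_radius H step)"
      using H(3) by (simp add: component_radius_def induce_subgraph_digraph_of[OF HX(1)])
    then have g0: "graph_radius H step \<noteq> 0" by (auto simp: log_ratio_def)
    then have g: "graph_radius H step > 0" using graph_radius_nonneg[OF HX(2), of step] by simp
    have "ln (graph_radius H step) < ln (real n powr s)" using lt g n0 by (subst ln_less_cancel_iff) auto
    then have "ln (graph_radius H step) < s * ln (real n)" using n0 by (simp add: ln_powr)
    then have "ln (graph_radius H step) / ln (real n) < s" using n2 by (simp add: pos_divide_less_eq)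
    then show False using lr g0 by (simp add: log_ratio_def)
  qed
  obtain i0 where i0: "i0 \<in> H" "\<And>k. graph_radius H step ^ k \<le> real (nwalks H step k i0)"
    using nwalks_ge_radius_power[OF HX(2) Hne] by blast
  have "\<exists>j q. walk_code n \<Xi> step (\<lambda>u. u mod int n) j w v q" if "w \<in> H" for w
  proof -
    have "(w, u0) \<in> (edges \<Xi> step)\<^sup>*" using H(1) that uv(1) unfolding strong_components_digraph_of by blast
    then have "(w, v) \<in> (edges \<Xi> step)\<^sup>*" using uv(3) by (rule rtrancl_trans)
    then show ?thesis by (rule walk_code_exists)
  qed
  \<comment> \<open>One connecting walk from each vertex of \<open>H\<close> to the vertex
    \<open>v\<close> of type \<open>t\<close>, chosen once, so that its length is bounded
    independently of \<open>k\<close>.\<close>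
  then obtain j q where jq: "\<And>w. w \<in> H \<Longrightarrow> walk_code n \<Xi> step (\<lambda>u. u mod int n) (j w) w v (q w)" by metis
  define L where "L = Max (j ` H)"
  have L: "j w \<le> L" if "w \<in> H" for w unfolding L_def using that HX(2) by simp
  define E where "E N = {x\<in>U r. exits x N}" for N
  \<comment> \<open>\<open>card H\<close> is lost to the pigeonhole on end vertices, and the power
    of n to the connecting walk and the extra digit: the exit time is k + j w + 1 \<le> k + L +
    1.\<close>
  define c where "c = ennreal (real n powr (- s * real (Suc L)) / real (card H)) * hausdorff_measure s (V t)"
  have cardH: "card H > 0" using HX(2) Hne by (simp add: card_gt_0_iff)
  have c0: "c \<noteq> 0" unfolding c_def using t(2) n0 cardH by simp
  have many: "\<exists>N>k. c \<le> 2 * hausdorff_measure s (E N)" for k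
  proof -
    obtain w where w: "w \<in> H" "nwalks H step k i0 \<le> card H * card {Q. walk_code n H step (\<lambda>u. u mod int n) k i0 w Q}"
      using H.nwalks_pigeonhole[OF i0(1)] by blast
    let ?C = "{Q. walk_code n H step (\<lambda>u. u mod int n) k i0 w Q}"
    have finC: "finite ?C" by (rule finite_subset[OF _ H.card_walk_codes(1)[OF i0(1), of k]]) auto
    define N where "N = Suc (k + j w)"
    define g where "g Q = i0 * int n ^ (k + j w) + (Q * int n ^ j w + q w)" for Q
    have inj: "inj_on g ?C" using n0 by (auto simp: inj_on_def g_def)
    have ge: "ennreal ((1 / real n ^ N) powr s) * hausdorff_measure s (V t) \<le>
        hausdorff_measure s {x\<in>E N. \<lfloor>real n ^ N * x\<rfloor> = g Q}" if "Q \<in> ?C" for Q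
    proof -
      have wc: "walk_code n \<Xi> step (\<lambda>u. u mod int n) (k + j w) i0 v (Q * int n ^ j w + q w)"
        using that by (intro walk_code_append[OF _ jq[OF w(1)]] walk_code_mono[OF _ HX(1)]) simp
      have "(\<lambda>x. (real_of_int (g Q - t) + x) / real n ^ N) ` V t \<subseteq> {x\<in>E N. \<lfloor>real n ^ N * x\<rfloor> = g Q}"
      proof
        fix y assume "y \<in> (\<lambda>x. (real_of_int (g Q - t) + x) / real n ^ N) ` V t"
        then obtain x where x: "x \<in> U r" "exits x 0" "\<lfloor>x\<rfloor> = t" "y = (real_of_int (g Q - t) + x) / real n ^ N"
          by (auto simp: V_def)
        have "i0 \<in> \<Xi>" "\<lfloor>x\<rfloor> = ty v" using i0(1) HX(1) x(3) tv by auto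
        from exits_walk[OF wc this(1) x(2) this(2) x(1)] have "exits y N \<and> y \<in> U r"
          unfolding Let_def x(4) g_def N_def tv by simp
        moreover have "real n ^ N * y = real_of_int (g Q - t) + x" using n0 by (simp add: x(4))
        then have "\<lfloor>real n ^ N * y\<rfloor> = g Q" using x(3) by (simp add: floor_add2)
        ultimately show "y \<in> {x\<in>E N. \<lfloor>real n ^ N * x\<rfloor> = g Q}" by (simp add: E_def)
      qed
      from hausdorff_measure_mono[OF this, of s] show ?thesis
        using hausdorff_measure_affine[OF s, of "real n ^ N"] n0 by simp
    qed
    have "c \<le> ennreal (real (card ?C) * (1 / real n ^ N) powr s) * hausdorff_measure s (V t)"
      unfolding c_def
    proof (intro mult_right_mono ennreal_leI)
      have "(real n powr s) ^ k \<le> graph_radius H step ^ k" using rad by (intro power_mono) auto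
      also have "\<dots> \<le> real (nwalks H step k i0)" by (rule i0(2))
      also have "\<dots> \<le> real (card H) * real (card ?C)" using of_nat_mono[OF w(2), where ?'a = real] by simp
      finally have "(real n powr s) ^ k / real (card H) \<le> real (card ?C)"
        using cardH by (simp add: pos_divide_le_eq mult.commute)
      moreover have "(real n powr s) ^ k = real n powr (s * real k)" using n0 by (simp add: powr_powr flip: powr_realpow)
      ultimately have C: "real n powr (s * real k) / real (card H) \<le> real (card ?C)" by simp
      have N: "(1 / real n ^ N) powr s = real n powr (- s * real N)"
        using n0 by (simp add: powr_divide powr_powr powr_minus_divide mult.commute flip: powr_realpow)
      have "real n powr (- s * real (Suc L)) / real (card H) \<le> real n powr (s * real k + - s * real N) / real (card H)"
        using L[OF w(1)] n2 s by (intro divide_right_mono powr_mono) (auto simp: N_def algebra_simps)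
      also have "\<dots> = real n powr (s * real k) / real (card H) * real n powr (- s * real N)" by (simp only: powr_add) simp
      also have "\<dots> \<le> real (card ?C) * real n powr (- s * real N)" by (rule mult_right_mono[OF C]) simp
      finally show "real n powr (- s * real (Suc L)) / real (card H) \<le> real (card ?C) * (1 / real n ^ N) powr s"
        unfolding N .
    qed simp
    also have "\<dots> = (\<Sum>Q\<in>?C. ennreal ((1 / real n ^ N) powr s) * hausdorff_measure s (V t))"
      by (simp add: ennreal_mult ennreal_of_nat_eq_real_of_nat mult.assoc)
    also have "\<dots> \<le> (\<Sum>Q\<in>?C. hausdorff_measure s {x\<in>E N. \<lfloor>real n ^ N * x\<rfloor> = g Q})"
      by (rule sum_mono) (rule ge)
    also have "\<dots> = (\<Sum>a\<in>g ` ?C. hausdorff_measure s {x\<in>E N. \<lfloor>real n ^ N * x\<rfloor> = a})"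
      by (simp add: sum.reindex[OF inj])
    also have "\<dots> \<le> 2 * hausdorff_measure s (E N)"
      by (rule hausdorff_measure_sum_le[of "real n ^ N" _ _ "\<lambda>a. a"]) (use n0 finC in auto)
    finally show ?thesis by (intro exI[of _ N]) (simp add: N_def)
  qed
  then have inf: "infinite {N. c \<le> 2 * hausdorff_measure s (E N)}" by (auto simp: infinite_nat_iff_unbounded)
  have "of_nat l * c \<le> 4 * hausdorff_measure s (U r)" for l
  proof -
    obtain S where S: "finite S" "card S = l" "S \<subseteq> {N. c \<le> 2 * hausdorff_measure s (E N)}"
      using infinite_arbitrarily_large[OF inf] by blast
    define M where "M = Max (insert 0 S)"
    have M: "N \<le> M" if "N \<in> S" for N unfolding M_def using that S(1) by simp
    define E' where "E' = {x\<in>U r. \<exists>N\<in>S. exits x N}"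
    \<comment> \<open>Recovers the exit time from the leading digits; by \<open>exits_cong\<close>
      and \<open>exits_unique\<close> the choice does not matter.\<close>
    define h where "h a = (SOME N. N \<in> S \<and> (\<exists>x\<in>E'. \<lfloor>real n ^ Suc M * x\<rfloor> = a \<and> exits x N))" for a
    have h: "h \<lfloor>real n ^ Suc M * x\<rfloor> = N" if x: "x \<in> E'" "exits x N" for x N
    proof -
      have "\<exists>N. N \<in> S \<and> (\<exists>x'\<in>E'. \<lfloor>real n ^ Suc M * x'\<rfloor> = \<lfloor>real n ^ Suc M * x\<rfloor> \<and> exits x' N)"
        using x(1) unfolding E'_def by blast
      from someI_ex[OF this] obtain x' where x': "h \<lfloor>real n ^ Suc M * x\<rfloor> \<in> S" "x' \<in> E'"
        "\<lfloor>real n ^ Suc M * x'\<rfloor> = \<lfloor>real n ^ Suc M * x\<rfloor>" "exits x' (h \<lfloor>real n ^ Suc M * x\<rfloor>)"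
        unfolding h_def by blast
      have "exits x (h \<lfloor>real n ^ Suc M * x\<rfloor>)"
        by (rule exits_cong[OF x'(4) exits_nadic[OF x(2)] x'(3) M[OF x'(1)]])
      then show ?thesis using exits_unique x(2) by blast
    qed
    have EN: "E N \<subseteq> {x\<in>E'. h \<lfloor>real n ^ Suc M * x\<rfloor> = N}" if "N \<in> S" for N
      using that h unfolding E_def by (auto simp: E'_def)
    have "of_nat l * c = (\<Sum>N\<in>S. c)" using S by simp
    also have "\<dots> \<le> (\<Sum>N\<in>S. 2 * hausdorff_measure s {x\<in>E'. h \<lfloor>real n ^ Suc M * x\<rfloor> = N})"
    proof (rule sum_mono)
      fix N assume N: "N \<in> S"
      then have "c \<le> 2 * hausdorff_measure s (E N)" using S(3) by blast
      also have "\<dots> \<le> 2 * hausdorff_measure s {x\<in>E'. h \<lfloor>real n ^ Suc M * x\<rfloor> = N}"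
        by (intro mult_left_mono hausdorff_measure_mono EN[OF N]) auto
      finally show "c \<le> 2 * hausdorff_measure s {x\<in>E'. h \<lfloor>real n ^ Suc M * x\<rfloor> = N}" .
    qed
    also have "\<dots> = 2 * (\<Sum>N\<in>S. hausdorff_measure s {x\<in>E'. h \<lfloor>real n ^ Suc M * x\<rfloor> = N})"
      by (simp add: sum_distrib_left)
    also have "\<dots> \<le> 2 * (2 * hausdorff_measure s E')"
      by (intro mult_left_mono hausdorff_measure_sum_le[of "real n ^ Suc M" _ _ h]) (use n0 S in auto)
    also have "\<dots> \<le> 2 * (2 * hausdorff_measure s (U r))"
      by (intro mult_left_mono hausdorff_measure_mono) (auto simp: E'_def)
    also have "\<dots> = 4 * hausdorff_measure s (U r)" by (simp flip: mult.assoc)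
    finally show ?thesis .
  qed
  from ennreal_multiples_bounded[OF c0 this] show ?thesis
    by (simp add: ennreal_mult_eq_top_iff)
qed

text \<open>Irreducibility makes all of \<Xi> one strong component, whose radius is that of the
  whole matrix; the assumption on \<open>d\<close> is then the dimension bound of part (1).\<close>

lemma irreducible_dominated:
  assumes irr: "irreducible_nonneg_mat (adjacency_mat (graph_Xi n A m))"
    and reach: "\<forall>t\<in>working_types m. Xi_reaches n A m t"
    and d: "d \<le> log_ratio n (graph_radius \<Xi> step)"
  shows "dominated n A m d"
  unfolding dominated_def
proof
  fix t assume t: "t \<in> working_types m"
  have scc: "\<Xi> \<in> strong_components (digraph_of \<Xi> step)"
    unfolding strong_components_digraph_of
    using lo_loop(1) irreducible_connected[OF finite_Xi irr[unfolded graph_Xi_eq]] by blast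
  have "component_reaches n A m \<Xi> t" using reach t unfolding Xi_reaches_def component_reaches_def by blast
  moreover have "component_radius (graph_Xi n A m) \<Xi> = graph_radius \<Xi> step"
    by (simp add: component_radius_def graph_Xi_eq induce_subgraph_digraph_of)
  ultimately show "\<exists>H\<in>strong_components (graph_Xi n A m). component_reaches n A m H t \<and>
      log_ratio n (component_radius (graph_Xi n A m) H) \<ge> d"
    using scc d unfolding graph_Xi_eq by (intro bexI[of _ \<Xi>]) auto
qed

end

section \<open>Strong separation and congruent sets\<close>

locale separated_digit_projection = digit_projection +
  assumes separation: "\<And>k. strong_separation (A k)"
begin

text \<open>Two expansions of the same number force neighbouring first digits, since the tails lie
  in [0, 1]; strong separation forbids such digits.\<close>

lemma cons_inject:
  assumes i: "i \<in> P" "i' \<in> P" and y: "y \<in> KK" "y' \<in> KK" and eq: "cons i y = cons i' y'"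
  shows "i = i'" "y = y'"
proof -
  show "i = i'"
  proof (rule ccontr)
    assume "i \<noteq> i'"
    then obtain k where k: "i $ k \<noteq> i' $ k" by (metis Finite_Cartesian_Product.vec_eq_iff)
    have "y $ k + real_of_int (i $ k) = y' $ k + real_of_int (i' $ k)"
      using arg_cong[OF eq, of "\<lambda>v. v $ k"] n0 unfolding cons_nth by simp
    moreover have "0 \<le> y $ k" "y $ k \<le> 1" "0 \<le> y' $ k" "y' $ k \<le> 1"
      using y KK_cube by (auto simp: cube_def)
    ultimately have "i $ k - i' $ k = 1 \<or> i' $ k - i $ k = 1" using k by linarith
    moreover have "i $ k \<in> A k" "i' $ k \<in> A k" using i by (auto simp: digit_vectors_def)
    ultimately have "1 \<in> {a - b |a b. a \<in> A k \<and> b \<in> A k}" by (auto intro: exI[of _ "i $ k"] exI[of _ "i' $ k"])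
    then show False using separation[of k] by (simp add: strong_separation_def)
  qed
  then show "y = y'" using eq inj_cons[of i UNIV] by (simp add: inj_eq)
qed

lemma foldr_cons_KK: "w \<in> words k \<Longrightarrow> y \<in> KK \<Longrightarrow> foldr cons w y \<in> KK"
proof (induction k arbitrary: w)
  case (Suc k)
  then obtain i w' where w: "i \<in> P" "w' \<in> words k" "w = i # w'" using words_Suc by blast
  have "foldr cons w' y \<in> KK" using Suc w by blast
  then have "cons i (foldr cons w' y) \<in> KK" using w(1) KK_image by blast
  then show ?case using w(3) by simp
qed (simp add: words_0)

lemma foldr_cons_inject:
  assumes "w \<in> words k" "w' \<in> words k" "y \<in> KK" "y' \<in> KK" "foldr cons w y = foldr cons w' y'"
  shows "w = w' \<and> y = y'"
  using assms
proof (induction k arbitrary: w w')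
  case (Suc k)
  obtain i v where w: "i \<in> P" "v \<in> words k" "w = i # v" using Suc.prems(1) words_Suc by blast
  obtain i' v' where w': "i' \<in> P" "v' \<in> words k" "w' = i' # v'" using Suc.prems(2) words_Suc by blast
  have eq: "cons i (foldr cons v y) = cons i' (foldr cons v' y')" using Suc.prems(5) w(3) w'(3) by simp
  note inject = cons_inject[OF w(1) w'(1) foldr_cons_KK[OF w(2) Suc.prems(3)] foldr_cons_KK[OF w'(2) Suc.prems(4)] eq]
  show ?case using Suc.IH[OF w(2) w'(2) Suc.prems(3,4) inject(2)] inject(1) w(3) w'(3) by simp
qed (simp add: words_0)

text \<open>Distinct words give disjoint images, so cardinalities add. Finiteness of the parts
  matters because \<open>card\<close> of an infinite set is 0.\<close>

lemma card_F_words: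
  assumes "\<And>w. w \<in> words k \<Longrightarrow> finite (F (real n ^ k * x - real_of_int (val w)))"
  shows "card (F x) = (\<Sum>w\<in>words k. card (F (real n ^ k * x - real_of_int (val w))))"
proof -
  let ?X = "\<lambda>w. F (real n ^ k * x - real_of_int (val w))"
  have inj: "inj_on (foldr cons w) (?X w)" if "w \<in> words k" for w
    using foldr_cons_inject[OF that that] by (auto simp: inj_on_def F_iff)
  have "card (F x) = card (\<Union>w\<in>words k. foldr cons w ` ?X w)" using F_words[of x k] by simp
  also have "\<dots> = (\<Sum>w\<in>words k. card (foldr cons w ` ?X w))"
  proof (rule card_UN_disjoint[OF finite_words])
    show "\<forall>w\<in>words k. finite (foldr cons w ` ?X w)" using assms by blast
    show "\<forall>w\<in>words k. \<forall>w'\<in>words k. w \<noteq> w' \<longrightarrow> foldr cons w ` ?X w \<inter> foldr cons w' ` ?X w' = {}"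
    proof (intro ballI impI)
      fix w w' assume w: "w \<in> words k" "w' \<in> words k" "w \<noteq> w'"
      show "foldr cons w ` ?X w \<inter> foldr cons w' ` ?X w' = {}"
      proof (rule ccontr)
        assume "\<not> ?thesis"
        then obtain y y' where "y \<in> ?X w" "y' \<in> ?X w'" "foldr cons w y = foldr cons w' y'" by blast
        then show False using foldr_cons_inject[OF w(1,2), of y y'] w(3) by (simp add: F_iff)
      qed
    qed
  qed
  also have "\<dots> = (\<Sum>w\<in>words k. card (?X w))"
    by (rule sum.cong[OF refl]) (rule card_image[OF inj])
  finally show ?thesis .
qed

text \<open>Two admissible digit vectors would give two different preimages, so under separation a
  singleton fibre lies over \<Xi> at once, not only after some shifts.\<close>

lemma singleton_fibre_Xi:
  assumes x: "x \<notin> nadic n" and c: "card (F x) = 1"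
  shows "\<lfloor>real n * x\<rfloor> \<in> \<Xi>"
proof -
  obtain y where y: "F x = {y}" using c by (auto simp: card_1_singleton_iff)
  obtain i where i: "i \<in> P" "F (real n * x - real_of_int (\<phi> i)) \<noteq> {}" using y F_rec[of x] by blast
  have "i' = i" if i': "admissible \<lfloor>real n * x\<rfloor> i'" for i'
  proof -
    have P: "i' \<in> P" using i' by (simp add: admissible_def)
    then have "F (real n * x - real_of_int (\<phi> i')) \<noteq> {}" using admissible_floor[OF x] i' by blast
    then obtain a b where ab: "a \<in> F (real n * x - real_of_int (\<phi> i'))" "b \<in> F (real n * x - real_of_int (\<phi> i))"
      using i(2) by blast
    then have "cons i' a \<in> F x" "cons i b \<in> F x" using F_rec[of x] P i(1) by blast+
    then have eq: "cons i' a = cons i b" using y by simp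
    have "a \<in> KK" "b \<in> KK" using ab by (simp_all add: F_iff)
    from cons_inject(1)[OF P i(1) this eq] show ?thesis .
  qed
  moreover have "admissible \<lfloor>real n * x\<rfloor> i" using admissible_floor[OF x i(1)] i(2) by blast
  ultimately show ?thesis using Xi_floor[OF x] y by blast
qed

section \<open>The graph of congruent sets\<close>

definition congruent_sets :: "int set set" where
  "congruent_sets = {\<omega>. \<omega> \<subseteq> \<Xi> \<and> congruent_subset n \<omega>}"

definition star_step :: "int set \<Rightarrow> int set \<Rightarrow> bool" where
  "star_step \<omega> \<omega>' \<longleftrightarrow> (\<forall>u\<in>\<omega>. \<exists>v\<in>\<omega>'. step u v) \<and> (\<forall>v\<in>\<omega>'. \<exists>u\<in>\<omega>. step u v)"

text \<open>Any element serves, as all elements of a congruent set have the same residue.\<close>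

definition residue :: "int set \<Rightarrow> int" where "residue \<omega> = (SOME u. u \<in> \<omega>) mod int n"

lemma graph_star_eq: "graph_star n A m = digraph_of congruent_sets star_step"
  unfolding graph_star_def congruent_sets_def star_step_def ..

lemma residue_eq: "\<omega> \<in> congruent_sets \<Longrightarrow> u \<in> \<omega> \<Longrightarrow> u mod int n = residue \<omega>"
proof -
  assume \<omega>: "\<omega> \<in> congruent_sets" and u: "u \<in> \<omega>"
  have "(SOME u. u \<in> \<omega>) \<in> \<omega>" using u by (rule someI)
  then have "[u = (SOME u. u \<in> \<omega>)] (mod int n)"
    using \<omega> u by (simp add: congruent_sets_def congruent_subset_def)
  then show ?thesis by (simp add: residue_def cong_def)
qed

text \<open>For \<open>resolving\<close>: an element of one target has a predecessor in \<omega>,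
  which also has a successor in the other target; equal residues make the two successors
  equal.\<close>

sublocale star: residue_graph n congruent_sets star_step residue
proof
  show "finite congruent_sets" using finite_Xi by (simp add: congruent_sets_def)
  show "0 \<le> residue \<omega> \<and> residue \<omega> < int n" for \<omega> using n0 by (simp add: residue_def)
  have sub: "\<omega>1 \<subseteq> \<omega>2" if *: "\<omega> \<in> congruent_sets" "\<omega>1 \<in> congruent_sets" "\<omega>2 \<in> congruent_sets"
    "star_step \<omega> \<omega>1" "star_step \<omega> \<omega>2" "residue \<omega>1 = residue \<omega>2" for \<omega> \<omega>1 \<omega>2
  proof
    fix v assume v: "v \<in> \<omega>1"
    then obtain u where u: "u \<in> \<omega>" "step u v" using * by (auto simp: star_step_def)
    then obtain v' where v': "v' \<in> \<omega>2" "step u v'" using * by (auto simp: star_step_def)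
    have X: "u \<in> \<Xi>" "v \<in> \<Xi>" "v' \<in> \<Xi>" using * u v v' by (auto simp: congruent_sets_def)
    have "v mod int n = v' mod int n" using residue_eq * v v' by metis
    then have "v = v'" using Xi.resolving[OF X u(2) v'(2)] by simp
    then show "v \<in> \<omega>2" using v' by simp
  qed
  show "\<omega>1 = \<omega>2" if "\<omega> \<in> congruent_sets" "\<omega>1 \<in> congruent_sets" "\<omega>2 \<in> congruent_sets"
    "star_step \<omega> \<omega>1" "star_step \<omega> \<omega>2" "residue \<omega>1 = residue \<omega>2" for \<omega> \<omega>1 \<omega>2
    using sub[OF that] sub[OF that(1,3,2,5,4)] that(6) by auto
qed (rule n2)

abbreviation "coded_star \<equiv> coded n congruent_sets star_step residue"

lemma coded_star_Xi:
  assumes "\<omega> \<in> congruent_sets" "u \<in> \<omega>" "coded_star \<omega> z"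
  shows "coded_Xi u z"
proof -
  have "\<exists>\<omega>\<in>congruent_sets. u \<in> \<omega> \<and> coded_star \<omega> z" using assms by blast
  then show ?thesis
  proof (coinduction arbitrary: u z)
    case coded
    then obtain \<omega> where \<omega>: "\<omega> \<in> congruent_sets" "u \<in> \<omega>" "coded_star \<omega> z" by blast
    then obtain \<omega>' z' where *: "\<omega>' \<in> congruent_sets" "star_step \<omega> \<omega>'" "0 \<le> z" "z \<le> 1"
      "real n * z = real_of_int (residue \<omega>') + z'" "coded_star \<omega>' z'" by (auto elim: coded.cases)
    obtain v where v: "v \<in> \<omega>'" "step u v" using *(2) \<omega>(2) by (auto simp: star_step_def)
    have "v \<in> \<Xi>" using v *(1) by (auto simp: congruent_sets_def)
    moreover have "real n * z = real_of_int (v mod int n) + z'" using *(5) residue_eq[OF *(1) v(1)] by simp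
    moreover have "\<exists>\<omega>\<in>congruent_sets. v \<in> \<omega> \<and> coded_star \<omega> z'" using *(1,6) v(1) by blast
    ultimately show ?case using v(2) *(3,4) by blast
  qed
qed

text \<open>Links G* to multiplicities: the elements of \<omega> are simultaneous positions with the
  common fractional part \<open>z\<close>. If all of them have single fibres, so do their shifts,
  and the next vertex is forced.\<close>

lemma coded_star_iff:
  assumes \<omega>: "\<omega> \<in> congruent_sets" and z: "z \<notin> nadic n" "0 \<le> z" "z \<le> 1"
  shows "coded_star \<omega> z \<longleftrightarrow> (\<forall>u\<in>\<omega>. card (F ((real_of_int u + z) / real n)) = 1)"
proof
  assume "coded_star \<omega> z"
  then have "card (F ((real_of_int u + z) / real n)) = 1" if u: "u \<in> \<omega>" for u
    using coded_star_Xi[OF \<omega> u] \<omega> u z(1) by (intro coded_Xi_card) (auto simp only: congruent_sets_def)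
  then show "\<forall>u\<in>\<omega>. card (F ((real_of_int u + z) / real n)) = 1" by blast
next
  assume "\<forall>u\<in>\<omega>. card (F ((real_of_int u + z) / real n)) = 1"
  with assms have "\<omega> \<in> congruent_sets \<and> z \<notin> nadic n \<and> 0 \<le> z \<and> z \<le> 1 \<and>
     (\<forall>u\<in>\<omega>. card (F ((real_of_int u + z) / real n)) = 1)" by blast
  then show "coded_star \<omega> z"
  proof (coinduction arbitrary: \<omega> z)
    case coded
    then have \<omega>: "\<omega> \<in> congruent_sets" and z: "z \<notin> nadic n" "0 \<le> z" "z \<le> 1"
      and one: "\<And>u. u \<in> \<omega> \<Longrightarrow> card (F ((real_of_int u + z) / real n)) = 1" by auto
    define e where "e = \<lfloor>real n * z\<rfloor>"
    define z' where "z' = real n * z - real_of_int e"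
    \<comment> \<open>The quotients are dictated by the types and the residue by the next digit
      \<open>e\<close> of \<open>z\<close>, so this is the only possible successor set.\<close>
    define \<omega>' where "\<omega>' = (\<lambda>u. int n * ty u + e) ` \<omega>"
    have z01: "0 < z" "z < 1" using nadic_interior[OF z] by auto
    have nz': "z' \<notin> nadic n" "0 \<le> z'" "z' \<le> 1"
      using z(1) nadic_step by (auto simp: z'_def e_def) linarith+
    have e: "0 \<le> e" "e < int n" unfolding e_def le_floor_iff floor_less_iff using z01 n0 by auto
    have X: "u \<in> \<Xi>" if "u \<in> \<omega>" for u using \<omega> that by (auto simp: congruent_sets_def)
    have one': "card (F ((real_of_int (int n * ty u + e) + z') / real n)) = 1" if u: "u \<in> \<omega>" for u
    proof -
      let ?x = "(real_of_int u + z) / real n"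
      have nx: "real n * ?x = real_of_int u + z" using n0 by simp
      have fl: "\<lfloor>real n * ?x\<rfloor> = u" unfolding nx using z01 by linarith
      have nd: "?x \<notin> nadic n" using z(1) nadic_div_power[OF n0(1), of u z 1] by simp
      have "real n * ?x - real_of_int (\<phi> (dig u)) = (real_of_int (int n * ty u + e) + z') / real n"
        unfolding nx ty_def z'_def using n0 by (simp add: field_simps)
      then show ?thesis using card_F_Xi[OF nd] fl X[OF u] one[OF u] by simp
    qed
    have Xi': "int n * ty u + e \<in> \<Xi>" if u: "u \<in> \<omega>" for u
    proof -
      let ?x = "(real_of_int (int n * ty u + e) + z') / real n"
      have nx: "real n * ?x = real_of_int (int n * ty u + e) + z'" using n0 by simp
      have "\<lfloor>real n * ?x\<rfloor> = int n * ty u + e"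
        unfolding nx using nadic_interior[OF nz'] by linarith
      moreover have "?x \<notin> nadic n" using nz'(1) nadic_div_power[OF n0(1), of "int n * ty u + e" z' 1] by simp
      ultimately show ?thesis using singleton_fibre_Xi[OF _ one'[OF u]] by simp
    qed
    have md: "(int n * ty u + e) mod int n = e" for u using e by simp
    have "\<omega>' \<in> congruent_sets"
      using Xi' \<omega> md unfolding congruent_sets_def congruent_subset_def \<omega>'_def by (auto simp: cong_def)
    moreover have "star_step \<omega> \<omega>'"
      unfolding star_step_def \<omega>'_def using X e by (auto simp: step_Xi)
    moreover have "residue \<omega>' = e"
    proof -
      obtain u where "u \<in> \<omega>" using \<omega> by (auto simp: congruent_sets_def congruent_subset_def)
      then have "int n * ty u + e \<in> \<omega>'" by (auto simp: \<omega>'_def)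
      from residue_eq[OF \<open>\<omega>' \<in> congruent_sets\<close> this] show ?thesis using md by simp
    qed
    moreover have "\<forall>v\<in>\<omega>'. card (F ((real_of_int v + z') / real n)) = 1" using one' by (auto simp: \<omega>'_def)
    ultimately show ?case using z nz'
      by (intro exI[of _ \<omega>'] exI[of _ \<omega>] exI[of _ z] exI[of _ z']) (auto simp: z'_def)
  qed
qed

text \<open>A prefix and a vertex such that everything coded from \<omega>, apart from n-adic
  points, lands in \<open>U r\<close>. Hence U_r contains a full similar copy, not just single
  points.\<close>

definition good :: "nat \<Rightarrow> nat \<Rightarrow> int \<Rightarrow> int set \<Rightarrow> bool" where
  "good r k Q \<omega> \<longleftrightarrow> \<omega> \<in> congruent_sets \<and>
     (\<forall>z. z \<notin> nadic n \<longrightarrow> coded_star \<omega> z \<longrightarrow> (real_of_int Q + z) / real n ^ k \<in> U r)"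

text \<open>Which words carry a part of the fibre depends only on the digits \<open>Q\<close>.
  Replacing the remaining fractional part by any other one that gives single fibres therefore leaves
  the number of preimages unchanged.\<close>

lemma U_good_cover:
  assumes r: "r > 0" and x: "x \<in> U r" "x \<notin> nadic n"
  shows "\<exists>k Q \<omega> z. good r k Q \<omega> \<and> coded_star \<omega> z \<and> x = (real_of_int Q + z) / real n ^ k"
proof -
  have cx: "card (F x) = r" using x(1) by (simp add: multiplicity_set_def)
  then have finF: "finite (F x)" using r by (simp add: card_gt_0_iff[of "F x", THEN iffD1])
  obtain k where k: "\<And>w y y'. w \<in> words k \<Longrightarrow> y \<in> F (real n ^ k * x - real_of_int (val w)) \<Longrightarrow>
     y' \<in> F (real n ^ k * x - real_of_int (val w)) \<Longrightarrow> y = y'"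
    using finite_fibre_separation[OF finF] by blast
  \<comment> \<open>One digit beyond the separating length \<open>k\<close>: the shifted points
    become (u w + z0) / n with integers \<open>u w\<close> and a common fractional part.\<close>
  define Q where "Q = \<lfloor>real n ^ Suc k * x\<rfloor>"
  define z0 where "z0 = real n ^ Suc k * x - real_of_int Q"
  have z0: "z0 \<notin> nadic n" "0 \<le> z0" "z0 \<le> 1"
    using nadic_power[OF n0(1), of "Suc k" x Q] x(2) unfolding z0_def Q_def by (auto simp del: power_Suc) linarith+
  define u where "u w = Q - int n * val w" for w
  define T where "T = {w\<in>words k. int n * lo \<le> u w \<and> u w < int n * hi}"
  have fT: "finite T" using finite_words by (simp add: T_def)
  have X: "real n ^ k * ((real_of_int Q + z) / real n ^ Suc k) - real_of_int (val w) = (real_of_int (u w) + z) / real n" for z w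
    unfolding u_def using n0 by (simp add: field_simps)
  have ne: "F ((real_of_int (u w) + z) / real n) \<noteq> {} \<longleftrightarrow> w \<in> T"
    if w: "w \<in> words k" and z: "z \<notin> nadic n" "0 \<le> z" "z \<le> 1" for w z
  proof -
    have z01: "0 < z" "z < 1" using nadic_interior[OF z] by auto
    have "real_of_int lo \<le> (real_of_int (u w) + z) / real n \<longleftrightarrow> real_of_int (int n * lo) \<le> real_of_int (u w) + z"
      using n0 by (simp add: pos_le_divide_eq mult.commute)
    also have "\<dots> \<longleftrightarrow> int n * lo \<le> u w" using z01 by linarith
    finally have 1: "real_of_int lo \<le> (real_of_int (u w) + z) / real n \<longleftrightarrow> int n * lo \<le> u w" .
    have "(real_of_int (u w) + z) / real n \<le> real_of_int hi \<longleftrightarrow> real_of_int (u w) + z \<le> real_of_int (int n * hi)"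
      using n0 by (simp add: pos_divide_le_eq mult.commute)
    also have "\<dots> \<longleftrightarrow> u w < int n * hi" using z01 by linarith
    finally show ?thesis unfolding F_nonempty_iff T_def using 1 w by simp
  qed
  have sum_T: "card (F ((real_of_int Q + z) / real n ^ Suc k)) = card T"
    if z: "z \<notin> nadic n" "0 \<le> z" "z \<le> 1" and one: "\<And>w. w \<in> T \<Longrightarrow> card (F ((real_of_int (u w) + z) / real n)) = 1" for z
  proof -
    have emp: "F ((real_of_int (u w) + z) / real n) = {}" if "w \<in> words k - T" for w using ne[of w z] z that by blast
    have "finite (F ((real_of_int (u w) + z) / real n))" if "w \<in> words k" for w
      using emp[of w] one[of w] that card.infinite by fastforce
    then have "card (F ((real_of_int Q + z) / real n ^ Suc k)) = (\<Sum>w\<in>words k. card (F ((real_of_int (u w) + z) / real n)))"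
      using card_F_words[of k "(real_of_int Q + z) / real n ^ Suc k"] unfolding X by blast
    also have "\<dots> = (\<Sum>w\<in>T. 1)"
      by (rule sum.mono_neutral_cong_right) (use emp one finite_words in \<open>auto simp: T_def\<close>)
    finally show ?thesis by simp
  qed
  have xz: "x = (real_of_int Q + z0) / real n ^ Suc k" unfolding z0_def using n0 by simp
  have one0: "card (F ((real_of_int (u w) + z0) / real n)) = 1" if w: "w \<in> T" for w
  proof -
    have wk: "w \<in> words k" using w by (simp add: T_def)
    have "real n ^ k * x - real_of_int (val w) = (real_of_int (u w) + z0) / real n" using X[of z0 w] xz by simp
    then obtain y where "F ((real_of_int (u w) + z0) / real n) = {y}"
      using ne[OF wk z0] w k[OF wk] by (metis is_singletonI' is_singleton_the_elem)
    then show ?thesis by simp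
  qed
  \<comment> \<open>The count runs over words, not over positions: different words may share the
    same \<open>u w\<close>, so \<omega> can have fewer than \<open>r\<close> elements.\<close>
  have rT: "card T = r" using sum_T[OF z0 one0] cx unfolding xz[symmetric] by simp
  define \<omega> where "\<omega> = u ` T"
  have "\<omega> \<noteq> {}" using rT r by (auto simp: \<omega>_def)
  moreover have "\<omega> \<subseteq> \<Xi>"
  proof
    fix a assume "a \<in> \<omega>"
    then obtain w where w: "w \<in> T" "a = u w" by (auto simp: \<omega>_def)
    let ?x = "(real_of_int a + z0) / real n"
    have nx: "real n * ?x = real_of_int a + z0" using n0 by simp
    have "\<lfloor>real n * ?x\<rfloor> = a" unfolding nx using nadic_interior[OF z0] by linarith
    moreover have "?x \<notin> nadic n" using z0(1) nadic_div_power[OF n0(1), of a z0 1] by simp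
    ultimately show "a \<in> \<Xi>" using singleton_fibre_Xi[of ?x] one0[OF w(1)] w(2) by simp
  qed
  moreover have "u w mod int n = Q mod int n" for w
    unfolding u_def by (metis mod_mult_self2 add.commute diff_add_cancel mult.commute)
  ultimately have \<omega>: "\<omega> \<in> congruent_sets"
    by (auto simp: congruent_sets_def congruent_subset_def \<omega>_def cong_def)
  have "good r (Suc k) Q \<omega>"
    unfolding good_def
  proof (intro conjI allI impI \<omega>)
    fix z assume z: "z \<notin> nadic n" and c: "coded_star \<omega> z"
    have z01: "0 \<le> z" "z \<le> 1" using coded_bounds[OF c] by auto
    have "\<forall>a\<in>\<omega>. card (F ((real_of_int a + z) / real n)) = 1" using coded_star_iff[OF \<omega> z z01] c by blast
    then have "card (F ((real_of_int Q + z) / real n ^ Suc k)) = card T"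
      by (intro sum_T[OF z z01]) (auto simp: \<omega>_def)
    then show "(real_of_int Q + z) / real n ^ Suc k \<in> U r" using rT by (simp add: multiplicity_set_def)
  qed
  moreover have "coded_star \<omega> z0" using coded_star_iff[OF \<omega> z0] one0 by (auto simp: \<omega>_def)
  ultimately show ?thesis using xz by blast
qed

text \<open>Only finitely many vertices are good for some prefix. One with the largest exponent
  supplies both the dimension and the positive measure, and its strong component is the witness
  \<open>H\<close>.\<close>

lemma dimension_dichotomy:
  assumes r: "r > 0" and unc: "\<not> countable (U r)"
  obtains H s where "H \<in> strong_components (graph_star n A m)" "s > 0"
    "max_exponent n A m H = ereal s" "hausdorff_dim (U r) = ereal s" "hausdorff_measure s (U r) \<noteq> 0"
proof -
  define W where "W = {\<omega>. \<exists>k Q. good r k Q \<omega>}"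
  have W: "W \<subseteq> congruent_sets" by (auto simp: W_def good_def)
  have finW: "finite W" by (rule finite_subset[OF W star.fin])
  define c where "c \<omega> = {\<omega>'\<in>congruent_sets. (\<omega>', \<omega>) \<in> (edges congruent_sets star_step)\<^sup>* \<and> (\<omega>, \<omega>') \<in> (edges congruent_sets star_step)\<^sup>*}" for \<omega>
  have c: "c \<omega> \<in> strong_components (digraph_of congruent_sets star_step)" "\<omega> \<in> c \<omega>" if "\<omega> \<in> W" for \<omega>
    using strong_component_of[of \<omega> congruent_sets star_step] that W by (auto simp: c_def)
  define e where "e \<omega> = star.component_exponent (c \<omega>)" for \<omega>
  have cov: "U r - nadic n \<subseteq> (\<Union>\<omega>\<in>W. spread n {z. coded_star \<omega> z})"
  proof
    fix x assume "x \<in> U r - nadic n"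
    then obtain k Q \<omega> z where "good r k Q \<omega>" "coded_star \<omega> z" "x = (real_of_int Q + z) / real n ^ k"
      using U_good_cover[OF r, of x] by blast
    then show "x \<in> (\<Union>\<omega>\<in>W. spread n {z. coded_star \<omega> z})" unfolding W_def spread_def by blast
  qed
  have "\<exists>\<omega>\<in>W. e \<omega> > 0"
  proof (rule ccontr)
    assume "\<not> ?thesis"
    then have "countable {z. coded_star \<omega> z}" if "\<omega> \<in> W" for \<omega>
      using star.coded_countable_exponent[OF c(2,1)[OF that]] that by (auto simp: e_def not_less)
    then have "countable (\<Union>\<omega>\<in>W. spread n {z. coded_star \<omega> z})"
      using finW by (intro countable_UN countable_spread) (auto intro: countable_finite)
    then have "countable (U r - nadic n)" using cov countable_subset by blast
    then have "countable ((U r - nadic n) \<union> nadic n)" by (rule countable_Un[OF _ countable_nadic[OF n0(1)]])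
    then have "countable (U r)" by (rule countable_subset[rotated]) auto
    then show False using unc by simp
  qed
  then obtain \<omega>1 where \<omega>1: "\<omega>1 \<in> W" "e \<omega>1 > 0" by blast
  obtain \<omega>0 where \<omega>0: "\<omega>0 \<in> W" "e \<omega>0 = Max (e ` W)" using Max_in[of "e ` W"] finW \<omega>1(1) by fastforce
  have max: "e \<omega> \<le> e \<omega>0" if "\<omega> \<in> W" for \<omega> unfolding \<omega>0(2) using finW that by simp
  have "e \<omega>0 > 0" using max[OF \<omega>1(1)] \<omega>1(2) by simp
  then obtain s where s: "s > 0" "e \<omega>0 = ereal s" "hausdorff_measure s {z. coded_star \<omega>0 z} \<noteq> 0"
    unfolding e_def using star.coded_positive_exponent[OF c(2,1)[OF \<omega>0(1)]] \<omega>0(1) by blast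
  have pos: "hausdorff_measure s (U r) \<noteq> 0"
  proof
    assume 0: "hausdorff_measure s (U r) = 0"
    obtain k Q where "good r k Q \<omega>0" using \<omega>0(1) by (auto simp: W_def)
    \<comment> \<open>\<open>good\<close> says nothing about n-adic points; removing them is
      harmless because s > 0.\<close>
    then have "(\<lambda>z. (real_of_int Q + z) / real n ^ k) ` ({z. coded_star \<omega>0 z} - nadic n) \<subseteq> U r"
      by (auto simp: good_def)
    from hausdorff_null_subset[OF this 0] have "hausdorff_measure s ({z. coded_star \<omega>0 z} - nadic n) = 0"
      using hausdorff_null_affine[OF s(1)] n0 by simp
    then show False using hausdorff_null_diff_countable[OF s(1) countable_nadic[OF n0(1)]] s(3) by blast
  qed
  have "hausdorff_dim (U r) = ereal s"
  proof (rule hausdorff_dim_eqI[OF _ _ pos])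
    fix t assume t: "s < t"
    have "hausdorff_measure t (\<Union>\<omega>\<in>W. spread n {z. coded_star \<omega> z}) = 0"
    proof (rule hausdorff_null_UN_countable[OF countable_finite[OF finW]])
      fix \<omega> assume i: "\<omega> \<in> W"
      have "e \<omega> \<le> ereal s" using max[OF i] s(2) by simp
      also have "\<dots> < ereal t" using t by simp
      finally have "star.component_exponent (c \<omega>) < ereal t" by (simp add: e_def)
      then have "hausdorff_measure t {z. coded_star \<omega> z} = 0"
        using star.coded_null_exponent[OF c(2,1)[OF i]] i t s(1) by auto
      then show "hausdorff_measure t (spread n {z. coded_star \<omega> z}) = 0"
        using hausdorff_null_spread[OF _ n0(1)] t s(1) by simp
    qed
    then have "hausdorff_measure t (U r - nadic n) = 0" by (rule hausdorff_null_subset[OF cov])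
    then show "hausdorff_measure t (U r) = 0"
      using hausdorff_null_diff_countable[OF _ countable_nadic[OF n0(1)]] t s(1) by simp
  qed (use s in simp)
  moreover have "max_exponent n A m (c \<omega>0) = ereal s"
  proof -
    have "component_radius (digraph_of congruent_sets star_step) H' = graph_radius H' star_step"
      if "H' \<in> strong_components (digraph_of congruent_sets star_step)" for H'
      using star.component_subgraph(3)[OF that] by (simp add: component_radius_def induce_subgraph_digraph_of)
    then have "{log_ratio n (component_radius (digraph_of congruent_sets star_step) H') | H'.
        H' \<in> strong_components (digraph_of congruent_sets star_step) \<and> component_le (digraph_of congruent_sets star_step) (c \<omega>0) H'} =
      {log_ratio n (graph_radius H' star_step) | H'.
        H' \<in> strong_components (digraph_of congruent_sets star_step) \<and> component_le (digraph_of congruent_sets star_step) (c \<omega>0) H'}"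
      by (intro Collect_cong ex_cong1) auto
    then show ?thesis using s(2) unfolding max_exponent_def Let_def graph_star_eq e_def star.component_exponent_def by simp
  qed
  ultimately show ?thesis using that[of "c \<omega>0" s] c(1)[OF \<omega>0(1)] s(1) pos unfolding graph_star_eq by blast
qed

end

theorem theorem3:
  fixes n r :: nat
    and A :: "'l::finite \<Rightarrow> int set"
    and K :: "'l \<Rightarrow> real set"
    and m :: "int ^ 'l"
    and d :: ereal
  assumes "n \<ge> 2"
    and "\<And>k. A k \<noteq> {}"
    and "\<And>k. A k \<subseteq> {0 .. int n - 1}"
    and "\<And>k. is_self_similar_set n (A k) (K k)"
    and "(\<Prod>k\<in>UNIV. m $ k) \<noteq> 0"
    and "covering_condition n A m"
    and "r \<ge> 2"
    and "multiplicity_set K m r \<noteq> {}"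
    and "d = hausdorff_dim (multiplicity_set K m r)"
  shows "d \<le> log_ratio n (real_spectral_radius (adjacency_mat (graph_Xi n A m)))
    \<and> ((\<forall>k. strong_separation (A k)) \<longrightarrow>
         countable (multiplicity_set K m r) \<or>
         (d \<in> {max_exponent n A m H | H. H \<in> strong_components (graph_star n A m)} - {0} \<and>
          hausdorff_measure (real_of_ereal d) (multiplicity_set K m r) > 0))
    \<and> ((\<forall>k. strong_separation (A k)) \<and> d > 0 \<and> dominated n A m d \<longrightarrow>
         hausdorff_measure (real_of_ereal d) (multiplicity_set K m r) = \<infinity>)
    \<and> ((\<forall>k. strong_separation (A k)) \<and> d > 0 \<and>
       irreducible_nonneg_mat (adjacency_mat (graph_Xi n A m)) \<and>
       (\<forall>t \<in> working_types m. Xi_reaches n A m t) \<longrightarrow>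
         hausdorff_measure (real_of_ereal d) (multiplicity_set K m r) = \<infinity>)"
proof -
  interpret digit_projection n A K m by unfold_locales (rule assms)+
  have r0: "r > 0" using assms(7) by simp
  have dim: "d \<le> log_ratio n (real_spectral_radius (adjacency_mat (graph_Xi n A m)))"
    unfolding assms(9) graph_Xi_eq by (rule dim_le_radius[OF r0])
  have uncountable_case: "\<exists>H s. H \<in> strong_components (graph_star n A m) \<and> s > 0 \<and> max_exponent n A m H = ereal s \<and>
      d = ereal s \<and> hausdorff_measure s (multiplicity_set K m r) \<noteq> 0"
    if "\<forall>k. strong_separation (A k)" "\<not> countable (multiplicity_set K m r)"
  proof -
    interpret separated_digit_projection n A K m by unfold_locales (use that(1) in blast)
    show ?thesis using dimension_dichotomy[OF r0 that(2)] unfolding assms(9) by metis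
  qed
  have inf: "hausdorff_measure (real_of_ereal d) (multiplicity_set K m r) = \<infinity>"
    if "\<forall>k. strong_separation (A k)" "d > 0" "dominated n A m d"
  proof -
    \<comment> \<open>Positive dimension rules out the countable alternative, so the positive
      measure needed for \<open>infinite_measure\<close> comes from the dichotomy.\<close>
    have "\<not> countable (multiplicity_set K m r)" using hausdorff_dim_countable that(2) unfolding assms(9) by force
    from uncountable_case[OF that(1) this] obtain s where "s > 0" "d = ereal s"
      "hausdorff_measure s (multiplicity_set K m r) \<noteq> 0" by blast
    then show ?thesis using infinite_measure[OF assms(7), of s] that(3) by simp
  qed
  show ?thesis
  proof (intro conjI impI)
    assume sep: "\<forall>k. strong_separation (A k)"
    show "countable (multiplicity_set K m r) \<or>
         (d \<in> {max_exponent n A m H | H. H \<in> strong_components (graph_star n A m)} - {0} \<and>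
          hausdorff_measure (real_of_ereal d) (multiplicity_set K m r) > 0)"
    proof (cases "countable (multiplicity_set K m r)")
      case False
      from uncountable_case[OF sep this] obtain H s where H: "H \<in> strong_components (graph_star n A m)" "s > 0"
        "max_exponent n A m H = ereal s" "d = ereal s" "hausdorff_measure s (multiplicity_set K m r) \<noteq> 0" by blast
      have "d \<in> {max_exponent n A m H | H. H \<in> strong_components (graph_star n A m)}"
        using H(1,3,4) by (intro CollectI exI[of _ H]) simp
      then show ?thesis using H(2,4,5) by (simp add: zero_less_iff_neq_zero)
    qed simp
  next
    assume "(\<forall>k. strong_separation (A k)) \<and> d > 0 \<and> dominated n A m d"
    then show "hausdorff_measure (real_of_ereal d) (multiplicity_set K m r) = \<infinity>" using inf by blast
  next
    assume *: "(\<forall>k. strong_separation (A k)) \<and> d > 0 \<and>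
       irreducible_nonneg_mat (adjacency_mat (graph_Xi n A m)) \<and> (\<forall>t \<in> working_types m. Xi_reaches n A m t)"
    have "dominated n A m d"
      by (rule irreducible_dominated) (use * dim in \<open>auto simp: graph_Xi_eq\<close>)
    then show "hausdorff_measure (real_of_ereal d) (multiplicity_set K m r) = \<infinity>" using inf * by blast
  qed (rule dim)
qed

end
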